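(* Let $X\in\mathbb{R}^p$ and $Y\in\mathbb{R}^q$ be independent, let $(X_1,Y_1),\ldots,(X_n,Y_n)$ be i.i.d. copies of $(X,Y)$, and fix (condition on) $U=(u_1,\ldots,u_K)\in(\mathcal{S}^{p-1})^K$ and $V=(v_1,\ldots,v_K)\in(\mathcal{S}^{q-1})^K$. Then, as $n\to\infty$, $$n\overline{\Omega}_n\xrightarrow{D}\sum_{i=1}^\infty\bar\lambda_i(Z_i^2-1)=\sum_{i=1}^\infty\bar\lambda_iZ_i^2-\sum_{i=1}^\infty\bar\lambda_i,$$ where $Z_i^2$ are i.i.d. $\chi^2_1$, and $$\sum_{i=1}^\infty\bar\lambda_i=\frac{C_pC_q}{K}\sum_{k=1}^K\mathbb{E}[|u_k^t(X-X')|]\,\mathbb{E}[|v_k^t(Y-Y')|],\qquad\sum_{i=1}^\infty\bar\lambda_i^2=\frac{C_p^2C_q^2}{K^2}\sum_{k,k'=1}^K\mathcal{V}^2(u_k^tX,u_{k'}^tX)\,\mathcal{V}^2(v_k^tY,v_{k'}^tY),$$ with $(X',Y')$ an independent copy of $(X,Y)$.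
   Context: $|\cdot|$ Euclidean norm; $C_p=\frac{\sqrt\pi\,\Gamma((p+1)/2)}{\Gamma(p/2)}$, similarly $C_q$. For univariate samples $x,y$ of size $n$: $a_{ij}=|x_i-x_j|$, $b_{ij}=|y_i-y_j|$, row sums $a_{i\cdot},b_{i\cdot}$, totals $a_{\cdot\cdot},b_{\cdot\cdot}$, and $\Omega_n(x,y)=\frac{1}{n(n-3)}\sum_{i\ne j}a_{ij}b_{ij}-\frac{2}{n(n-2)(n-3)}\sum_ia_{i\cdot}b_{i\cdot}+\frac{a_{\cdot\cdot}b_{\cdot\cdot}}{n(n-1)(n-2)(n-3)}$. $\overline{\Omega}_n=\frac1K\sum_{k=1}^KC_pC_q\Omega_n(u_k^tX,v_k^tY)$ with $u_k^tX=(u_k^tX_1,\ldots,u_k^tX_n)$. It is a U-statistic with kernel $\bar h_4=\frac1K\sum_kC_pC_qh_4$ applied to projected points, where $h_4((x_1,y_1),\ldots,(x_4,y_4))=\frac14\sum_{i\ne j}|x_i-x_j||y_i-y_j|-\frac14\sum_i(\sum_{j\ne i}|x_i-x_j|)(\sum_{j\ne i}|y_i-y_j|)+\frac1{24}(\sum_{i\ne j}|x_i-x_j|)(\sum_{i\ne j}|y_i-y_j|)$; $\bar h_2((x_1,y_1),(x_2,y_2))=\mathbb{E}[\bar h_4((x_1,y_1),(x_2,y_2),(X_3,Y_3),(X_4,Y_4))]$. The $\bar\lambda_i$ are the eigenvalues of the operator $g\mapsto\mathbb{E}_{(X_2,Y_2)}[6\bar h_2((x_1,y_1),(X_2,Y_2))g(X_2,Y_2)]$.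 $\mathcal{V}^2$ denotes distance covariance: $\mathcal{V}^2(A,B)=\mathbb{E}[|A-A'||B-B'|]-2\mathbb{E}[|A-A'||B-B''|]+\mathbb{E}[|A-A'|]\mathbb{E}[|B-B'|]$ for i.i.d. copies $(A,B),(A',B'),(A'',B'')$.
   Formalization: Finite second moments of X and Y are assumed in addition; without them the expectations in the formula for V²(u_k^tX, u_k^tX) are infinite and the expression for the sum of squared eigenvalues is undefined. *)

theory Defs
  imports "HOL-Probability.Probability"
begin

definition Cconst :: "nat \<Rightarrow> real" where
  "Cconst p = sqrt pi * Gamma ((real p + 1) / 2) / Gamma (real p / 2)"

definition Omega_n :: "nat \<Rightarrow> (nat \<Rightarrow> real) \<Rightarrow> (nat \<Rightarrow> real) \<Rightarrow> real" where
  "Omega_n n x y =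
    (let a = (\<lambda>i j. \<bar>x i - x j\<bar>); b = (\<lambda>i j. \<bar>y i - y j\<bar>);
         ar = (\<lambda>i. \<Sum>j<n. a i j); br = (\<lambda>i. \<Sum>j<n. b i j);
         sa = (\<Sum>i<n. ar i); sb = (\<Sum>i<n. br i);
         m = real n
     in (\<Sum>i<n. \<Sum>j<n. if i \<noteq> j then a i j * b i j else 0) / (m * (m - 3))
        - 2 / (m * (m - 2) * (m - 3)) * (\<Sum>i<n. ar i * br i)
        + sa * sb / (m * (m - 1) * (m - 2) * (m - 3)))"

definition Omegabar :: "nat \<Rightarrow> (nat \<Rightarrow> real^'p) \<Rightarrow> (nat \<Rightarrow> real^'q) \<Rightarrow> nat
    \<Rightarrow> (nat \<Rightarrow> real^'p) \<Rightarrow> (nat \<Rightarrow> real^'q) \<Rightarrow> real" where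
  "Omegabar K u v n x y =
     (1 / real K) * (\<Sum>k<K. Cconst CARD('p) * Cconst CARD('q) *
        Omega_n n (\<lambda>i. u k \<bullet> x i) (\<lambda>i. v k \<bullet> y i))"

definition h4 :: "(nat \<Rightarrow> real) \<Rightarrow> (nat \<Rightarrow> real) \<Rightarrow> real" where
  "h4 x y =
     1/4 * (\<Sum>i<4. \<Sum>j<4. if i \<noteq> j then \<bar>x i - x j\<bar> * \<bar>y i - y j\<bar> else 0)
   - 1/4 * (\<Sum>i<4. (\<Sum>j<4. if j \<noteq> i then \<bar>x i - x j\<bar> else 0) *
                    (\<Sum>j<4. if j \<noteq> i then \<bar>y i - y j\<bar> else 0))
   + 1/24 * (\<Sum>i<4. \<Sum>j<4. if i \<noteq> j then \<bar>x i - x j\<bar> else 0) *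
            (\<Sum>i<4. \<Sum>j<4. if i \<noteq> j then \<bar>y i - y j\<bar> else 0)"

definition hbar4 :: "nat \<Rightarrow> (nat \<Rightarrow> real^'p) \<Rightarrow> (nat \<Rightarrow> real^'q)
    \<Rightarrow> (nat \<Rightarrow> (real^'p) \<times> (real^'q)) \<Rightarrow> real" where
  "hbar4 K u v z = (1 / real K) * (\<Sum>k<K. Cconst CARD('p) * Cconst CARD('q) *
        h4 (\<lambda>i. u k \<bullet> fst (z i)) (\<lambda>i. v k \<bullet> snd (z i)))"

definition hbar2 :: "((real^'p) \<times> (real^'q)) measure \<Rightarrow> nat \<Rightarrow> (nat \<Rightarrow> real^'p) \<Rightarrow> (nat \<Rightarrow> real^'q)
    \<Rightarrow> (real^'p) \<times> (real^'q) \<Rightarrow> (real^'p) \<times> (real^'q) \<Rightarrow> real" where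
  "hbar2 \<mu> K u v z1 z2 =
     (\<integral>z3. (\<integral>z4. hbar4 K u v (\<lambda>i. [z1, z2, z3, z4] ! i) \<partial>\<mu>) \<partial>\<mu>)"

definition dcov :: "(real \<times> real) measure \<Rightarrow> real" where
  "dcov \<nu> =
     (\<integral>z. (\<integral>z'. \<bar>fst z - fst z'\<bar> * \<bar>snd z - snd z'\<bar> \<partial>\<nu>) \<partial>\<nu>)
   - 2 * (\<integral>z. (\<integral>z'. (\<integral>z''. \<bar>fst z - fst z'\<bar> * \<bar>snd z - snd z''\<bar> \<partial>\<nu>) \<partial>\<nu>) \<partial>\<nu>)
   + (\<integral>z. (\<integral>z'. \<bar>fst z - fst z'\<bar> \<partial>\<nu>) \<partial>\<nu>) * (\<integral>z. (\<integral>z'. \<bar>snd z - snd z'\<bar> \<partial>\<nu>) \<partial>\<nu>)"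

text \<open>lam enumerates the nonzero eigenvalues (with multiplicity, in some order, padded with
  zeros) of the integral operator g \<mapsto> (z \<mapsto> \<integral> kappa z z' g z' d mu(z')) on L^2(mu):
  the entries lam i \<noteq> 0 carry orthonormal eigenfunctions, and for every nonzero c these
  eigenfunctions exhaust the c-eigenspace (any c-eigenfunction orthogonal to all of them is 0).\<close>
definition kernel_eigen_enum :: "'b measure \<Rightarrow> ('b \<Rightarrow> 'b \<Rightarrow> real) \<Rightarrow> (nat \<Rightarrow> real) \<Rightarrow> bool" where
  "kernel_eigen_enum \<mu> \<kappa> lam \<longleftrightarrow>
    (\<exists>\<phi> :: nat \<Rightarrow> 'b \<Rightarrow> real.
       (\<forall>i. lam i \<noteq> 0 \<longrightarrow> \<phi> i \<in> borel_measurable \<mu> \<and> integrable \<mu> (\<lambda>z. (\<phi> i z)\<^sup>2) \<and>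
            (AE z in \<mu>. (\<integral>z'. \<kappa> z z' * \<phi> i z' \<partial>\<mu>) = lam i * \<phi> i z)) \<and>
       (\<forall>i j. lam i \<noteq> 0 \<longrightarrow> lam j \<noteq> 0 \<longrightarrow>
            (\<integral>z. \<phi> i z * \<phi> j z \<partial>\<mu>) = (if i = j then 1 else 0)) \<and>
       (\<forall>c g. c \<noteq> 0 \<longrightarrow> g \<in> borel_measurable \<mu> \<longrightarrow> integrable \<mu> (\<lambda>z. (g z)\<^sup>2) \<longrightarrow>
            (AE z in \<mu>. (\<integral>z'. \<kappa> z z' * g z' \<partial>\<mu>) = c * g z) \<longrightarrow>
            (\<forall>i. lam i = c \<longrightarrow> (\<integral>z. g z * \<phi> i z \<partial>\<mu>) = 0) \<longrightarrow>
            (AE z in \<mu>. g z = 0)))"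

end

theory Submission
  imports Defs "HOL-Real_Asymp.Real_Asymp"
begin

text \<open>Under independence \<open>6 * hbar2\<close> is the kernel \<open>\<kappa> = c \<Sum>\<^sub>k A\<^sub>k B\<^sub>k\<close> of doubly centred distances. In
  dimension one a distance is the squared \<open>L\<^sup>2\<close>-distance of two indicator functions, so \<open>\<kappa>\<close> is the
  Gram kernel of an explicit square integrable feature map \<open>\<Phi>\<close>. If some part of \<open>\<Phi>\<close> were orthogonal to
  all enumerated eigenfunctions, power iteration would produce a further eigenfunction; hence \<open>\<Phi>\<close> is the
  sum of its components along them. This gives the trace \<open>\<Sum> lam\<close> and the Hilbert-Schmidt norm
  \<open>\<Sum> lam\<^sup>2\<close>, which are then computed by Fubini.

  The V-statistic \<open>V\<^sub>n = \<Sum>\<^sub>j\<^sub>l \<kappa>(Z\<^sub>j, Z\<^sub>l) / n\<close> dominates its truncation to finitely many eigenfunctions and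
  has expectation \<open>\<Sum> lam\<close>, so that the truncation error is small in \<open>L\<^sup>1\<close> uniformly in \<open>n\<close>. The
  Laplace transform of the truncation is a Gaussian average of characteristic functions of linear
  statistics, to which the one-dimensional central limit theorem applies. Since \<open>V\<^sub>n \<ge> 0\<close>, convergence of
  Laplace transforms implies weak convergence, and orthogonality of degenerate kernels shows that
  \<open>n\<close> times the U-statistic differs from \<open>V\<^sub>n - \<Sum> lam\<close> by a term tending to 0 in \<open>L\<^sup>1\<close>.\<close>

section \<open>Hilbert-Schmidt kernels on L2 spaces\<close>

text \<open>The enumeration \<open>lam\<close> is given, and \<open>kernel_eigen_enum\<close> only
  says that no eigenfunction is missing; that the eigenfunctions span has to be proved. The trace
  needs still more: an L2 expansion of the kernel controls the squares of \<open>lam i\<close> but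
  not their sum, and it is blind to the diagonal, on which part of the V-statistic lives. Factoring
  the kernel through a square root \<open>\<Phi>\<close> settles both points: the trace becomes the
  squared norm of \<open>\<Phi>\<close>, and the lower bound of the V-statistic by its truncations
  becomes Bessel's inequality at the sample points. Nonnegativity enters the final limit because
  \<open>exp (- v)\<close> sends the half-line into the unit interval, where polynomial
  approximation asks only for Laplace transforms at integers. Only second moments of
  \<open>X\<close> and \<open>Y\<close> are available; they suffice because the two samples are
  independent, so that the second moment of a product of centred distances is a product of second
  moments. The factor 6 is the binomial coefficient 4 over 2 of a U-statistic of degree 4:
  projecting its kernel onto two points leaves one sixth of the centred product.\<close>

definition L2 :: "'a measure \<Rightarrow> ('a \<Rightarrow> real) set" where
  "L2 M = {f \<in> borel_measurable M. integrable M (\<lambda>x. (f x)\<^sup>2)}"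

text \<open>Functions are not identified when equal almost everywhere, so this form is only
  semidefinite; limits and operator identities below therefore hold \<open>AE\<close>.\<close>

definition ip :: "'a measure \<Rightarrow> ('a \<Rightarrow> real) \<Rightarrow> ('a \<Rightarrow> real) \<Rightarrow> real" where
  "ip M f g = (\<integral>x. f x * g x \<partial>M)"

abbreviation nrm2 :: "'a measure \<Rightarrow> ('a \<Rightarrow> real) \<Rightarrow> real" where
  "nrm2 M f \<equiv> ip M f f"

lemma L2_measurable [measurable_dest]: "f \<in> L2 M \<Longrightarrow> f \<in> borel_measurable M"
  by (simp add: L2_def)

lemma L2_iff: "f \<in> L2 M \<longleftrightarrow> f \<in> borel_measurable M \<and> integrable M (\<lambda>x. f x * f x)"
  by (simp add: L2_def power2_eq_square)

lemma L2_integrable_mult: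
  assumes "f \<in> L2 M" "g \<in> L2 M"
  shows "integrable M (\<lambda>x. f x * g x)"
proof (rule Bochner_Integration.integrable_bound)
  show "integrable M (\<lambda>x. f x * f x + g x * g x)"
    using assms by (auto simp: L2_iff)
  show "(\<lambda>x. f x * g x) \<in> borel_measurable M"
    using assms by (auto simp: L2_iff)
  have "\<bar>a * b\<bar> \<le> \<bar>a * a + b * b\<bar>" for a b :: real
  proof -
    have "0 \<le> (\<bar>a\<bar> - \<bar>b\<bar>)\<^sup>2" by simp
    then have "2 * (\<bar>a\<bar> * \<bar>b\<bar>) \<le> a * a + b * b"
      by (simp add: power2_eq_square algebra_simps)
    then show ?thesis by (simp add: abs_mult) (smt (verit) mult_nonneg_nonneg abs_ge_zero)
  qed
  then show "AE x in M. norm (f x * g x) \<le> norm (f x * f x + g x * g x)"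
    by simp
qed

lemma L2_add: "f \<in> L2 M \<Longrightarrow> g \<in> L2 M \<Longrightarrow> (\<lambda>x. f x + g x) \<in> L2 M"
  using L2_integrable_mult[of f M g] integrable_mult_right[of 2 M "\<lambda>x. f x * g x"]
  by (auto simp: L2_def power2_sum mult.assoc)

lemma L2_cmult: "f \<in> L2 M \<Longrightarrow> (\<lambda>x. c * f x) \<in> L2 M"
  by (auto simp: L2_def power_mult_distrib)

lemma L2_zero: "(\<lambda>x. 0) \<in> L2 M"
  by (simp add: L2_iff)

lemma L2_diff: "f \<in> L2 M \<Longrightarrow> g \<in> L2 M \<Longrightarrow> (\<lambda>x. f x - g x) \<in> L2 M"
  using L2_add[of f M "\<lambda>x. (-1) * g x"] L2_cmult[of g M "-1"] by simp

lemma L2_sum: "(\<And>i. i \<in> I \<Longrightarrow> f i \<in> L2 M) \<Longrightarrow> (\<lambda>x. \<Sum>i\<in>I. f i x) \<in> L2 M"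
  by (induction I rule: infinite_finite_induct) (auto simp: L2_zero intro: L2_add)

lemmas L2_intros = L2_add L2_cmult L2_diff L2_sum L2_zero

lemma ip_commute: "ip M f g = ip M g f"
  by (simp add: ip_def mult.commute)

lemma ip_add_left: "f \<in> L2 M \<Longrightarrow> g \<in> L2 M \<Longrightarrow> h \<in> L2 M \<Longrightarrow>
  ip M (\<lambda>x. f x + g x) h = ip M f h + ip M g h"
  by (simp add: ip_def distrib_right L2_integrable_mult)

lemma ip_diff_left: "f \<in> L2 M \<Longrightarrow> g \<in> L2 M \<Longrightarrow> h \<in> L2 M \<Longrightarrow>
  ip M (\<lambda>x. f x - g x) h = ip M f h - ip M g h"
  by (simp add: ip_def left_diff_distrib L2_integrable_mult)

lemma ip_cmult_left: "ip M (\<lambda>x. c * f x) h = c * ip M f h"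
  by (simp add: ip_def mult.assoc)

lemma ip_sum_left: "(\<And>i. i \<in> I \<Longrightarrow> f i \<in> L2 M) \<Longrightarrow> h \<in> L2 M \<Longrightarrow>
  ip M (\<lambda>x. \<Sum>i\<in>I. f i x) h = (\<Sum>i\<in>I. ip M (f i) h)"
  by (simp add: ip_def sum_distrib_right L2_integrable_mult)

lemma ip_add_right: "f \<in> L2 M \<Longrightarrow> g \<in> L2 M \<Longrightarrow> h \<in> L2 M \<Longrightarrow>
  ip M h (\<lambda>x. f x + g x) = ip M h f + ip M h g"
  using ip_add_left[of f M g h] by (simp add: ip_commute)

lemma ip_diff_right: "f \<in> L2 M \<Longrightarrow> g \<in> L2 M \<Longrightarrow> h \<in> L2 M \<Longrightarrow>
  ip M h (\<lambda>x. f x - g x) = ip M h f - ip M h g"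
  using ip_diff_left[of f M g h] by (simp add: ip_commute)

lemma ip_cmult_right: "ip M h (\<lambda>x. c * f x) = c * ip M h f"
  using ip_cmult_left[of M c f h] by (simp add: ip_commute)

lemma ip_sum_right: "(\<And>i. i \<in> I \<Longrightarrow> f i \<in> L2 M) \<Longrightarrow> h \<in> L2 M \<Longrightarrow>
  ip M h (\<lambda>x. \<Sum>i\<in>I. f i x) = (\<Sum>i\<in>I. ip M h (f i))"
  using ip_sum_left[of I f M h] by (simp add: ip_commute)

lemma nrm2_nonneg: "0 \<le> nrm2 M f"
  by (simp add: ip_def)

lemma nrm2_diff: "f \<in> L2 M \<Longrightarrow> g \<in> L2 M \<Longrightarrow>
  nrm2 M (\<lambda>x. f x - g x) = nrm2 M f + nrm2 M g - 2 * ip M f g"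
  by (simp add: ip_diff_left ip_diff_right L2_diff ip_commute[of M g f])

lemma nrm2_zero_iff: "f \<in> L2 M \<Longrightarrow> nrm2 M f = 0 \<longleftrightarrow> (AE x in M. f x = 0)"
  unfolding ip_def by (subst integral_nonneg_eq_0_iff_AE) (auto simp: L2_iff)

lemma ip_cong_AE: "(AE x in M. f x = f' x) \<Longrightarrow> (AE x in M. g x = g' x) \<Longrightarrow>
  f \<in> borel_measurable M \<Longrightarrow> f' \<in> borel_measurable M \<Longrightarrow> g \<in> borel_measurable M \<Longrightarrow> g' \<in> borel_measurable M \<Longrightarrow>
  ip M f g = ip M f' g'"
  unfolding ip_def by (intro integral_cong_AE) (auto elim: eventually_elim2)

lemma nrm2_add_le: "f \<in> L2 M \<Longrightarrow> g \<in> L2 M \<Longrightarrow> nrm2 M (\<lambda>x. f x + g x) \<le> 2 * nrm2 M f + 2 * nrm2 M g"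
  using nrm2_nonneg[of M "\<lambda>x. f x - g x"]
  by (simp add: nrm2_diff ip_add_left ip_add_right L2_add ip_commute[of M g f])

lemma Cauchy_Schwarz_L2:
  assumes f: "f \<in> L2 M" and g: "g \<in> L2 M"
  shows "(ip M f g)\<^sup>2 \<le> nrm2 M f * nrm2 M g"
proof -
  have *: "0 \<le> t\<^sup>2 * nrm2 M f + nrm2 M g - 2 * t * ip M f g" for t
    using nrm2_nonneg[of M "\<lambda>x. t * f x - g x"] f g
    by (simp add: nrm2_diff L2_cmult ip_cmult_left ip_cmult_right power2_eq_square mult_ac)
  show ?thesis
  proof (cases "nrm2 M f = 0")
    case True
    then have "ip M f g = 0"
      using nrm2_zero_iff[OF f] ip_cong_AE[of f "\<lambda>_. 0" M g g] f g by (auto simp: ip_def)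
    then show ?thesis using True by simp
  next
    case False
    then have p: "nrm2 M f > 0" using nrm2_nonneg[of M f] by simp
    \<comment> \<open>The value put for \<open>t\<close> minimises the quadratic in
      \<open>*\<close>; the case of a vanishing leading coefficient was split off above.\<close>
    have "0 \<le> nrm2 M g - (ip M f g)\<^sup>2 / nrm2 M f"
      using *[of "ip M f g / nrm2 M f"] p by (simp add: power2_eq_square field_simps)
    then show ?thesis using p by (simp add: field_simps)
  qed
qed

lemma ip_tendsto:
  assumes f: "\<And>n. f n \<in> L2 M" "f' \<in> L2 M" "g \<in> L2 M"
    and lim: "(\<lambda>n. nrm2 M (\<lambda>x. f n x - f' x)) \<longlonglongrightarrow> 0"
  shows "(\<lambda>n. ip M (f n) g) \<longlonglongrightarrow> ip M f' g"
proof -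
  have b: "(ip M (f n) g - ip M f' g)\<^sup>2 \<le> nrm2 M (\<lambda>x. f n x - f' x) * nrm2 M g" for n
    using Cauchy_Schwarz_L2[of "\<lambda>x. f n x - f' x" M g] f by (simp add: ip_diff_left L2_diff)
  have "(\<lambda>n. (ip M (f n) g - ip M f' g)\<^sup>2) \<longlonglongrightarrow> 0"
    by (rule tendsto_sandwich[OF _ _ tendsto_const tendsto_mult_left_zero[OF lim, of "nrm2 M g"]]) (use b in auto)
  then have "(\<lambda>n. ip M (f n) g - ip M f' g) \<longlonglongrightarrow> 0"
    by (simp add: power_tendsto_0_iff)
  then show ?thesis by (simp add: LIM_zero_iff)
qed

lemma nrm2_tendsto:
  assumes f: "\<And>n. f n \<in> L2 M" "f' \<in> L2 M"
    and lim: "(\<lambda>n. nrm2 M (\<lambda>x. f n x - f' x)) \<longlonglongrightarrow> 0"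
  shows "(\<lambda>n. nrm2 M (f n)) \<longlonglongrightarrow> nrm2 M f'"
proof -
  have "nrm2 M (f n) = nrm2 M (\<lambda>x. f n x - f' x) + 2 * ip M (f n) f' - nrm2 M f'" for n
    using f by (simp add: nrm2_diff)
  then show ?thesis
    using tendsto_add[OF lim tendsto_diff[OF tendsto_mult_left[OF ip_tendsto[OF f(1) f(2) f(2) lim], of 2] tendsto_const[of "nrm2 M f'"]]]
    by (simp add: add_diff_eq)
qed

lemma L2_limit_unique:
  assumes f: "\<And>n. f n \<in> L2 M" "g \<in> L2 M" "h \<in> L2 M"
    and g: "(\<lambda>n. nrm2 M (\<lambda>x. f n x - g x)) \<longlonglongrightarrow> 0"
    and h: "(\<lambda>n. nrm2 M (\<lambda>x. f n x - h x)) \<longlonglongrightarrow> 0"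
  shows "AE x in M. g x = h x"
proof -
  have d: "(\<lambda>x. g x - h x) \<in> L2 M" using f by (intro L2_diff)
  have "(\<lambda>n. ip M (f n) (\<lambda>x. g x - h x)) \<longlonglongrightarrow> ip M g (\<lambda>x. g x - h x)"
    "(\<lambda>n. ip M (f n) (\<lambda>x. g x - h x)) \<longlonglongrightarrow> ip M h (\<lambda>x. g x - h x)"
    by (intro ip_tendsto f d g h)+
  then have "ip M g (\<lambda>x. g x - h x) = ip M h (\<lambda>x. g x - h x)"
    using LIMSEQ_unique by blast
  then have "nrm2 M (\<lambda>x. g x - h x) = 0"
    using f d by (simp add: ip_diff_left)
  then show ?thesis using nrm2_zero_iff[OF d] by simp
qed

text \<open>Riesz-Fischer. A subsequence with squared increments below \<open>(1/8)^k\<close>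
  converges almost everywhere, and Fatou's lemma along it turns the Cauchy bound into a bound on the
  distance to the pointwise limit.\<close>

lemma L2_complete:
  assumes f: "\<And>n. f n \<in> L2 M"
    and C: "\<And>e. e > 0 \<Longrightarrow> \<exists>N. \<forall>n\<ge>N. \<forall>m\<ge>N. nrm2 M (\<lambda>x. f n x - f m x) < e"
  shows "\<exists>g \<in> L2 M. (\<lambda>n. nrm2 M (\<lambda>x. f n x - g x)) \<longlonglongrightarrow> 0"
proof -
  have "\<exists>N. \<forall>n\<ge>N. \<forall>m\<ge>N. nrm2 M (\<lambda>x. f n x - f m x) < (1/8)^k" for k :: nat
    using C[of "(1/8)^k"] by simp
  then obtain N where N: "\<And>k n m. n \<ge> N k \<Longrightarrow> m \<ge> N k \<Longrightarrow> nrm2 M (\<lambda>x. f n x - f m x) < (1/8)^k"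
    by metis
  \<comment> \<open>Summing the thresholds and adding \<open>k\<close> makes \<open>r\<close>
    strictly increasing while keeping it above \<open>N k\<close>.\<close>
  define r where "r k = (\<Sum>i\<le>k. N i) + k" for k
  have rN: "r k \<ge> N k" for k
    unfolding r_def using member_le_sum[of k "{..k}" N] by auto
  have rS: "r (Suc k) > r k" for k unfolding r_def by simp
  then have r: "strict_mono r" by (rule strict_mono_Suc_iff[THEN iffD2, OF allI])
  define d where "d k x = f (r (Suc k)) x - f (r k) x" for k x
  have d_L2: "d k \<in> L2 M" for k unfolding d_def using f by (intro L2_diff)
  have d_n: "nrm2 M (d k) \<le> (1/8)^k" for k
    using N[of k "r (Suc k)" "r k"] rN[of k] rS[of k] unfolding d_def by force
  have [measurable]: "f n \<in> borel_measurable M" for n using f[of n] by measurable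
  have [measurable]: "d n \<in> borel_measurable M" for n using d_L2[of n] by measurable
  \<comment> \<open>The weight \<open>4^k\<close> is a compromise: the integrals stay summable since
    \<open>4/8 = 1/2\<close>, and boundedness of the weighted terms still forces
    \<open>d k x\<close> to decay like \<open>(1/2)^k\<close>.\<close>
  have "(\<integral>\<^sup>+x. (\<Sum>k. ennreal (4^k * (d k x * d k x))) \<partial>M) = (\<Sum>k. \<integral>\<^sup>+x. ennreal (4^k * (d k x * d k x)) \<partial>M)"
    by (intro nn_integral_suminf) auto
  also have "\<dots> = (\<Sum>k. ennreal (4^k * nrm2 M (d k)))"
    using d_L2 unfolding ip_def
    by (intro suminf_cong, subst nn_integral_eq_integral) (auto simp: L2_iff)
  also have "\<dots> \<le> (\<Sum>k. ennreal ((1/2)^k))"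
  proof (intro suminf_le)
    fix k
    have "4^k * nrm2 M (d k) \<le> 4^k * (1/8)^k"
      using d_n[of k] by (intro mult_left_mono) auto
    also have "\<dots> = (1/2)^k" by (simp flip: power_mult_distrib)
    finally show "ennreal (4^k * nrm2 M (d k)) \<le> ennreal ((1/2)^k)"
      by (rule ennreal_leI)
  qed auto
  also have "\<dots> < \<infinity>"
    by (subst suminf_ennreal2) (auto simp: summable_geometric)
  finally have "AE x in M. (\<Sum>k. ennreal (4^k * (d k x * d k x))) \<noteq> \<infinity>"
    by (intro nn_integral_PInf_AE) auto
  then have AEconv: "AE x in M. convergent (\<lambda>k. f (r k) x)"
  proof eventually_elim
    case (elim x)
    then have S: "summable (\<lambda>k. 4^k * (d k x * d k x))"
      by (intro summable_suminf_not_top) (auto simp: top_unique)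
    have "(\<lambda>k. 4^k * (d k x * d k x)) \<longlonglongrightarrow> 0" using S by (rule summable_LIMSEQ_zero)
    then have "Bseq (\<lambda>k. 4^k * (d k x * d k x))"
      by (intro convergent_imp_Bseq convergentI)
    then obtain B where B: "B > 0" "\<And>k. norm (4^k * (d k x * d k x)) \<le> B"
      by (auto simp: Bseq_def)
    have "\<bar>d k x\<bar> \<le> sqrt B * (1/2)^k" for k
    proof (rule power2_le_imp_le)
      have "4^k * (d k x)\<^sup>2 \<le> B" using B(2)[of k] by (simp add: power2_eq_square abs_mult)
      then have "(d k x)\<^sup>2 \<le> B * (1/4)^k" by (simp add: field_simps power_divide)
      also have "\<dots> = (sqrt B * (1/2)^k)\<^sup>2"
        using B(1) by (simp add: power_mult_distrib power_divide flip: power_mult) (simp add: power_mult mult.commute[of k])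
      finally show "\<bar>d k x\<bar>\<^sup>2 \<le> (sqrt B * (1/2)^k)\<^sup>2" by simp
    qed (use B in auto)
    then have dle: "\<And>k. k \<ge> 0 \<Longrightarrow> norm (d k x) \<le> sqrt B * (1/2)^k" by simp
    have "summable (\<lambda>k. sqrt B * (1/2::real)^k)"
      by (intro summable_mult summable_geometric) simp
    then have "summable (\<lambda>k. d k x)"
      using dle by (rule summable_comparison_test')
    then have "convergent (\<lambda>n. \<Sum>k<n. d k x)" by (simp add: summable_iff_convergent)
    then have "convergent (\<lambda>n. (f (r n) x - f (r 0) x) + f (r 0) x)"
      unfolding d_def by (subst (asm) sum_lessThan_telescope) (intro convergent_add convergent_const)
    then show ?case by simp
  qed
  define g where "g x = lim (\<lambda>k. f (r k) x)" for x
  have g_m[measurable]: "g \<in> borel_measurable M" unfolding g_def by measurable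
  have lim: "AE x in M. (\<lambda>k. f (r k) x) \<longlonglongrightarrow> g x"
    using AEconv unfolding g_def by eventually_elim (simp add: convergent_LIMSEQ_iff)
  \<comment> \<open>Fatou along the subsequence, shifted by \<open>K\<close> so that every index
    that occurs is at least \<open>K\<close>.\<close>
  have bound: "(\<integral>\<^sup>+x. ennreal ((f n x - g x) * (f n x - g x)) \<partial>M) \<le> ennreal e"
    if "\<And>m. m \<ge> K \<Longrightarrow> nrm2 M (\<lambda>x. f n x - f m x) \<le> e" for n K e
  proof -
    have "(\<integral>\<^sup>+x. ennreal ((f n x - g x) * (f n x - g x)) \<partial>M)
       = (\<integral>\<^sup>+x. liminf (\<lambda>k. ennreal ((f n x - f (r (k + K)) x) * (f n x - f (r (k + K)) x))) \<partial>M)"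
    proof (intro nn_integral_cong_AE, use lim in eventually_elim)
      case (elim x)
      have "(\<lambda>k. f (r (k + K)) x) \<longlonglongrightarrow> g x" using elim by (rule LIMSEQ_ignore_initial_segment)
      then have "(\<lambda>k. ennreal ((f n x - f (r (k + K)) x) * (f n x - f (r (k + K)) x))) \<longlonglongrightarrow> ennreal ((f n x - g x) * (f n x - g x))"
        by (intro tendsto_intros tendsto_ennrealI)
      from lim_imp_Liminf[OF sequentially_bot this] show ?case by simp
    qed
    also have "\<dots> \<le> liminf (\<lambda>k. \<integral>\<^sup>+x. ennreal ((f n x - f (r (k + K)) x) * (f n x - f (r (k + K)) x)) \<partial>M)"
      by (intro nn_integral_liminf) auto
    also have "\<dots> = liminf (\<lambda>k. ennreal (nrm2 M (\<lambda>x. f n x - f (r (k + K)) x)))"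
      using L2_diff[OF f f] unfolding ip_def by (subst nn_integral_eq_integral) (auto simp: L2_iff)
    also have "\<dots> \<le> liminf (\<lambda>k::nat. ennreal e)"
    proof (intro Liminf_mono always_eventually allI ennreal_leI that)
      fix k show "K \<le> r (k + K)" using strict_mono_imp_increasing[OF r, of "k+K"] by simp
    qed
    finally show ?thesis by (simp add: Liminf_const)
  qed
  have L2d: "(\<lambda>x. f n x - g x) \<in> L2 M \<and> nrm2 M (\<lambda>x. f n x - g x) \<le> e"
    if h: "\<And>m. m \<ge> K \<Longrightarrow> nrm2 M (\<lambda>x. f n x - f m x) \<le> e" "e \<ge> 0" for n K e
  proof -
    have b: "(\<integral>\<^sup>+x. ennreal ((f n x - g x) * (f n x - g x)) \<partial>M) \<le> ennreal e"
      using bound[OF h(1)] .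
    have i: "integrable M (\<lambda>x. (f n x - g x) * (f n x - g x))"
    proof (rule integrableI_nonneg)
      show "(\<integral>\<^sup>+x. ennreal ((f n x - g x) * (f n x - g x)) \<partial>M) < \<infinity>"
        using b by (rule le_less_trans) simp
    qed auto
    then have "ennreal (nrm2 M (\<lambda>x. f n x - g x)) \<le> ennreal e"
      using b unfolding ip_def by (subst (asm) nn_integral_eq_integral) auto
    then show ?thesis using i h(2) by (auto simp: L2_iff)
  qed
  have "g \<in> L2 M"
  proof -
    have "(\<lambda>x. f (N 0) x - g x) \<in> L2 M"
      using L2d[of "N 0" "N 0" 1] N[of 0 "N 0"] by fastforce
    from L2_diff[OF f[of "N 0"] this] show ?thesis by simp
  qed
  moreover have "(\<lambda>n. nrm2 M (\<lambda>x. f n x - g x)) \<longlonglongrightarrow> 0"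
  proof (rule LIMSEQ_I)
    fix e :: real assume e: "e > 0"
    obtain K where K: "\<forall>n\<ge>K. \<forall>m\<ge>K. nrm2 M (\<lambda>x. f n x - f m x) < e / 2" using C[of "e/2"] e by auto
    have "norm (nrm2 M (\<lambda>x. f n x - g x) - 0) < e" if "n \<ge> K" for n
      using L2d[of K n "e/2"] K that e nrm2_nonneg[of M "\<lambda>x. f n x - g x"] by (force simp: less_imp_le)
    then show "\<exists>K. \<forall>n\<ge>K. norm (nrm2 M (\<lambda>x. f n x - g x) - 0) < e" by blast
  qed
  ultimately show ?thesis by blast
qed


section \<open>Integral kernels as Hilbert-Schmidt operators\<close>

definition hs_comp :: "'b measure \<Rightarrow> ('a \<times> 'b \<Rightarrow> real) \<Rightarrow> ('b \<times> 'c \<Rightarrow> real) \<Rightarrow> 'a \<times> 'c \<Rightarrow> real" where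
  "hs_comp B F G = (\<lambda>(a, c). \<integral>b. F (a, b) * G (b, c) \<partial>B)"

text \<open>Integration runs over the first variable, so a kernel on a product of \<open>A\<close>
  and \<open>C\<close> acts from L2(A) to L2(C), and its adjoint is
  \<open>hs_app C (tr F)\<close>.\<close>

definition hs_app :: "'a measure \<Rightarrow> ('a \<times> 'c \<Rightarrow> real) \<Rightarrow> ('a \<Rightarrow> real) \<Rightarrow> 'c \<Rightarrow> real" where
  "hs_app A F f = (\<lambda>c. \<integral>a. F (a, c) * f a \<partial>A)"

definition tr :: "('a \<times> 'b \<Rightarrow> real) \<Rightarrow> 'b \<times> 'a \<Rightarrow> real" where
  "tr F = (\<lambda>(b, a). F (a, b))"

definition tensor :: "('a \<Rightarrow> real) \<Rightarrow> ('b \<Rightarrow> real) \<Rightarrow> 'a \<times> 'b \<Rightarrow> real" where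
  "tensor f g = (\<lambda>(a, b). f a * g b)"

lemma tr_tr [simp]: "tr (tr F) = F"
  by (auto simp: tr_def)

text \<open>Stated with extended nonnegative integrals so that no integrability has to be known: if
  the product is not integrable, its Bochner integral is 0 and the bound is trivial.\<close>

lemma integral_square_le_nn:
  fixes f g :: "'a \<Rightarrow> real"
  assumes [measurable]: "f \<in> borel_measurable M" "g \<in> borel_measurable M"
  shows "ennreal ((\<integral>x. f x * g x \<partial>M) * (\<integral>x. f x * g x \<partial>M))
    \<le> (\<integral>\<^sup>+x. ennreal (f x * f x) \<partial>M) * (\<integral>\<^sup>+x. ennreal (g x * g x) \<partial>M)"
proof -
  have "ennreal (norm (\<integral>x. f x * g x \<partial>M)) \<le> (\<integral>\<^sup>+x. norm (f x * g x) \<partial>M)"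
    by (cases "integrable M (\<lambda>x. f x * g x)")
       (auto intro: integral_norm_bound_ennreal simp: not_integrable_integral_eq simp del: real_norm_def)
  also have "\<dots> = (\<integral>\<^sup>+x. ennreal \<bar>f x\<bar> * ennreal \<bar>g x\<bar> \<partial>M)"
    by (simp add: abs_mult ennreal_mult)
  finally have "ennreal \<bar>\<integral>x. f x * g x \<partial>M\<bar> ^ 2 \<le> (\<integral>\<^sup>+x. ennreal \<bar>f x\<bar> * ennreal \<bar>g x\<bar> \<partial>M) ^ 2"
    by (intro power_mono) auto
  also have "\<dots> \<le> (\<integral>\<^sup>+x. ennreal \<bar>f x\<bar> ^ 2 \<partial>M) * (\<integral>\<^sup>+x. ennreal \<bar>g x\<bar> ^ 2 \<partial>M)"
    by (intro Cauchy_Schwarz_nn_integral) auto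
  finally show ?thesis
    by (simp add: ennreal_power power2_eq_square flip: ennreal_mult abs_mult)
qed

lemma nn_integral_L2:
  "f \<in> L2 M \<Longrightarrow> (\<integral>\<^sup>+x. ennreal (f x * f x) \<partial>M) = ennreal (nrm2 M f)"
  unfolding ip_def by (subst nn_integral_eq_integral) (auto simp: L2_iff)

lemma L2_bound_nn:
  assumes [measurable]: "f \<in> borel_measurable M"
    and b: "(\<integral>\<^sup>+x. ennreal (f x * f x) \<partial>M) \<le> ennreal e" and e: "e \<ge> 0"
  shows "f \<in> L2 M" "nrm2 M f \<le> e"
proof -
  have i: "integrable M (\<lambda>x. f x * f x)"
  proof (rule integrableI_nonneg)
    show "(\<integral>\<^sup>+x. ennreal (f x * f x) \<partial>M) < \<infinity>"
      using b by (rule le_less_trans) simp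
  qed auto
  then show "f \<in> L2 M" by (simp add: L2_iff)
  with b e show "nrm2 M f \<le> e" by (simp add: nn_integral_L2)
qed

text \<open>Cauchy-Schwarz in the inner variable bounds the squared composition by a function of
  \<open>a\<close> times a function of \<open>c\<close>, and Tonelli factors the double
  integral.\<close>

lemma
  assumes A: "sigma_finite_measure A" and B: "sigma_finite_measure B" and C: "sigma_finite_measure C"
    and F: "F \<in> L2 (A \<Otimes>\<^sub>M B)" and G: "G \<in> L2 (B \<Otimes>\<^sub>M C)"
  shows hs_comp_L2: "hs_comp B F G \<in> L2 (A \<Otimes>\<^sub>M C)"
    and hs_comp_nrm2: "nrm2 (A \<Otimes>\<^sub>M C) (hs_comp B F G) \<le> nrm2 (A \<Otimes>\<^sub>M B) F * nrm2 (B \<Otimes>\<^sub>M C) G"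
proof -
  interpret A: sigma_finite_measure A by fact
  interpret B: sigma_finite_measure B by fact
  interpret C: sigma_finite_measure C by fact
  interpret BC: pair_sigma_finite B C ..
  note [measurable] = L2_measurable[OF F] L2_measurable[OF G]
  have m[measurable]: "hs_comp B F G \<in> borel_measurable (A \<Otimes>\<^sub>M C)"
    unfolding hs_comp_def by measurable
  have "(\<integral>\<^sup>+p. ennreal (hs_comp B F G p * hs_comp B F G p) \<partial>(A \<Otimes>\<^sub>M C))
    \<le> (\<integral>\<^sup>+p. (\<integral>\<^sup>+b. ennreal (F (fst p, b) * F (fst p, b)) \<partial>B) * (\<integral>\<^sup>+b. ennreal (G (b, snd p) * G (b, snd p)) \<partial>B) \<partial>(A \<Otimes>\<^sub>M C))"
    unfolding hs_comp_def
    by (intro nn_integral_mono) (auto simp: space_pair_measure intro!: integral_square_le_nn)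
  also have "\<dots> = (\<integral>\<^sup>+a. \<integral>\<^sup>+c. (\<integral>\<^sup>+b. ennreal (F (a, b) * F (a, b)) \<partial>B) * (\<integral>\<^sup>+b. ennreal (G (b, c) * G (b, c)) \<partial>B) \<partial>C \<partial>A)"
    by (subst C.nn_integral_fst[symmetric]) auto
  also have "\<dots> = (\<integral>\<^sup>+a. \<integral>\<^sup>+b. ennreal (F (a, b) * F (a, b)) \<partial>B \<partial>A) * (\<integral>\<^sup>+c. \<integral>\<^sup>+b. ennreal (G (b, c) * G (b, c)) \<partial>B \<partial>C)"
    by (simp add: nn_integral_cmult nn_integral_multc)
  also have "(\<integral>\<^sup>+a. \<integral>\<^sup>+b. ennreal (F (a, b) * F (a, b)) \<partial>B \<partial>A) = ennreal (nrm2 (A \<Otimes>\<^sub>M B) F)"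
    using nn_integral_L2[OF F] by (subst (asm) B.nn_integral_fst[symmetric]) auto
  also have "(\<integral>\<^sup>+c. \<integral>\<^sup>+b. ennreal (G (b, c) * G (b, c)) \<partial>B \<partial>C) = ennreal (nrm2 (B \<Otimes>\<^sub>M C) G)"
    using nn_integral_L2[OF G] by (subst (asm) BC.nn_integral_snd[symmetric]) auto
  finally have "(\<integral>\<^sup>+p. ennreal (hs_comp B F G p * hs_comp B F G p) \<partial>(A \<Otimes>\<^sub>M C)) \<le> ennreal (nrm2 (A \<Otimes>\<^sub>M B) F * nrm2 (B \<Otimes>\<^sub>M C) G)"
    by (simp add: ennreal_mult nrm2_nonneg)
  from L2_bound_nn[OF m this] show "hs_comp B F G \<in> L2 (A \<Otimes>\<^sub>M C)"
    "nrm2 (A \<Otimes>\<^sub>M C) (hs_comp B F G) \<le> nrm2 (A \<Otimes>\<^sub>M B) F * nrm2 (B \<Otimes>\<^sub>M C) G"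
    by (auto simp: nrm2_nonneg)
qed

lemma hs_app_L2:
  assumes A: "sigma_finite_measure A" and C: "sigma_finite_measure C"
    and F: "F \<in> L2 (A \<Otimes>\<^sub>M C)" and f: "f \<in> L2 A"
  shows "hs_app A F f \<in> L2 C"
proof -
  interpret A: sigma_finite_measure A by fact
  interpret C: sigma_finite_measure C by fact
  interpret AC: pair_sigma_finite A C ..
  note [measurable] = L2_measurable[OF F] L2_measurable[OF f]
  have m[measurable]: "hs_app A F f \<in> borel_measurable C"
    unfolding hs_app_def by measurable
  have "(\<integral>\<^sup>+c. ennreal (hs_app A F f c * hs_app A F f c) \<partial>C)
    \<le> (\<integral>\<^sup>+c. (\<integral>\<^sup>+a. ennreal (F (a, c) * F (a, c)) \<partial>A) * (\<integral>\<^sup>+a. ennreal (f a * f a) \<partial>A) \<partial>C)"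
    unfolding hs_app_def
    by (intro nn_integral_mono) (auto simp: space_pair_measure intro!: integral_square_le_nn)
  also have "\<dots> = (\<integral>\<^sup>+c. \<integral>\<^sup>+a. ennreal (F (a, c) * F (a, c)) \<partial>A \<partial>C) * (\<integral>\<^sup>+a. ennreal (f a * f a) \<partial>A)"
    by (simp add: nn_integral_multc)
  also have "(\<integral>\<^sup>+c. \<integral>\<^sup>+a. ennreal (F (a, c) * F (a, c)) \<partial>A \<partial>C) = ennreal (nrm2 (A \<Otimes>\<^sub>M C) F)"
    using nn_integral_L2[OF F] by (subst (asm) AC.nn_integral_snd[symmetric]) auto
  finally have "(\<integral>\<^sup>+c. ennreal (hs_app A F f c * hs_app A F f c) \<partial>C) \<le> ennreal (nrm2 (A \<Otimes>\<^sub>M C) F * nrm2 A f)"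
    by (simp add: ennreal_mult nrm2_nonneg nn_integral_L2[OF f])
  from L2_bound_nn(1)[OF m this] show ?thesis by (simp add: nrm2_nonneg)
qed

lemma
  assumes A: "sigma_finite_measure A" and B: "sigma_finite_measure B"
    and F: "F \<in> L2 (A \<Otimes>\<^sub>M B)"
  shows tr_L2: "tr F \<in> L2 (B \<Otimes>\<^sub>M A)"
    and L2_slice1: "AE a in A. (\<lambda>b. F (a, b)) \<in> L2 B"
    and L2_slice2: "AE b in B. (\<lambda>a. F (a, b)) \<in> L2 A"
proof -
  interpret A: sigma_finite_measure A by fact
  interpret B: sigma_finite_measure B by fact
  interpret AB: pair_sigma_finite A B ..
  note [measurable] = L2_measurable[OF F]
  have i: "integrable (A \<Otimes>\<^sub>M B) (\<lambda>p. F p * F p)" using F by (simp add: L2_iff)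
  have "integrable (B \<Otimes>\<^sub>M A) (\<lambda>(b, a). F (a, b) * F (a, b))"
    using AB.integrable_product_swap[OF i] by (simp add: split_def)
  then show "tr F \<in> L2 (B \<Otimes>\<^sub>M A)" by (auto simp: L2_iff tr_def split_def)
  have i': "integrable (A \<Otimes>\<^sub>M B) (case_prod (\<lambda>a b. F (a, b) * F (a, b)))"
    using i by (simp add: split_def)
  show "AE a in A. (\<lambda>b. F (a, b)) \<in> L2 B"
    using AB.AE_integrable_fst[OF i'] AE_space by eventually_elim (auto simp: L2_iff)
  show "AE b in B. (\<lambda>a. F (a, b)) \<in> L2 A"
    using AB.AE_integrable_snd[OF i'] AE_space by eventually_elim (auto simp: L2_iff)
qed

lemma ip_pair:
  assumes A: "sigma_finite_measure A" and B: "sigma_finite_measure B"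
    and F: "F \<in> L2 (A \<Otimes>\<^sub>M B)" and G: "G \<in> L2 (A \<Otimes>\<^sub>M B)"
  shows "ip (A \<Otimes>\<^sub>M B) F G = (\<integral>a. ip B (\<lambda>b. F (a, b)) (\<lambda>b. G (a, b)) \<partial>A)"
    and "ip (A \<Otimes>\<^sub>M B) F G = (\<integral>b. ip A (\<lambda>a. F (a, b)) (\<lambda>a. G (a, b)) \<partial>B)"
proof -
  interpret A: sigma_finite_measure A by fact
  interpret B: sigma_finite_measure B by fact
  interpret AB: pair_sigma_finite A B ..
  have i: "integrable (A \<Otimes>\<^sub>M B) (\<lambda>(a, b). F (a, b) * G (a, b))"
    using L2_integrable_mult[OF F G] by (simp add: split_def)
  show "ip (A \<Otimes>\<^sub>M B) F G = (\<integral>a. ip B (\<lambda>b. F (a, b)) (\<lambda>b. G (a, b)) \<partial>A)"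
    using AB.integral_fst[OF i] by (simp add: ip_def split_def)
  show "ip (A \<Otimes>\<^sub>M B) F G = (\<integral>b. ip A (\<lambda>a. F (a, b)) (\<lambda>a. G (a, b)) \<partial>B)"
    using AB.integral_snd[OF i] by (simp add: ip_def split_def)
qed

lemma ip_tr:
  assumes A: "sigma_finite_measure A" and B: "sigma_finite_measure B"
    and F: "F \<in> L2 (A \<Otimes>\<^sub>M B)" and G: "G \<in> L2 (A \<Otimes>\<^sub>M B)"
  shows "ip (B \<Otimes>\<^sub>M A) (tr F) (tr G) = ip (A \<Otimes>\<^sub>M B) F G"
  using ip_pair(1)[OF B A tr_L2[OF A B F] tr_L2[OF A B G]] ip_pair(2)[OF A B F G]
  by (simp add: tr_def)

lemma tensor_L2:
  assumes A: "sigma_finite_measure A" and B: "sigma_finite_measure B"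
    and f: "f \<in> L2 A" and g: "g \<in> L2 B"
  shows "tensor f g \<in> L2 (A \<Otimes>\<^sub>M B)"
proof -
  interpret A: sigma_finite_measure A by fact
  interpret B: sigma_finite_measure B by fact
  note [measurable] = L2_measurable[OF f] L2_measurable[OF g]
  have m: "tensor f g \<in> borel_measurable (A \<Otimes>\<^sub>M B)" unfolding tensor_def by measurable
  have "(\<integral>\<^sup>+p. ennreal (tensor f g p * tensor f g p) \<partial>(A \<Otimes>\<^sub>M B))
      = (\<integral>\<^sup>+a. \<integral>\<^sup>+b. ennreal (f a * f a) * ennreal (g b * g b) \<partial>B \<partial>A)"
    using m by (subst B.nn_integral_fst[symmetric]) (auto simp: tensor_def mult_ac ennreal_mult[symmetric])
  also have "\<dots> = ennreal (nrm2 A f * nrm2 B g)"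
    by (simp add: nn_integral_cmult nn_integral_multc nn_integral_L2 f g ennreal_mult nrm2_nonneg)
  finally have n: "(\<integral>\<^sup>+p. ennreal (tensor f g p * tensor f g p) \<partial>(A \<Otimes>\<^sub>M B)) = ennreal (nrm2 A f * nrm2 B g)" .
  show ?thesis
    using L2_bound_nn(1)[OF m, of "nrm2 A f * nrm2 B g"] n by (simp add: nrm2_nonneg)
qed

text \<open>Associativity, adjoints and factorisation of forms all reduce to this exchange of
  integrals. It is legitimate because \<open>tensor f h\<close> and \<open>G\<close> are both square
  integrable on the product, so their product is integrable.\<close>

lemma Fubini_three:
  assumes B: "sigma_finite_measure B" and C: "sigma_finite_measure C"
    and f: "f \<in> L2 B" and h: "h \<in> L2 C" and G: "G \<in> L2 (B \<Otimes>\<^sub>M C)"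
  shows "(\<integral>c. (\<integral>b. f b * G (b, c) \<partial>B) * h c \<partial>C) = (\<integral>b. f b * (\<integral>c. G (b, c) * h c \<partial>C) \<partial>B)"
    and "(\<integral>b. f b * (\<integral>c. G (b, c) * h c \<partial>C) \<partial>B) = ip (B \<Otimes>\<^sub>M C) (tensor f h) G"
proof -
  interpret B: sigma_finite_measure B by fact
  interpret C: sigma_finite_measure C by fact
  interpret BC: pair_sigma_finite B C ..
  have i: "integrable (B \<Otimes>\<^sub>M C) (\<lambda>(b, c). f b * G (b, c) * h c)"
    using L2_integrable_mult[OF tensor_L2[OF B C f h] G]
    by (simp add: tensor_def split_def mult_ac)
  show "(\<integral>c. (\<integral>b. f b * G (b, c) \<partial>B) * h c \<partial>C) = (\<integral>b. f b * (\<integral>c. G (b, c) * h c \<partial>C) \<partial>B)"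
    using BC.Fubini_integral[OF i] by (simp add: mult.assoc flip: integral_mult_left_zero)
  show "(\<integral>b. f b * (\<integral>c. G (b, c) * h c \<partial>C) \<partial>B) = ip (B \<Otimes>\<^sub>M C) (tensor f h) G"
    using BC.integral_fst[OF i] by (simp add: ip_def tensor_def split_def mult_ac)
qed

text \<open>Equality is only almost everywhere, because the exchange of integrals is justified for
  those \<open>a\<close> and \<open>d\<close> whose slices are square integrable.\<close>

lemma hs_comp_assoc:
  assumes A: "sigma_finite_measure A" and B: "sigma_finite_measure B"
    and C: "sigma_finite_measure C" and D: "sigma_finite_measure D"
    and F: "F \<in> L2 (A \<Otimes>\<^sub>M B)" and G: "G \<in> L2 (B \<Otimes>\<^sub>M C)" and H: "H \<in> L2 (C \<Otimes>\<^sub>M D)"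
  shows "AE p in A \<Otimes>\<^sub>M D. hs_comp C (hs_comp B F G) H p = hs_comp B F (hs_comp C G H) p"
proof -
  interpret A: sigma_finite_measure A by fact
  interpret D: sigma_finite_measure D by fact
  interpret AD: pair_sigma_finite A D ..
  note [measurable] = L2_measurable[OF hs_comp_L2[OF A C D hs_comp_L2[OF A B C F G] H]]
    L2_measurable[OF hs_comp_L2[OF A B D F hs_comp_L2[OF B C D G H]]]
  have "AE a in A. AE d in D. hs_comp C (hs_comp B F G) H (a, d) = hs_comp B F (hs_comp C G H) (a, d)"
    using L2_slice1[OF A B F]
  proof eventually_elim
    case a: (elim a)
    show ?case using L2_slice2[OF C D H]
    proof eventually_elim
      case (elim d)
      show ?case using Fubini_three(1)[OF B C a elim G] by (simp add: hs_comp_def)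
    qed
  qed
  then show ?thesis by (intro AD.AE_pair_measure) auto
qed

lemma hs_comp_adjoint:
  assumes A: "sigma_finite_measure A" and B: "sigma_finite_measure B" and C: "sigma_finite_measure C"
    and P: "P \<in> L2 (A \<Otimes>\<^sub>M B)" and F: "F \<in> L2 (B \<Otimes>\<^sub>M C)" and G: "G \<in> L2 (A \<Otimes>\<^sub>M C)"
  shows "ip (A \<Otimes>\<^sub>M C) (hs_comp B P F) G = ip (A \<Otimes>\<^sub>M B) P (hs_comp C G (tr F))"
proof -
  interpret B: sigma_finite_measure B by fact
  interpret C: sigma_finite_measure C by fact
  note PF = hs_comp_L2[OF A B C P F]
  note GF = hs_comp_L2[OF A C B G tr_L2[OF B C F]]
  note [measurable] = L2_measurable[OF PF] L2_measurable[OF GF] L2_measurable[OF P] L2_measurable[OF G]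
  have "ip (A \<Otimes>\<^sub>M C) (hs_comp B P F) G = (\<integral>a. ip C (\<lambda>c. hs_comp B P F (a, c)) (\<lambda>c. G (a, c)) \<partial>A)"
    by (rule ip_pair(1)[OF A C PF G])
  also have "\<dots> = (\<integral>a. ip B (\<lambda>b. P (a, b)) (\<lambda>b. hs_comp C G (tr F) (a, b)) \<partial>A)"
  proof (rule integral_cong_AE)
    show "AE a in A. ip C (\<lambda>c. hs_comp B P F (a, c)) (\<lambda>c. G (a, c)) = ip B (\<lambda>b. P (a, b)) (\<lambda>b. hs_comp C G (tr F) (a, b))"
      using L2_slice1[OF A B P] L2_slice1[OF A C G]
    proof eventually_elim
      case (elim a)
      show ?case using Fubini_three(1)[OF B C elim(1) elim(2) F]
        by (simp add: hs_comp_def ip_def tr_def mult.commute)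
    qed
  qed (unfold ip_def, measurable)
  also have "\<dots> = ip (A \<Otimes>\<^sub>M B) P (hs_comp C G (tr F))"
    by (rule ip_pair(1)[OF A B P GF, symmetric])
  finally show ?thesis .
qed

lemma hs_app_adjoint:
  assumes A: "sigma_finite_measure A" and C: "sigma_finite_measure C"
    and F: "F \<in> L2 (A \<Otimes>\<^sub>M C)" and f: "f \<in> L2 A" and h: "h \<in> L2 C"
  shows "ip C (hs_app A F f) h = ip A f (hs_app C (tr F) h)"
    and "ip C (hs_app A F f) h = ip (A \<Otimes>\<^sub>M C) (tensor f h) F"
  using Fubini_three[OF A C f h F] by (simp_all add: ip_def hs_app_def tr_def mult.commute)

lemma hs_app_tensor: "hs_app A (tensor f g) h = (\<lambda>c. ip A f h * g c)"
proof
  fix c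
  have "hs_app A (tensor f g) h c = (\<integral>a. g c * (f a * h a) \<partial>A)"
    by (simp add: hs_app_def tensor_def mult_ac)
  then show "hs_app A (tensor f g) h c = ip A f h * g c" by (simp add: ip_def)
qed

section \<open>Spectral expansion of a feature kernel\<close>

text \<open>Hypothesis \<open>conv\<close> makes the ratios of successive terms increase;
  \<open>sub\<close> bounds them, so they have a limit \<open>r\<close>, and the quotient by
  \<open>r ^ n\<close> decreases. Hypothesis \<open>sub\<close> also keeps that quotient away from
  0.\<close>

lemma ratio_limit:
  fixes N :: "nat \<Rightarrow> real"
  assumes pos: "\<And>n. N n > 0"
    and conv: "\<And>n. (N (Suc n))\<^sup>2 \<le> N n * N (Suc (Suc n))"
    and sub: "\<And>n m. N (n + m + 1) \<le> C * N n * N m"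
  shows "\<exists>r>0. \<exists>L>0. (\<lambda>n. N n / r ^ n) \<longlonglongrightarrow> L"
proof -
  have C: "C > 0"
  proof (rule ccontr)
    assume "\<not> C > 0"
    then have "C * N 0 * N 0 \<le> 0" using pos[of 0]
      by (intro mult_nonpos_nonneg) (auto intro: mult_nonpos_nonneg less_imp_le)
    then show False using sub[of 0 0] pos[of 1] by simp
  qed
  define q where "q n = N (Suc n) / N n" for n
  have q_pos: "q n > 0" for n using pos by (simp add: q_def)
  have q_mono: "incseq q"
  proof (rule incseq_SucI)
    fix n show "q n \<le> q (Suc n)"
      using conv[of n] pos[of n] pos[of "Suc n"] by (simp add: q_def field_simps power2_eq_square)
  qed
  have q_bound: "q n \<le> C * N 0" for n
    using sub[of 0 n] pos[of n] by (simp add: q_def field_simps)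
  obtain r where r: "q \<longlonglongrightarrow> r" and q_le: "\<And>n. q n \<le> r"
    using incseq_convergent[OF q_mono, of "C * N 0"] q_bound by blast
  have r_pos: "r > 0" using q_pos[of 0] q_le[of 0] by simp
  define a where "a n = N n / r ^ n" for n
  have a_Suc: "a (Suc n) = a n * (q n / r)" for n
    using pos[of n] r_pos by (simp add: a_def q_def field_simps)
  have a_pos: "a n > 0" for n using pos r_pos by (simp add: a_def)
  have "a (Suc n) \<le> a n" for n
    unfolding a_Suc using a_pos[of n] q_le[of n] r_pos by (simp add: field_simps)
  then have dec: "decseq a" by (rule decseq_SucI)
  have lim_ratio: "(\<lambda>m. N (m + n) / N m) \<longlonglongrightarrow> r ^ n" for n
  proof (induction n)
    case 0
    then show ?case using pos by (simp add: less_imp_neq[THEN not_sym])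
  next
    case (Suc n)
    have "(\<lambda>m. q (m + n) * (N (m + n) / N m)) \<longlonglongrightarrow> r * r ^ n"
      by (intro tendsto_mult Suc LIMSEQ_ignore_initial_segment r)
    moreover have "q (m + n) * (N (m + n) / N m) = N (m + Suc n) / N m" for m
      using pos[of "m + n"] by (simp add: q_def)
    ultimately show ?case by (simp only: power_Suc)
  qed
  \<comment> \<open>Divide \<open>sub\<close> by \<open>N m\<close> and let \<open>m\<close> grow:
    the left side tends to a power of \<open>r\<close>, while the right side does not depend on
    \<open>m\<close>.\<close>
  have low: "r ^ Suc n \<le> C * N n" for n
  proof (rule LIMSEQ_le_const2[OF lim_ratio])
    show "\<exists>M. \<forall>m\<ge>M. N (m + Suc n) / N m \<le> C * N n"
      using sub[of n] pos by (auto simp: field_simps)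
  qed
  have a_low: "r / C \<le> a n" for n
    using low[of n] C r_pos by (simp add: a_def field_simps)
  obtain L where L: "a \<longlonglongrightarrow> L"
    using decseq_convergent[OF dec, of 0] a_pos by (meson less_imp_le)
  have "r / C \<le> L" by (rule LIMSEQ_le_const[OF L]) (use a_low in auto)
  then have "L > 0" using C r_pos by (meson divide_pos_pos less_le_trans)
  then show ?thesis using r_pos L unfolding a_def by blast
qed

lemma hs_comp_cong_AE:
  assumes A: "sigma_finite_measure A" and B: "sigma_finite_measure B" and C: "sigma_finite_measure C"
    and F: "F \<in> L2 (A \<Otimes>\<^sub>M B)" "F' \<in> L2 (A \<Otimes>\<^sub>M B)" and G: "G \<in> L2 (B \<Otimes>\<^sub>M C)" "G' \<in> L2 (B \<Otimes>\<^sub>M C)"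
    and FF: "AE p in A \<Otimes>\<^sub>M B. F p = F' p" and GG: "AE p in B \<Otimes>\<^sub>M C. G p = G' p"
  shows "AE p in A \<Otimes>\<^sub>M C. hs_comp B F G p = hs_comp B F' G' p"
proof -
  interpret A: sigma_finite_measure A by fact
  interpret B: sigma_finite_measure B by fact
  interpret C: sigma_finite_measure C by fact
  interpret AB: pair_sigma_finite A B ..
  interpret AC: pair_sigma_finite A C ..
  interpret BC: pair_sigma_finite B C ..
  note [measurable] = F[THEN L2_measurable] G[THEN L2_measurable]
    L2_measurable[OF hs_comp_L2[OF A B C F(1) G(1)]] L2_measurable[OF hs_comp_L2[OF A B C F(2) G(2)]]
  have a: "AE a in A. AE b in B. F (a, b) = F' (a, b)" using AB.AE_pair[OF FF] by simp
  have "AE b in B. AE c in C. G (b, c) = G' (b, c)" using BC.AE_pair[OF GG] by simp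
  then have c: "AE c in C. AE b in B. G (b, c) = G' (b, c)"
    by (subst (asm) BC.AE_commute) (auto simp: split_def)
  have "AE a in A. AE c in C. hs_comp B F G (a, c) = hs_comp B F' G' (a, c)"
    using a AE_space
  proof eventually_elim
    case a: (elim a)
    show ?case using c AE_space
    proof eventually_elim
      case c: (elim c)
      have [measurable]: "a \<in> space A" "c \<in> space C" by fact+
      have "AE b in B. F (a, b) * G (b, c) = F' (a, b) * G' (b, c)"
        using a(1) c(1) by eventually_elim simp
      then show ?case unfolding hs_comp_def by (auto intro!: integral_cong_AE)
    qed
  qed
  then show ?thesis by (intro AC.AE_pair_measure) auto
qed

lemma hs_comp_lin_right:
  assumes A: "sigma_finite_measure A" and B: "sigma_finite_measure B" and C: "sigma_finite_measure C"
    and F: "F \<in> L2 (A \<Otimes>\<^sub>M B)" and G: "G \<in> L2 (B \<Otimes>\<^sub>M C)" and H: "H \<in> L2 (B \<Otimes>\<^sub>M C)"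
  shows "AE p in A \<Otimes>\<^sub>M C. hs_comp B F (\<lambda>p. G p + k * H p) p = hs_comp B F G p + k * hs_comp B F H p"
proof -
  interpret A: sigma_finite_measure A by fact
  interpret C: sigma_finite_measure C by fact
  interpret AC: pair_sigma_finite A C ..
  note [measurable] = L2_measurable[OF hs_comp_L2[OF A B C F G]] L2_measurable[OF hs_comp_L2[OF A B C F H]]
    L2_measurable[OF hs_comp_L2[OF A B C F L2_add[OF G L2_cmult[OF H]]]]
  have "AE a in A. AE c in C. hs_comp B F (\<lambda>p. G p + k * H p) (a, c) = hs_comp B F G (a, c) + k * hs_comp B F H (a, c)"
    using L2_slice1[OF A B F]
  proof eventually_elim
    case a: (elim a)
    show ?case using L2_slice2[OF B C G] L2_slice2[OF B C H]
    proof eventually_elim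
      case (elim c)
      have "(\<integral>b. F (a, b) * (G (b, c) + k * H (b, c)) \<partial>B) = (\<integral>b. F (a, b) * G (b, c) + k * (F (a, b) * H (b, c)) \<partial>B)"
        by (simp add: algebra_simps)
      also have "\<dots> = (\<integral>b. F (a, b) * G (b, c) \<partial>B) + k * (\<integral>b. F (a, b) * H (b, c) \<partial>B)"
        by (subst Bochner_Integration.integral_add) (auto intro!: L2_integrable_mult a elim)
      finally show ?case by (simp add: hs_comp_def)
    qed
  qed
  then show ?thesis by (intro AC.AE_pair_measure) auto
qed

lemma hs_comp_cmult_right: "hs_comp B F (\<lambda>p. k * G p) = (\<lambda>p. k * hs_comp B F G p)"
proof (rule ext, clarify)
  fix a c
  have "(\<integral>b. F (a, b) * (k * G (b, c)) \<partial>B) = (\<integral>b. k * (F (a, b) * G (b, c)) \<partial>B)"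
    by (simp add: mult_ac)
  then show "hs_comp B F (\<lambda>p. k * G p) (a, c) = k * hs_comp B F G (a, c)"
    by (simp add: hs_comp_def)
qed

lemma hs_comp_tr: "tr (hs_comp B F G) = hs_comp B (tr G) (tr F)"
  by (auto simp: tr_def hs_comp_def mult.commute)

text \<open>Indicators of rectangles of finite measure are tensors, so the integral of
  \<open>F\<close> over each of them vanishes; a Dynkin argument passes to all measurable sets
  inside a fixed rectangle, and countably many rectangles cover the space.\<close>

lemma AE_zero_if_orthogonal_to_tensors:
  assumes A: "sigma_finite_measure A" and B: "sigma_finite_measure B" and F: "F \<in> L2 (A \<Otimes>\<^sub>M B)"
    and z: "\<And>f g. f \<in> L2 A \<Longrightarrow> g \<in> L2 B \<Longrightarrow> ip (A \<Otimes>\<^sub>M B) (tensor f g) F = 0"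
  shows "AE p in A \<Otimes>\<^sub>M B. F p = 0"
proof -
  interpret A: sigma_finite_measure A by fact
  interpret B: sigma_finite_measure B by fact
  interpret AB: pair_sigma_finite A B ..
  note [measurable] = L2_measurable[OF F]
  have indL2: "indicator E \<in> L2 M" if [measurable]: "E \<in> sets M" and "emeasure M E < \<infinity>" for E and M :: "'x measure"
  proof -
    have "(\<lambda>x. indicator E x * indicator E x :: real) = indicator E" by (auto split: split_indicator)
    then show ?thesis using that by (auto simp: L2_iff)
  qed
  obtain SA :: "nat \<Rightarrow> 'a set" where SA: "range SA \<subseteq> sets A" "(\<Union>i. SA i) = space A" "\<And>i. emeasure A (SA i) \<noteq> \<infinity>"
    using A.sigma_finite by metis
  obtain SB :: "nat \<Rightarrow> 'b set" where SB: "range SB \<subseteq> sets B" "(\<Union>i. SB i) = space B" "\<And>i. emeasure B (SB i) \<noteq> \<infinity>"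
    using B.sigma_finite by metis
  have "AE p in A \<Otimes>\<^sub>M B. p \<in> SA i \<times> SB j \<longrightarrow> F p = 0" for i j
  proof -
    have sets[measurable]: "SA i \<in> sets A" "SB j \<in> sets B" using SA SB by auto
    \<comment> \<open>Cutting \<open>F\<close> down to a rectangle of finite measure makes it
      integrable, not merely square integrable, and keeps the indicators used as test functions in
      L2.\<close>
    define H where "H p = indicator (SA i \<times> SB j) p * F p" for p
    have ind_eq: "indicator (X \<times> Y) = tensor (indicator X) (indicator Y)" for X :: "'a set" and Y :: "'b set"
      by (auto simp: tensor_def fun_eq_iff split: split_indicator)
    have fin: "emeasure A (SA i \<inter> X) < \<infinity>" "emeasure B (SB j \<inter> Y) < \<infinity>"
      if "X \<in> sets A" "Y \<in> sets B" for X Y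
      using emeasure_mono[of "SA i \<inter> X" "SA i" A] emeasure_mono[of "SB j \<inter> Y" "SB j" B] SA(3)[of i] SB(3)[of j]
        that sets by (auto simp: less_top[symmetric] top_unique)
    have H_int[measurable]: "integrable (A \<Otimes>\<^sub>M B) H"
    proof -
      have "indicator (SA i \<times> SB j) \<in> L2 (A \<Otimes>\<^sub>M B)"
        unfolding ind_eq using fin[of "space A" "space B"] sets
        by (intro tensor_L2[OF A B] indL2) (auto simp: sets.Int_space_eq2)
      then show ?thesis unfolding H_def by (intro L2_integrable_mult F)
    qed
    have EH_int: "integrable (A \<Otimes>\<^sub>M B) (\<lambda>p. indicator E p * H p)" if [measurable]: "E \<in> sets (A \<Otimes>\<^sub>M B)" for E
      by (rule Bochner_Integration.integrable_bound[OF H_int]) (auto split: split_indicator)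
    have zero: "(\<integral>p. indicator E p * H p \<partial>(A \<Otimes>\<^sub>M B)) = 0" if "E \<in> sets (A \<Otimes>\<^sub>M B)" for E
      using Int_stable_pair_measure_generator[of A B] pair_measure_closed[of A B] that[unfolded sets_pair_measure]
    proof (induction rule: sigma_sets_induct_disjoint)
      case (basic E)
      then obtain X Y where E: "E = X \<times> Y" and XY[measurable]: "X \<in> sets A" "Y \<in> sets B" by auto
      have "(\<integral>p. indicator E p * H p \<partial>(A \<Otimes>\<^sub>M B)) = ip (A \<Otimes>\<^sub>M B) (indicator ((SA i \<inter> X) \<times> (SB j \<inter> Y))) F"
        unfolding ip_def H_def E by (intro Bochner_Integration.integral_cong) (auto split: split_indicator)
      also have "\<dots> = 0" unfolding ind_eq using fin[OF XY] by (intro z indL2) auto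
      finally show ?case .
    next
      case empty then show ?case by simp
    next
      case (compl E)
      have sE: "E \<in> sets (A \<Otimes>\<^sub>M B)" using compl by (simp add: sets_pair_measure)
      have "(\<integral>p. indicator (space A \<times> space B - E) p * H p \<partial>(A \<Otimes>\<^sub>M B)) = (\<integral>p. H p - indicator E p * H p \<partial>(A \<Otimes>\<^sub>M B))"
        by (intro Bochner_Integration.integral_cong) (auto simp: space_pair_measure split: split_indicator)
      also have "\<dots> = (\<integral>p. H p \<partial>(A \<Otimes>\<^sub>M B)) - 0"
        by (subst Bochner_Integration.integral_diff) (use H_int EH_int[OF sE] compl in auto)
      also have "(\<integral>p. H p \<partial>(A \<Otimes>\<^sub>M B)) = ip (A \<Otimes>\<^sub>M B) (tensor (indicator (SA i)) (indicator (SB j))) F"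
        unfolding ip_def H_def ind_eq ..
      also have "\<dots> = 0" using fin[of "space A" "space B"] sets by (intro z indL2) (auto simp: sets.Int_space_eq2)
      finally show ?case by simp
    next
      case (union E)
      have sE[measurable]: "E n \<in> sets (A \<Otimes>\<^sub>M B)" for n using union by (auto simp: sets_pair_measure)
      have "(LINT p:(\<Union>n. E n)|A \<Otimes>\<^sub>M B. H p) = (\<Sum>n. LINT p:E n|A \<Otimes>\<^sub>M B. H p)"
        using union(1) EH_int[of "\<Union>n. E n"]
        by (intro lebesgue_integral_countable_add) (auto simp: disjoint_family_on_def set_integrable_def)
      then show ?case using union by (simp add: set_lebesgue_integral_def)
    qed
    \<comment> \<open>The two sets are those where \<open>H\<close> is positive and nonpositive;
      both integrals vanish, hence so does that of the absolute value.\<close>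
    have "(\<integral>p. \<bar>H p\<bar> \<partial>(A \<Otimes>\<^sub>M B)) = (\<integral>p. indicator {p \<in> space (A \<Otimes>\<^sub>M B). H p > 0} p * H p - indicator {p \<in> space (A \<Otimes>\<^sub>M B). H p \<le> 0} p * H p \<partial>(A \<Otimes>\<^sub>M B))"
      by (intro Bochner_Integration.integral_cong) (auto split: split_indicator)
    also have "\<dots> = 0"
      by (subst Bochner_Integration.integral_diff) (auto intro!: EH_int simp: zero)
    finally have "AE p in A \<Otimes>\<^sub>M B. \<bar>H p\<bar> = 0"
      by (subst (asm) integral_nonneg_eq_0_iff_AE) (use H_int in auto)
    then show ?thesis by eventually_elim (auto simp: H_def)
  qed
  then have "AE p in A \<Otimes>\<^sub>M B. \<forall>i j. p \<in> SA i \<times> SB j \<longrightarrow> F p = 0"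
    unfolding AE_all_countable by blast
  then show ?thesis using AE_space
  proof eventually_elim
    case (elim p)
    then have "fst p \<in> (\<Union>i. SA i)" "snd p \<in> (\<Union>i. SB i)"
      by (auto simp: space_pair_measure SA(2) SB(2))
    then obtain i j where "p \<in> SA i \<times> SB j" by (auto simp: mem_Times_iff)
    then show ?case using elim by blast
  qed
qed

lemma nrm2_cong_AE:
  assumes "AE x in M. f x = g x" "f \<in> L2 M" "g \<in> L2 M"
  shows "nrm2 M f = nrm2 M g"
  using assms by (intro ip_cong_AE) auto

text \<open>The quadratic form of \<open>F F^T\<close> at \<open>f\<close> is the squared norm of
  \<open>hs_app A F f\<close>. If \<open>F F^T\<close> is null, all these images vanish, so
  \<open>F\<close> is orthogonal to every tensor.\<close>

lemma hs_comp_self_nonzero: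
  assumes A: "sigma_finite_measure A" and B: "sigma_finite_measure B" and F: "F \<in> L2 (A \<Otimes>\<^sub>M B)"
    and z: "nrm2 (A \<Otimes>\<^sub>M A) (hs_comp B F (tr F)) = 0"
  shows "AE p in A \<Otimes>\<^sub>M B. F p = 0"
proof (rule AE_zero_if_orthogonal_to_tensors[OF A B F])
  fix f g assume f: "f \<in> L2 A" and g: "g \<in> L2 B"
  let ?P = "hs_comp B F (tr F)"
  have P: "?P \<in> L2 (A \<Otimes>\<^sub>M A)" by (rule hs_comp_L2[OF A B A F tr_L2[OF A B F]])
  have Pz: "AE p in A \<Otimes>\<^sub>M A. ?P p = 0" using nrm2_zero_iff[OF P] z by simp
  note Ff = hs_app_L2[OF A B F f]
  note t = hs_app_L2[OF B A tr_L2[OF A B F] Ff]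
  have "nrm2 B (hs_app A F f) = ip A f (hs_app B (tr F) (hs_app A F f))"
    by (rule hs_app_adjoint(1)[OF A B F f Ff])
  also have "\<dots> = ip A f (hs_app A ?P f)"
  proof (rule ip_cong_AE)
    show "AE x in A. hs_app B (tr F) (hs_app A F f) x = hs_app A ?P f x"
      using L2_slice1[OF A B F]
    proof eventually_elim
      case (elim x)
      show ?case using Fubini_three(1)[OF A B f elim F]
        by (simp add: hs_app_def hs_comp_def tr_def mult.commute)
    qed
  qed (use f t hs_app_L2[OF A A P f] in auto)
  also have "\<dots> = ip (A \<Otimes>\<^sub>M A) (tensor f f) ?P"
    using hs_app_adjoint(2)[OF A A P f f] by (simp add: ip_commute)
  also have "\<dots> = ip (A \<Otimes>\<^sub>M A) (tensor f f) (\<lambda>_. 0)"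
    by (rule ip_cong_AE) (use Pz P tensor_L2[OF A A f f] in auto)
  finally have "nrm2 B (hs_app A F f) = 0" by (simp add: ip_def)
  then have "AE b in B. hs_app A F f b = 0" using nrm2_zero_iff[OF Ff] by simp
  then have "ip B (hs_app A F f) g = ip B (\<lambda>_. 0) g"
    by (intro ip_cong_AE) (use Ff g in auto)
  then show "ip (A \<Otimes>\<^sub>M B) (tensor f g) F = 0"
    using hs_app_adjoint(2)[OF A B F f g] by (simp add: ip_def)
qed

text \<open>Power iteration on kernels: the renormalised even powers of \<open>F F\<^sup>T\<close> applied to \<open>F\<close> form
  a Cauchy sequence, because all their inner products are values of the single convergent sequence
  \<open>N n / r ^ n\<close>; submultiplicativity of the Hilbert-Schmidt norm keeps the limit away from 0.\<close>

lemma hs_eigenfunction_exists: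
  assumes A: "sigma_finite_measure A" and B: "sigma_finite_measure B" and F: "F \<in> L2 (A \<Otimes>\<^sub>M B)"
    and nz: "\<not> (AE p in A \<Otimes>\<^sub>M B. F p = 0)"
  shows "\<exists>c g. c \<noteq> 0 \<and> g \<in> L2 A \<and> \<not> (AE x in A. g x = 0) \<and>
     (AE x in A. (\<integral>y. hs_comp B F (tr F) (x, y) * g y \<partial>A) = c * g x)"
proof -
  interpret A: sigma_finite_measure A by fact
  interpret B: sigma_finite_measure B by fact
  interpret AB: pair_sigma_finite A B ..
  let ?M = "A \<Otimes>\<^sub>M B"
  define P where "P = hs_comp B F (tr F)"
  have P: "P \<in> L2 (A \<Otimes>\<^sub>M A)" unfolding P_def by (rule hs_comp_L2[OF A B A F tr_L2[OF A B F]])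
  have Psym: "tr P = P" unfolding P_def hs_comp_tr by simp
  define T where "T G = hs_comp A P G" for G :: "'a \<times> 'b \<Rightarrow> real"
  have T_L2: "T G \<in> L2 ?M" if "G \<in> L2 ?M" for G unfolding T_def by (rule hs_comp_L2[OF A A B P that])
  have T_nrm: "nrm2 ?M (T G) \<le> nrm2 (A \<Otimes>\<^sub>M A) P * nrm2 ?M G" if "G \<in> L2 ?M" for G
    unfolding T_def by (rule hs_comp_nrm2[OF A A B P that])
  \<comment> \<open>Both forms are inner products of \<open>P\<close> with a composition of
    \<open>H\<close> and \<open>tr G\<close> or with its transpose; they agree since
    \<open>P\<close> is symmetric.\<close>
  have T_sym: "ip ?M (T G) H = ip ?M G (T H)" if G: "G \<in> L2 ?M" and H: "H \<in> L2 ?M" for G H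
  proof -
    have "ip ?M (T G) H = ip (A \<Otimes>\<^sub>M A) P (hs_comp B H (tr G))"
      unfolding T_def by (rule hs_comp_adjoint[OF A A B P G H])
    also have "\<dots> = ip (A \<Otimes>\<^sub>M A) (tr P) (tr (hs_comp B H (tr G)))"
      by (rule ip_tr[symmetric, OF A A P hs_comp_L2[OF A B A H tr_L2[OF A B G]]])
    also have "\<dots> = ip ?M (T H) G"
      unfolding T_def hs_comp_adjoint[OF A A B P H G] by (simp add: Psym hs_comp_tr)
    finally show ?thesis by (simp add: ip_commute)
  qed
  define W where "W n = (T ^^ n) F" for n
  have W0: "W 0 = F" and WS: "W (Suc n) = T (W n)" for n by (simp_all add: W_def)
  have W_L2: "W n \<in> L2 ?M" for n by (induction n) (auto simp: W0 WS F T_L2)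
  have W_shift: "ip ?M (W (i + k)) (W j) = ip ?M (W i) (W (k + j))" for i j k
  proof (induction k arbitrary: j)
    case (Suc k)
    have "ip ?M (W (i + Suc k)) (W j) = ip ?M (W (i + k)) (W (Suc j))"
      by (simp add: WS T_sym W_L2)
    then show ?case using Suc[of "Suc j"] by simp
  qed simp
  have W_ip: "ip ?M (W i) (W j) = ip ?M (W k) (W l)" if "i + j = k + l" for i j k l
    using W_shift[of 0 i j] W_shift[of 0 k l] that by simp
  define N where "N n = nrm2 ?M (W n)" for n
  \<comment> \<open>Cauchy-Schwarz for \<open>W n\<close> and \<open>W (n + 2)\<close>, whose inner
    product is \<open>N (n + 1)\<close> by symmetry of \<open>T\<close>: log-convexity.\<close>
  have conv: "(N (Suc n))\<^sup>2 \<le> N n * N (Suc (Suc n))" for n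
    using Cauchy_Schwarz_L2[OF W_L2 W_L2, of n "Suc (Suc n)"] W_ip[of n "Suc (Suc n)" "Suc n" "Suc n"]
    unfolding N_def by simp
  have N0: "N 0 > 0"
    using nz nrm2_zero_iff[OF F] nrm2_nonneg[of ?M F] unfolding N_def W0 by linarith
  \<comment> \<open>The inner product of \<open>P F\<close> and \<open>F\<close> is the squared norm
    of \<open>P\<close>, which is not zero. Log-convexity then carries positivity to every
    index.\<close>
  have N1: "N 1 > 0"
  proof -
    have "nrm2 (A \<Otimes>\<^sub>M A) P \<noteq> 0" using hs_comp_self_nonzero[OF A B F] nz unfolding P_def by blast
    moreover have "nrm2 (A \<Otimes>\<^sub>M A) P = ip ?M (W 1) (W 0)"
      using hs_comp_adjoint[OF A A B P F F] unfolding W_def T_def by (simp add: P_def)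
    moreover have "(ip ?M (W 1) (W 0))\<^sup>2 \<le> N 1 * N 0"
      unfolding N_def by (intro Cauchy_Schwarz_L2 W_L2)
    ultimately have "N 1 * N 0 > 0" by (metis less_le_trans zero_less_power2)
    then show ?thesis using N0 by (simp add: zero_less_mult_iff)
  qed
  have "N n > 0 \<and> N (Suc n) > 0" for n
  proof (induction n)
    case 0 then show ?case using N0 N1 by simp
  next
    case (Suc n)
    then have "0 < N n * N (Suc (Suc n))" using conv[of n] by (metis less_le_trans zero_less_power)
    then show ?case using Suc by (simp add: zero_less_mult_iff)
  qed
  then have pos: "N n > 0" for n by blast
  \<comment> \<open>As \<open>P\<close> is \<open>F F^T\<close>, one factor \<open>P\<close> can be
    split in the middle: \<open>P^(n+m+1) F\<close> is \<open>(P^n F F^T) (P^m F)\<close>. The norm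
    inequality for compositions then gives \<open>sub\<close>.\<close>
  have W_split: "AE p in ?M. W (n + m + 1) p = hs_comp A (hs_comp B (W n) (tr F)) (W m) p" for n m
  proof (induction n)
    case 0
    then show ?case by (simp add: WS W0 T_def P_def)
  next
    case (Suc n)
    note trF = tr_L2[OF A B F]
    note Q = hs_comp_L2[OF A B A W_L2 trF, of n] and Q' = hs_comp_L2[OF A B A W_L2 trF, of "Suc n"]
    have 1: "AE p in ?M. T (W (n + m + 1)) p = T (hs_comp A (hs_comp B (W n) (tr F)) (W m)) p"
      unfolding T_def by (rule hs_comp_cong_AE[OF A A B P P W_L2 hs_comp_L2[OF A A B Q W_L2] _ Suc]) auto
    have 2: "AE p in ?M. hs_comp A (hs_comp A P (hs_comp B (W n) (tr F))) (W m) p = T (hs_comp A (hs_comp B (W n) (tr F)) (W m)) p"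
      unfolding T_def by (rule hs_comp_assoc[OF A A A B P Q W_L2])
    have "AE p in A \<Otimes>\<^sub>M A. hs_comp B (hs_comp A P (W n)) (tr F) p = hs_comp A P (hs_comp B (W n) (tr F)) p"
      by (rule hs_comp_assoc[OF A A B A P W_L2 trF])
    then have 3: "AE p in A \<Otimes>\<^sub>M A. hs_comp B (W (Suc n)) (tr F) p = hs_comp A P (hs_comp B (W n) (tr F)) p"
      by (simp add: WS T_def)
    have 4: "AE p in ?M. hs_comp A (hs_comp B (W (Suc n)) (tr F)) (W m) p = hs_comp A (hs_comp A P (hs_comp B (W n) (tr F))) (W m) p"
      by (rule hs_comp_cong_AE[OF A A B Q' hs_comp_L2[OF A A A P Q] W_L2 W_L2 3]) auto
    show ?case using 1 2 4 by eventually_elim (simp add: WS)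
  qed
  have sub: "N (n + m + 1) \<le> N 0 * N n * N m" for n m
  proof -
    note trF = tr_L2[OF A B F]
    note Q = hs_comp_L2[OF A B A W_L2 trF, of n]
    have "N (n + m + 1) = nrm2 ?M (hs_comp A (hs_comp B (W n) (tr F)) (W m))"
      unfolding N_def by (rule nrm2_cong_AE[OF W_split W_L2 hs_comp_L2[OF A A B Q W_L2]])
    also have "\<dots> \<le> nrm2 (A \<Otimes>\<^sub>M A) (hs_comp B (W n) (tr F)) * N m"
      unfolding N_def by (rule hs_comp_nrm2[OF A A B Q W_L2])
    also have "\<dots> \<le> (N n * nrm2 (B \<Otimes>\<^sub>M A) (tr F)) * N m"
      unfolding N_def by (intro mult_right_mono hs_comp_nrm2[OF A B A W_L2 trF] nrm2_nonneg)
    also have "nrm2 (B \<Otimes>\<^sub>M A) (tr F) = N 0" unfolding N_def W0 by (rule ip_tr[OF A B F F])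
    finally show ?thesis by (simp add: mult_ac)
  qed
  obtain r L where r: "r > 0" and L: "L > 0" and lim: "(\<lambda>n. N n / r ^ n) \<longlonglongrightarrow> L"
    using ratio_limit[OF pos conv sub] by blast
  define a where "a n = N n / r ^ n" for n
  \<comment> \<open>Only even powers occur: the inner product of \<open>W (2 * n)\<close> and
    \<open>W (2 * m)\<close> is \<open>N (n + m)\<close>, which the two normalisations together
    divide by \<open>r ^ (n + m)\<close>.\<close>
  define h where "h n = (\<lambda>p. (1 / r ^ n) * W (2 * n) p)" for n
  have h_L2: "h n \<in> L2 ?M" for n unfolding h_def by (intro L2_cmult W_L2)
  have h_ip: "ip ?M (h n) (h m) = a (n + m)" for n m
    using W_ip[of "2 * n" "2 * m" "n + m" "n + m"]
    unfolding h_def ip_cmult_left ip_cmult_right by (simp add: a_def N_def power_add)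
  have "\<exists>G\<in>L2 ?M. (\<lambda>n. nrm2 ?M (\<lambda>x. h n x - G x)) \<longlonglongrightarrow> 0"
  proof (rule L2_complete[OF h_L2])
    fix e :: real assume e: "e > 0"
    obtain K where K: "\<And>n. n \<ge> K \<Longrightarrow> \<bar>a n - L\<bar> < e / 4"
      using LIMSEQ_D[OF lim, of "e / 4"] e unfolding a_def by auto
    have "nrm2 ?M (\<lambda>x. h n x - h m x) < e" if "n \<ge> K" "m \<ge> K" for n m
    proof -
      have "nrm2 ?M (\<lambda>x. h n x - h m x) = a (n + n) + a (m + m) - 2 * a (n + m)"
        by (simp add: nrm2_diff h_L2 h_ip)
      then show ?thesis using K[of "n + n"] K[of "m + m"] K[of "n + m"] that by linarith
    qed
    then show "\<exists>N. \<forall>n\<ge>N. \<forall>m\<ge>N. nrm2 ?M (\<lambda>x. h n x - h m x) < e" by blast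
  qed
  then obtain G where G: "G \<in> L2 ?M" and hG: "(\<lambda>n. nrm2 ?M (\<lambda>x. h n x - G x)) \<longlonglongrightarrow> 0" by blast
  have "nrm2 ?M G = L"
  proof (rule LIMSEQ_unique)
    show "(\<lambda>n. nrm2 ?M (h n)) \<longlonglongrightarrow> nrm2 ?M G" by (rule nrm2_tendsto[OF h_L2 G hG])
    have "(\<lambda>n. a (2 * n)) \<longlonglongrightarrow> L"
      using LIMSEQ_subseq_LIMSEQ[OF lim, of "\<lambda>n. 2 * n"] by (simp add: a_def o_def strict_mono_def)
    then show "(\<lambda>n. nrm2 ?M (h n)) \<longlonglongrightarrow> L" by (simp add: h_ip mult_2)
  qed
  then have Gnz: "\<not> (AE p in ?M. G p = 0)" using nrm2_zero_iff[OF G] L by simp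
  have T_diff: "AE p in ?M. T (\<lambda>p. H p - H' p) p = T H p - T H' p" if "H \<in> L2 ?M" "H' \<in> L2 ?M" for H H'
    using hs_comp_lin_right[OF A A B P that, of "-1"] by (simp add: T_def)
  have T_tendsto: "(\<lambda>n. nrm2 ?M (\<lambda>p. T (H n) p - T H' p)) \<longlonglongrightarrow> 0"
    if H: "\<And>n. H n \<in> L2 ?M" "H' \<in> L2 ?M" and lim: "(\<lambda>n. nrm2 ?M (\<lambda>p. H n p - H' p)) \<longlonglongrightarrow> 0" for H H'
  proof (rule tendsto_sandwich[OF _ _ tendsto_const tendsto_mult_right_zero[OF lim, of "nrm2 (A \<Otimes>\<^sub>M A) P"]])
    have "nrm2 ?M (\<lambda>p. T (H n) p - T H' p) \<le> nrm2 (A \<Otimes>\<^sub>M A) P * nrm2 ?M (\<lambda>p. H n p - H' p)" for n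
    proof -
      have "nrm2 ?M (\<lambda>p. T (H n) p - T H' p) = nrm2 ?M (T (\<lambda>p. H n p - H' p))"
        by (rule nrm2_cong_AE[OF AE_symmetric[OF T_diff]]) (intro L2_diff T_L2 H)+
      also have "\<dots> \<le> nrm2 (A \<Otimes>\<^sub>M A) P * nrm2 ?M (\<lambda>p. H n p - H' p)" by (intro T_nrm L2_diff H)
      finally show ?thesis .
    qed
    then show "\<forall>\<^sub>F n in sequentially. nrm2 ?M (\<lambda>p. T (H n) p - T H' p) \<le> nrm2 (A \<Otimes>\<^sub>M A) P * nrm2 ?M (\<lambda>p. H n p - H' p)"
      by simp
  qed (simp add: nrm2_nonneg)
  \<comment> \<open>Applying \<open>T\<close> twice shifts the sequence and multiplies it by
    \<open>r\<close>, so the limit \<open>G\<close> is an eigenvector of the square of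
    \<open>T\<close>.\<close>
  have TTh: "T (T (h n)) = (\<lambda>p. r * h (Suc n) p)" for n
    unfolding h_def T_def hs_comp_cmult_right using r by (simp add: WS T_def)
  have "AE p in ?M. T (T G) p = r * G p"
  proof (rule L2_limit_unique)
    show "(\<lambda>n. nrm2 ?M (\<lambda>p. T (T (h n)) p - T (T G) p)) \<longlonglongrightarrow> 0"
      by (intro T_tendsto T_L2 h_L2 G hG)
    have "nrm2 ?M (\<lambda>p. T (T (h n)) p - r * G p) = r\<^sup>2 * nrm2 ?M (\<lambda>p. h (Suc n) p - G p)" for n
    proof -
      have "(\<lambda>p. T (T (h n)) p - r * G p) = (\<lambda>p. r * (h (Suc n) p - G p))"
        by (simp add: TTh right_diff_distrib)
      then show ?thesis by (simp add: ip_cmult_left ip_cmult_right power2_eq_square)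
    qed
    then show "(\<lambda>n. nrm2 ?M (\<lambda>p. T (T (h n)) p - r * G p)) \<longlonglongrightarrow> 0"
      using tendsto_mult_right_zero[OF LIMSEQ_Suc[OF hG], of "r\<^sup>2"] by simp
  qed (intro T_L2 h_L2 G L2_cmult)+
  note TTG = this
  define s where "s = sqrt r"
  have s: "s > 0" "s * s = r" using r by (simp_all add: s_def)
  \<comment> \<open>The operator \<open>T T - r\<close> factors as \<open>(T - s) (T + s)\<close>:
    either \<open>T G + s G\<close> is an eigenvector for \<open>s\<close>, or it vanishes and
    \<open>G\<close> is one for \<open>- s\<close>.\<close>
  define G' where "G' p = T G p + s * G p" for p
  have G': "G' \<in> L2 ?M" unfolding G'_def by (intro L2_intros T_L2 G)
  have "AE p in ?M. T G' p = T (T G) p + s * T G p"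
    using hs_comp_lin_right[OF A A B P T_L2[OF G] G, of s] by (simp add: T_def G'_def[abs_def])
  with TTG have TG': "AE p in ?M. T G' p = s * G' p"
    by eventually_elim (simp add: G'_def algebra_simps s(2)[symmetric])
  have "\<exists>c H. c \<noteq> 0 \<and> H \<in> L2 ?M \<and> \<not> (AE p in ?M. H p = 0) \<and> (AE p in ?M. T H p = c * H p)"
  proof (cases "AE p in ?M. G' p = 0")
    case True
    then have "AE p in ?M. T G p = - s * G p" by eventually_elim (simp add: G'_def)
    then show ?thesis using G Gnz s by (intro exI[of _ "-s"] exI[of _ G]) auto
  next
    case False
    then show ?thesis using G' TG' s by (intro exI[of _ s] exI[of _ G']) auto
  qed
  then obtain c H where c: "c \<noteq> 0" and H: "H \<in> L2 ?M" and Hnz: "\<not> (AE p in ?M. H p = 0)"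
    and TH: "AE p in ?M. T H p = c * H p" by blast
  note [measurable] = L2_measurable[OF H] L2_measurable[OF T_L2[OF H]]
  have "AE a in A. AE b in B. T H (a, b) = c * H (a, b)" using AB.AE_pair[OF TH] by simp
  then have 1: "AE b in B. AE a in A. T H (a, b) = c * H (a, b)"
    by (subst (asm) AB.AE_commute) (auto simp: split_def)
  have 2: "\<not> (AE b in B. AE a in A. H (a, b) = 0)"
  proof
    assume "AE b in B. AE a in A. H (a, b) = 0"
    then have "AE a in A. AE b in B. H (a, b) = 0"
      by (subst AB.AE_commute) (auto simp: split_def)
    then show False using Hnz AB.AE_pair_measure[of "\<lambda>p. H p = 0"] by auto
  qed
  \<comment> \<open>The operator \<open>T\<close> acts on the first variable only, so almost every
    slice of \<open>H\<close> satisfies the eigenvalue equation; as \<open>H\<close> is not null,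
    one such slice is not null.\<close>
  have "\<exists>b. (AE a in A. T H (a, b) = c * H (a, b)) \<and> (\<lambda>a. H (a, b)) \<in> L2 A \<and> \<not> (AE a in A. H (a, b) = 0)"
  proof (rule ccontr)
    assume n: "\<not> ?thesis"
    have "AE b in B. AE a in A. H (a, b) = 0"
      using 1 L2_slice2[OF A B H] by eventually_elim (use n in blast)
    then show False using 2 by blast
  qed
  then obtain b where b: "AE a in A. T H (a, b) = c * H (a, b)" "(\<lambda>a. H (a, b)) \<in> L2 A" "\<not> (AE a in A. H (a, b) = 0)"
    by blast
  show ?thesis
    by (rule exI[of _ c], rule exI[of _ "\<lambda>a. H (a, b)"]) (use c b in \<open>auto simp: T_def P_def hs_comp_def\<close>)
qed

lemma hs_app_factor:
  assumes A: "sigma_finite_measure A" and B: "sigma_finite_measure B"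
    and F: "F \<in> L2 (A \<Otimes>\<^sub>M B)" and f: "f \<in> L2 A"
  shows "AE x in A. (\<integral>y. hs_comp B F (tr F) (x, y) * f y \<partial>A) = hs_app B (tr F) (hs_app A F f) x"
  using L2_slice1[OF A B F]
proof eventually_elim
  case (elim x)
  show ?case using Fubini_three(1)[OF A B f elim F]
    by (simp add: hs_app_def hs_comp_def tr_def mult.commute)
qed

lemma hs_kernel_apply_L2:
  assumes A: "sigma_finite_measure A" and P: "P \<in> L2 (A \<Otimes>\<^sub>M A)" and f: "f \<in> L2 A"
  shows "(\<lambda>x. \<integral>y. P (x, y) * f y \<partial>A) \<in> L2 A"
  using hs_app_L2[OF A A tr_L2[OF A A P] f] by (simp add: hs_app_def tr_def)

lemma hs_form_factor:
  assumes A: "sigma_finite_measure A" and B: "sigma_finite_measure B"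
    and F: "F \<in> L2 (A \<Otimes>\<^sub>M B)" and f: "f \<in> L2 A" and g: "g \<in> L2 A"
  shows "ip A f (\<lambda>x. \<integral>y. hs_comp B F (tr F) (x, y) * g y \<partial>A) = ip B (hs_app A F f) (hs_app A F g)"
proof -
  note Fg = hs_app_L2[OF A B F g]
  have "ip A f (\<lambda>x. \<integral>y. hs_comp B F (tr F) (x, y) * g y \<partial>A) = ip A f (hs_app B (tr F) (hs_app A F g))"
    by (rule ip_cong_AE[OF _ hs_app_factor[OF A B F g]])
      (use f hs_kernel_apply_L2[OF A hs_comp_L2[OF A B A F tr_L2[OF A B F]] g] hs_app_L2[OF B A tr_L2[OF A B F] Fg] in auto)
  then show ?thesis using hs_app_adjoint(1)[OF A B F f Fg] by simp
qed

lemma L2_eq_AE_I: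
  assumes f: "f \<in> L2 M" and g: "g \<in> L2 M" and e: "\<And>h. h \<in> L2 M \<Longrightarrow> ip M h f = ip M h g"
  shows "AE x in M. f x = g x"
proof -
  have d: "(\<lambda>x. f x - g x) \<in> L2 M" by (intro L2_diff f g)
  have "nrm2 M (\<lambda>x. f x - g x) = 0"
    using e[OF d] f g d by (simp add: ip_diff_right)
  then show ?thesis using nrm2_zero_iff[OF d] by simp
qed

text \<open>Indices with \<open>lam i = 0\<close> only pad the enumeration and carry the zero function.\<close>

locale feature_kernel =
  fixes \<mu> :: "'a measure" and \<nu> :: "'b measure" and \<Phi> :: "'a \<times> 'b \<Rightarrow> real"
    and lam :: "nat \<Rightarrow> real" and \<phi> :: "nat \<Rightarrow> 'a \<Rightarrow> real"
  assumes sf_\<mu>: "sigma_finite_measure \<mu>" and sf_\<nu>: "sigma_finite_measure \<nu>"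
    and \<Phi>: "\<Phi> \<in> L2 (\<mu> \<Otimes>\<^sub>M \<nu>)"
    and \<phi>: "\<And>i. \<phi> i \<in> L2 \<mu>"
    and orth: "\<And>i j. ip \<mu> (\<phi> i) (\<phi> j) = (if i = j \<and> lam i \<noteq> 0 then 1 else 0)"
    and eig: "\<And>i. AE x in \<mu>. (\<integral>y. hs_comp \<nu> \<Phi> (tr \<Phi>) (x, y) * \<phi> i y \<partial>\<mu>) = lam i * \<phi> i x"
    and maximal: "\<And>c g. c \<noteq> 0 \<Longrightarrow> g \<in> L2 \<mu> \<Longrightarrow>
      AE x in \<mu>. (\<integral>y. hs_comp \<nu> \<Phi> (tr \<Phi>) (x, y) * g y \<partial>\<mu>) = c * g x \<Longrightarrow>
      (\<And>i. ip \<mu> g (\<phi> i) = 0) \<Longrightarrow> AE x in \<mu>. g x = 0"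
begin

definition \<kappa> :: "'a \<times> 'a \<Rightarrow> real" where "\<kappa> = hs_comp \<nu> \<Phi> (tr \<Phi>)"

text \<open>The right singular functions of \<open>\<Phi>\<close>, left unnormalised: they are
  orthogonal with squared norm \<open>lam i\<close>, so no division by a possibly vanishing
  \<open>lam i\<close> occurs.\<close>

definition e :: "nat \<Rightarrow> 'b \<Rightarrow> real" where "e i = hs_app \<mu> \<Phi> (\<phi> i)"

lemma \<kappa>_L2: "\<kappa> \<in> L2 (\<mu> \<Otimes>\<^sub>M \<mu>)"
  unfolding \<kappa>_def by (intro hs_comp_L2 tr_L2 sf_\<mu> sf_\<nu> \<Phi>)

lemma e_L2: "e i \<in> L2 \<nu>"
  unfolding e_def by (intro hs_app_L2 sf_\<mu> sf_\<nu> \<Phi> \<phi>)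

lemma \<kappa>_sym: "tr \<kappa> = \<kappa>"
  by (simp add: \<kappa>_def hs_comp_tr)

lemma ip_app_e:
  assumes g: "g \<in> L2 \<mu>"
  shows "ip \<nu> (hs_app \<mu> \<Phi> g) (e i) = lam i * ip \<mu> g (\<phi> i)"
proof -
  have "ip \<nu> (hs_app \<mu> \<Phi> g) (e i) = ip \<mu> g (\<lambda>x. \<integral>y. hs_comp \<nu> \<Phi> (tr \<Phi>) (x, y) * \<phi> i y \<partial>\<mu>)"
    unfolding e_def by (rule hs_form_factor[OF sf_\<mu> sf_\<nu> \<Phi> g \<phi>, symmetric])
  also have "\<dots> = ip \<mu> g (\<lambda>x. lam i * \<phi> i x)"
    by (rule ip_cong_AE[OF _ eig])
      (use g \<phi>[of i] hs_kernel_apply_L2[OF sf_\<mu> \<kappa>_L2 \<phi>, of i] in \<open>auto simp: \<kappa>_def\<close>)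
  finally show ?thesis by (simp add: ip_cmult_right)
qed

lemma ip_e: "ip \<nu> (e i) (e j) = (if i = j then lam i else 0)"
  using ip_app_e[OF \<phi>, of i j] by (auto simp: orth e_def[symmetric])

lemma lam_nonneg: "lam i \<ge> 0"
  using ip_e[of i i] nrm2_nonneg[of \<nu> "e i"] by simp

lemma tensor_\<phi>_e_L2: "tensor (\<phi> i) (e i) \<in> L2 (\<mu> \<Otimes>\<^sub>M \<nu>)"
  by (intro tensor_L2 sf_\<mu> sf_\<nu> \<phi> e_L2)

lemma ip_tensor_\<Phi>:
  assumes "f \<in> L2 \<mu>" "h \<in> L2 \<nu>"
  shows "ip (\<mu> \<Otimes>\<^sub>M \<nu>) (tensor f h) \<Phi> = ip \<nu> (hs_app \<mu> \<Phi> f) h"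
  using hs_app_adjoint(2)[OF sf_\<mu> sf_\<nu> \<Phi> assms] by simp

lemma ip_tensor_tensor:
  assumes "f \<in> L2 \<mu>" "h \<in> L2 \<nu>"
  shows "ip (\<mu> \<Otimes>\<^sub>M \<nu>) (tensor f h) (tensor (\<phi> i) (e i)) = ip \<mu> (\<phi> i) f * ip \<nu> (e i) h"
  using hs_app_adjoint(2)[OF sf_\<mu> sf_\<nu> tensor_\<phi>_e_L2 assms, of i]
  by (simp add: hs_app_tensor ip_cmult_left)

definition \<Phi>N :: "nat set \<Rightarrow> 'a \<times> 'b \<Rightarrow> real" where
  "\<Phi>N I = (\<lambda>p. \<Sum>i\<in>I. tensor (\<phi> i) (e i) p)"

lemma \<Phi>N_L2: "\<Phi>N I \<in> L2 (\<mu> \<Otimes>\<^sub>M \<nu>)"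
  unfolding \<Phi>N_def by (intro L2_sum tensor_\<phi>_e_L2)

lemma nrm2_\<Phi>N: "finite I \<Longrightarrow> nrm2 (\<mu> \<Otimes>\<^sub>M \<nu>) (\<Phi>N I) = (\<Sum>i\<in>I. lam i)"
proof -
  assume fin: "finite I"
  have "ip (\<mu> \<Otimes>\<^sub>M \<nu>) (tensor (\<phi> i) (e i)) (\<Phi>N I) = lam i" if "i \<in> I" for i
  proof -
    have "ip (\<mu> \<Otimes>\<^sub>M \<nu>) (tensor (\<phi> i) (e i)) (\<Phi>N I) = (\<Sum>j\<in>I. ip \<mu> (\<phi> j) (\<phi> i) * ip \<nu> (e j) (e i))"
      unfolding \<Phi>N_def by (simp add: ip_sum_right tensor_\<phi>_e_L2 ip_tensor_tensor \<phi> e_L2)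
    also have "\<dots> = (\<Sum>j\<in>I. if j = i then lam i else 0)"
      by (intro sum.cong) (auto simp: orth ip_e)
    finally show ?thesis using fin that by simp
  qed
  then show ?thesis
    by (subst (1) \<Phi>N_def) (simp add: ip_sum_left tensor_\<phi>_e_L2 \<Phi>N_L2)
qed

lemma ip_\<Phi>_tensor: "ip (\<mu> \<Otimes>\<^sub>M \<nu>) \<Phi> (tensor (\<phi> i) (e i)) = lam i"
  using ip_tensor_\<Phi>[OF \<phi> e_L2, of i i] ip_e[of i i] by (simp add: ip_commute e_def[symmetric])

text \<open>Pythagoras. The inner product of \<open>\<Phi>\<close> with
  \<open>tensor (\<phi> i) (e i)\<close> equals the squared norm of that tensor, so
  \<open>\<Phi>N I\<close> is an orthogonal projection of \<open>\<Phi>\<close>. This also bounds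
  the partial sums of \<open>lam\<close>.\<close>

lemma nrm2_\<Phi>_diff: "finite I \<Longrightarrow> nrm2 (\<mu> \<Otimes>\<^sub>M \<nu>) (\<lambda>p. \<Phi> p - \<Phi>N I p) = nrm2 (\<mu> \<Otimes>\<^sub>M \<nu>) \<Phi> - (\<Sum>i\<in>I. lam i)"
proof -
  assume "finite I"
  moreover have "ip (\<mu> \<Otimes>\<^sub>M \<nu>) \<Phi> (\<Phi>N I) = (\<Sum>i\<in>I. lam i)"
    unfolding \<Phi>N_def by (simp add: ip_sum_right tensor_\<phi>_e_L2 \<Phi> ip_\<Phi>_tensor)
  ultimately show ?thesis by (simp add: nrm2_diff \<Phi> \<Phi>N_L2 nrm2_\<Phi>N)
qed

lemma lam_summable: "summable lam"
proof (rule bounded_imp_summable[where B = "nrm2 (\<mu> \<Otimes>\<^sub>M \<nu>) \<Phi>"])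
  fix n show "sum lam {..n} \<le> nrm2 (\<mu> \<Otimes>\<^sub>M \<nu>) \<Phi>"
    using nrm2_\<Phi>_diff[of "{..n}"] nrm2_nonneg[of "\<mu> \<Otimes>\<^sub>M \<nu>" "\<lambda>p. \<Phi> p - \<Phi>N {..n} p"] by simp
qed (rule lam_nonneg)

text \<open>The partial sums converge to some \<open>G\<close>, as \<open>lam\<close> is summable.
  If the rest \<open>\<Psi>\<close> were not null, the kernel of \<open>\<Psi>\<close> with its
  transpose would have an eigenfunction \<open>g\<close> with nonzero eigenvalue. It is orthogonal
  to all \<open>\<phi> i\<close>, and on it \<open>\<Psi>\<close> acts like \<open>\<Phi>\<close>,
  so \<open>g\<close> is an eigenfunction of the original kernel, against
  \<open>maximal\<close>.\<close>

lemma \<Phi>N_tendsto_\<Phi>: "(\<lambda>n. nrm2 (\<mu> \<Otimes>\<^sub>M \<nu>) (\<lambda>p. \<Phi>N {..<n} p - \<Phi> p)) \<longlonglongrightarrow> 0"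
proof -
  let ?M = "\<mu> \<Otimes>\<^sub>M \<nu>"
  have dN: "(\<lambda>p. \<Phi>N {..<n} p - \<Phi>N {..<m} p) = \<Phi>N {m..<n}" if "m \<le> n" for m n
    unfolding \<Phi>N_def using that
    by (auto simp: fun_eq_iff sum_diff[symmetric] intro!: sum.cong)
  have "\<exists>G\<in>L2 ?M. (\<lambda>n. nrm2 ?M (\<lambda>x. \<Phi>N {..<n} x - G x)) \<longlonglongrightarrow> 0"
  proof (rule L2_complete[OF \<Phi>N_L2])
    fix \<epsilon> :: real assume \<epsilon>: "\<epsilon> > 0"
    obtain K where K: "\<And>m n. m \<ge> K \<Longrightarrow> norm (sum lam {m..<n}) < \<epsilon>"
      using summable_Cauchy[of lam] lam_summable \<epsilon> by metis
    have *: "nrm2 ?M (\<lambda>x. \<Phi>N {..<n} x - \<Phi>N {..<m} x) < \<epsilon>" if "m \<ge> K" "m \<le> n" for m n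
      using K[of m n] that by (simp add: dN nrm2_\<Phi>N)
    have "nrm2 ?M (\<lambda>x. \<Phi>N {..<n} x - \<Phi>N {..<m} x) < \<epsilon>" if "m \<ge> K" "n \<ge> K" for m n
    proof (cases "m \<le> n")
      case False
      have "nrm2 ?M (\<lambda>x. \<Phi>N {..<n} x - \<Phi>N {..<m} x) = nrm2 ?M (\<lambda>x. \<Phi>N {..<m} x - \<Phi>N {..<n} x)"
        unfolding ip_def by (intro Bochner_Integration.integral_cong) (auto simp: algebra_simps)
      then show ?thesis using *[of n m] that False by simp
    qed (use * that in auto)
    then show "\<exists>N. \<forall>n\<ge>N. \<forall>m\<ge>N. nrm2 ?M (\<lambda>x. \<Phi>N {..<n} x - \<Phi>N {..<m} x) < \<epsilon>" by blast
  qed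
  then obtain G where G: "G \<in> L2 ?M" and limG: "(\<lambda>n. nrm2 ?M (\<lambda>x. \<Phi>N {..<n} x - G x)) \<longlonglongrightarrow> 0" by blast
  define \<Psi> where "\<Psi> = (\<lambda>p. \<Phi> p - G p)"
  have \<Psi>: "\<Psi> \<in> L2 ?M" unfolding \<Psi>_def by (intro L2_diff \<Phi> G)
  \<comment> \<open>Testing the limit \<open>G\<close>, that is \<open>\<Phi>\<close> minus
    \<open>\<Psi>\<close>, against tensors turns the expansion into a statement on numbers.\<close>
  have form: "(\<lambda>n. \<Sum>i<n. ip \<mu> (\<phi> i) f * ip \<nu> (e i) h) \<longlonglongrightarrow> ip \<nu> (hs_app \<mu> \<Phi> f) h - ip \<nu> (hs_app \<mu> \<Psi> f) h"
    if f: "f \<in> L2 \<mu>" and h: "h \<in> L2 \<nu>" for f h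
  proof -
    note t = tensor_L2[OF sf_\<mu> sf_\<nu> f h]
    have "(\<lambda>n. ip ?M (\<Phi>N {..<n}) (tensor f h)) \<longlonglongrightarrow> ip ?M G (tensor f h)"
      by (rule ip_tendsto[OF \<Phi>N_L2 G t limG])
    moreover have "ip ?M (\<Phi>N {..<n}) (tensor f h) = (\<Sum>i<n. ip \<mu> (\<phi> i) f * ip \<nu> (e i) h)" for n
      unfolding \<Phi>N_def by (simp add: ip_sum_right tensor_\<phi>_e_L2 t ip_commute[of _ _ "tensor f h"] ip_tensor_tensor f h)
    moreover have "ip ?M G (tensor f h) = ip \<nu> (hs_app \<mu> \<Phi> f) h - ip \<nu> (hs_app \<mu> \<Psi> f) h"
      unfolding hs_app_adjoint(2)[OF sf_\<mu> sf_\<nu> \<Psi> f h] hs_app_adjoint(2)[OF sf_\<mu> sf_\<nu> \<Phi> f h]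
      by (simp add: \<Psi>_def ip_diff_right t \<Phi> G ip_commute)
    ultimately show ?thesis by simp
  qed
  have e_null: "ip \<nu> (e j) h = 0" if "lam j = 0" "h \<in> L2 \<nu>" for j h
  proof -
    have "AE w in \<nu>. e j w = 0" using nrm2_zero_iff[OF e_L2, of j] ip_e[of j j] that by simp
    then have "ip \<nu> (e j) h = ip \<nu> (\<lambda>_. 0) h"
      by (intro ip_cong_AE) (use e_L2[of j] that in auto)
    then show ?thesis by (simp add: ip_def)
  qed
  \<comment> \<open>On \<open>\<phi> j\<close> only the term with index \<open>j\<close> survives
    and already accounts for all of \<open>e j\<close>, so nothing is left for
    \<open>\<Psi>\<close>. At padded indices \<open>e j\<close> is null.\<close>
  have \<Psi>\<phi>: "ip \<nu> (hs_app \<mu> \<Psi> (\<phi> j)) h = 0" if h: "h \<in> L2 \<nu>" for j h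
  proof -
    have "(\<Sum>i<n. ip \<mu> (\<phi> i) (\<phi> j) * ip \<nu> (e i) h) = ip \<nu> (e j) h" if "n > j" for n
    proof -
      have "(\<Sum>i<n. ip \<mu> (\<phi> i) (\<phi> j) * ip \<nu> (e i) h) = (\<Sum>i<n. if i = j then ip \<nu> (e j) h else 0)"
        using e_null[OF _ h] by (intro sum.cong) (auto simp: orth)
      then show ?thesis using that by simp
    qed
    then have "(\<lambda>n. \<Sum>i<n. ip \<mu> (\<phi> i) (\<phi> j) * ip \<nu> (e i) h) \<longlonglongrightarrow> ip \<nu> (e j) h"
      by (intro tendsto_eventually eventually_sequentiallyI[of "Suc j"]) auto
    from LIMSEQ_unique[OF this form[OF \<phi> h]] show ?thesis by (simp add: e_def)
  qed
  have "AE p in ?M. \<Psi> p = 0"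
  proof (rule ccontr)
    assume "\<not> ?thesis"
    then obtain c g where c: "c \<noteq> 0" and g: "g \<in> L2 \<mu>" and gnz: "\<not> (AE x in \<mu>. g x = 0)"
      and eg: "AE x in \<mu>. (\<integral>y. hs_comp \<nu> \<Psi> (tr \<Psi>) (x, y) * g y \<partial>\<mu>) = c * g x"
      using hs_eigenfunction_exists[OF sf_\<mu> sf_\<nu> \<Psi>] by blast
    note P = hs_comp_L2[OF sf_\<mu> sf_\<nu> sf_\<mu> \<Psi> tr_L2[OF sf_\<mu> sf_\<nu> \<Psi>]]
    note Pg = hs_kernel_apply_L2[OF sf_\<mu> P g]
    note S\<Psi>g = hs_app_L2[OF sf_\<mu> sf_\<nu> \<Psi> g] and Sg = hs_app_L2[OF sf_\<mu> sf_\<nu> \<Phi> g]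
    have form\<Psi>: "ip \<mu> f (\<lambda>x. c * g x) = ip \<nu> (hs_app \<mu> \<Psi> f) (hs_app \<mu> \<Psi> g)" if f: "f \<in> L2 \<mu>" for f
    proof -
      have "ip \<mu> f (\<lambda>x. c * g x) = ip \<mu> f (\<lambda>x. \<integral>y. hs_comp \<nu> \<Psi> (tr \<Psi>) (x, y) * g y \<partial>\<mu>)"
        by (rule ip_cong_AE[OF _ AE_symmetric[OF eg]]) (use f g Pg in auto)
      then show ?thesis using hs_form_factor[OF sf_\<mu> sf_\<nu> \<Psi> f g] by simp
    qed
    have g_orth: "ip \<mu> g (\<phi> j) = 0" for j
      using form\<Psi>[OF \<phi>, of j] \<Psi>\<phi>[OF S\<Psi>g, of j] c by (simp add: ip_cmult_right ip_commute)
    \<comment> \<open>The partial sums in \<open>form\<close> vanish at \<open>g\<close>, hence both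
      operators agree there.\<close>
    have S_eq: "AE w in \<nu>. hs_app \<mu> \<Psi> g w = hs_app \<mu> \<Phi> g w"
    proof (rule L2_eq_AE_I[OF S\<Psi>g Sg])
      fix h assume h: "h \<in> L2 \<nu>"
      have "(\<Sum>i<n. ip \<mu> (\<phi> i) g * ip \<nu> (e i) h) = 0" for n
        using g_orth by (simp add: ip_commute)
      then have "ip \<nu> (hs_app \<mu> \<Phi> g) h - ip \<nu> (hs_app \<mu> \<Psi> g) h = 0"
        using form[OF g h] by (simp add: LIMSEQ_const_iff)
      then show "ip \<nu> h (hs_app \<mu> \<Psi> g) = ip \<nu> h (hs_app \<mu> \<Phi> g)" by (simp add: ip_commute)
    qed
    have "AE x in \<mu>. (\<integral>y. hs_comp \<nu> \<Phi> (tr \<Phi>) (x, y) * g y \<partial>\<mu>) = c * g x"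
    proof (rule L2_eq_AE_I)
      show "(\<lambda>x. \<integral>y. hs_comp \<nu> \<Phi> (tr \<Phi>) (x, y) * g y \<partial>\<mu>) \<in> L2 \<mu>"
        using hs_kernel_apply_L2[OF sf_\<mu> \<kappa>_L2 g] by (simp add: \<kappa>_def)
      show "(\<lambda>x. c * g x) \<in> L2 \<mu>" by (intro L2_cmult g)
      fix f assume f: "f \<in> L2 \<mu>"
      \<comment> \<open>The image of \<open>g\<close> is orthogonal to every \<open>e i\<close> by
        \<open>ip_app_e\<close>, so \<open>\<Phi>\<close> may be replaced by \<open>\<Psi>\<close>
        in the first argument as well.\<close>
      have "(\<Sum>i<n. ip \<mu> (\<phi> i) f * ip \<nu> (e i) (hs_app \<mu> \<Phi> g)) = 0" for n
        using ip_app_e[OF g] g_orth by (simp add: ip_commute)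
      then have 1: "ip \<nu> (hs_app \<mu> \<Phi> f) (hs_app \<mu> \<Phi> g) = ip \<nu> (hs_app \<mu> \<Psi> f) (hs_app \<mu> \<Phi> g)"
        using form[OF f Sg] by (simp add: LIMSEQ_const_iff)
      have 2: "ip \<nu> (hs_app \<mu> \<Psi> f) (hs_app \<mu> \<Phi> g) = ip \<nu> (hs_app \<mu> \<Psi> f) (hs_app \<mu> \<Psi> g)"
        by (rule ip_cong_AE[OF _ AE_symmetric[OF S_eq]])
          (use hs_app_L2[OF sf_\<mu> sf_\<nu> \<Psi> f] Sg S\<Psi>g in auto)
      show "ip \<mu> f (\<lambda>x. \<integral>y. hs_comp \<nu> \<Phi> (tr \<Phi>) (x, y) * g y \<partial>\<mu>) = ip \<mu> f (\<lambda>x. c * g x)"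
        unfolding hs_form_factor[OF sf_\<mu> sf_\<nu> \<Phi> f g] form\<Psi>[OF f] using 1 2 by simp
    qed
    from maximal[OF c g this g_orth] gnz show False by blast
  qed
  then have "nrm2 ?M (\<lambda>x. \<Phi>N {..<n} x - G x) = nrm2 ?M (\<lambda>p. \<Phi>N {..<n} p - \<Phi> p)" for n
    by (intro nrm2_cong_AE L2_diff \<Phi>N_L2 G \<Phi>) (auto simp: \<Psi>_def elim: eventually_mono)
  then show ?thesis using limG by simp
qed

text \<open>A trace formula obtained from Hilbert-Schmidt norms alone: the trace of
  \<open>\<Phi>\<close> times its transpose is the squared norm of \<open>\<Phi>\<close>, and no
  continuity of the kernel is involved.\<close>

theorem lam_sums: "lam sums nrm2 (\<mu> \<Otimes>\<^sub>M \<nu>) \<Phi>"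
  unfolding sums_def using nrm2_tendsto[OF \<Phi>N_L2 \<Phi> \<Phi>N_tendsto_\<Phi>] by (simp add: nrm2_\<Phi>N)

text \<open>The squared norm of \<open>\<kappa>\<close> is the inner product of
  \<open>\<Phi>\<close> with \<open>\<kappa>\<close> applied to \<open>\<Phi>\<close>. Expanding one
  \<open>\<Phi>\<close> produces \<open>lam i\<close> twice, once from the eigenvalue equation and
  once from \<open>ip_\<Phi>_tensor\<close>.\<close>

theorem lam_square_sums: "(\<lambda>i. (lam i)\<^sup>2) sums nrm2 (\<mu> \<Otimes>\<^sub>M \<mu>) \<kappa>"
proof -
  let ?M = "\<mu> \<Otimes>\<^sub>M \<nu>"
  note T = hs_comp_L2[OF sf_\<mu> sf_\<mu> sf_\<nu> \<kappa>_L2]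
  have 1: "ip ?M (hs_comp \<mu> \<kappa> \<Phi>) (tensor (\<phi> i) (e i)) = (lam i)\<^sup>2" for i
  proof -
    note t = tensor_\<phi>_e_L2[of i]
    note tP = tr_L2[OF sf_\<mu> sf_\<nu> \<Phi>]
    have "ip ?M (hs_comp \<mu> \<kappa> \<Phi>) (tensor (\<phi> i) (e i)) = ip (\<mu> \<Otimes>\<^sub>M \<mu>) \<kappa> (hs_comp \<nu> (tensor (\<phi> i) (e i)) (tr \<Phi>))"
      by (rule hs_comp_adjoint[OF sf_\<mu> sf_\<mu> sf_\<nu> \<kappa>_L2 \<Phi> t])
    also have "\<dots> = ip (\<mu> \<Otimes>\<^sub>M \<mu>) (tr \<kappa>) (tr (hs_comp \<nu> (tensor (\<phi> i) (e i)) (tr \<Phi>)))"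
      by (rule ip_tr[symmetric, OF sf_\<mu> sf_\<mu> \<kappa>_L2 hs_comp_L2[OF sf_\<mu> sf_\<nu> sf_\<mu> t tP]])
    also have "\<dots> = ip ?M (hs_comp \<mu> \<kappa> (tensor (\<phi> i) (e i))) \<Phi>"
      unfolding hs_comp_adjoint[OF sf_\<mu> sf_\<mu> sf_\<nu> \<kappa>_L2 t \<Phi>] by (simp add: \<kappa>_sym hs_comp_tr)
    also have "\<dots> = ip ?M (\<lambda>p. lam i * tensor (\<phi> i) (e i) p) \<Phi>"
    proof (rule ip_cong_AE)
      interpret \<mu>: sigma_finite_measure \<mu> by (rule sf_\<mu>)
      interpret \<nu>: sigma_finite_measure \<nu> by (rule sf_\<nu>)
      interpret MN: pair_sigma_finite \<mu> \<nu> ..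
      show m: "hs_comp \<mu> \<kappa> (tensor (\<phi> i) (e i)) \<in> borel_measurable ?M" "(\<lambda>p. lam i * tensor (\<phi> i) (e i) p) \<in> borel_measurable ?M"
        using T[OF t] L2_cmult[OF t] by auto
      have "AE a in \<mu>. AE b in \<nu>. hs_comp \<mu> \<kappa> (tensor (\<phi> i) (e i)) (a, b) = lam i * tensor (\<phi> i) (e i) (a, b)"
        using eig[of i]
      proof eventually_elim
        case (elim a)
        have "hs_comp \<mu> \<kappa> (tensor (\<phi> i) (e i)) (a, b) = (\<integral>y. \<kappa> (a, y) * \<phi> i y \<partial>\<mu>) * e i b" for b
          by (simp add: hs_comp_def tensor_def flip: mult.assoc)
        then show ?case using elim by (simp add: \<kappa>_def tensor_def)
      qed
      then show "AE p in ?M. hs_comp \<mu> \<kappa> (tensor (\<phi> i) (e i)) p = lam i * tensor (\<phi> i) (e i) p"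
        using m by (intro MN.AE_pair_measure) auto
    qed (use \<Phi> in auto)
    finally show ?thesis
      using ip_\<Phi>_tensor[of i] by (simp add: ip_cmult_left ip_commute[of _ _ \<Phi>] power2_eq_square)
  qed
  have "(\<lambda>n. ip ?M (\<Phi>N {..<n}) (hs_comp \<mu> \<kappa> \<Phi>)) \<longlonglongrightarrow> ip ?M \<Phi> (hs_comp \<mu> \<kappa> \<Phi>)"
    by (rule ip_tendsto[OF \<Phi>N_L2 \<Phi> T[OF \<Phi>] \<Phi>N_tendsto_\<Phi>])
  moreover have "ip ?M (\<Phi>N {..<n}) (hs_comp \<mu> \<kappa> \<Phi>) = (\<Sum>i<n. (lam i)\<^sup>2)" for n
    unfolding \<Phi>N_def using 1 by (simp add: ip_sum_left tensor_\<phi>_e_L2 T \<Phi> ip_commute[of _ "hs_comp \<mu> \<kappa> \<Phi>"])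
  moreover have "ip ?M \<Phi> (hs_comp \<mu> \<kappa> \<Phi>) = nrm2 (\<mu> \<Otimes>\<^sub>M \<mu>) \<kappa>"
    using hs_comp_adjoint[OF sf_\<mu> sf_\<mu> sf_\<nu> \<kappa>_L2 \<Phi> \<Phi>] by (simp add: ip_commute \<kappa>_def)
  ultimately show ?thesis by (simp add: sums_def)
qed

end

section \<open>Laplace transforms and the Gaussian limit\<close>

text \<open>In the variable \<open>y = exp (- v)\<close> a polynomial is a linear combination of the
  functions \<open>exp (- i v)\<close>, so Weierstrass approximation on the unit interval reduces
  the claim to Laplace transforms at integers.\<close>

lemma laplace_transforms_tendsto_imp_integral_tendsto:
  fixes V :: "nat \<Rightarrow> 'a \<Rightarrow> real" and Q :: "'b \<Rightarrow> real" and f :: "real \<Rightarrow> real"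
  assumes M: "prob_space M" and P: "prob_space P"
    and [measurable]: "\<And>n. V n \<in> borel_measurable M" "Q \<in> borel_measurable P"
    and V_nn: "\<And>n. AE \<omega> in M. 0 \<le> V n \<omega>" and Q_nn: "AE z in P. 0 \<le> Q z"
    and lap: "\<And>m::nat. (\<lambda>n. \<integral>\<omega>. exp (- (real m * V n \<omega>)) \<partial>M) \<longlonglongrightarrow> (\<integral>z. exp (- (real m * Q z)) \<partial>P)"
    and f: "continuous_on UNIV f" and f0: "\<And>x. x \<ge> b \<Longrightarrow> f x = 0"
  shows "(\<lambda>n. \<integral>\<omega>. f (V n \<omega>) \<partial>M) \<longlonglongrightarrow> (\<integral>z. f (Q z) \<partial>P)"
proof (rule LIMSEQ_I)
  interpret M: prob_space M by fact
  interpret P: prob_space P by fact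
  fix \<epsilon> :: real assume \<epsilon>: "\<epsilon> > 0"
  \<comment> \<open>Since \<open>f\<close> vanishes beyond \<open>b\<close>, the two branches agree
    at \<open>exp (- b)\<close> and \<open>g\<close> is continuous down to \<open>y = 0\<close>, the
    image of infinity.\<close>
  define g where "g y = (if y \<le> exp (-b) then 0 else f (- ln y))" for y :: real
  have "continuous_on {0..1} g"
    unfolding g_def
  proof (rule continuous_on_cases_le)
    have pos: "y \<noteq> 0" if "exp (-b) \<le> y" for y :: real using that exp_gt_zero[of "-b"] by linarith
    show "continuous_on {x \<in> {0..1}. exp (-b) \<le> x} (\<lambda>x. f (- ln x))"
      by (intro continuous_on_compose2[OF f] continuous_intros) (use pos in auto)
  qed (auto intro!: continuous_intros simp: f0)
  then obtain p where "real_polynomial_function p" and p: "\<And>x. x \<in> {0..1} \<Longrightarrow> \<bar>g x - p x\<bar> < \<epsilon> / 4"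
    using Stone_Weierstrass_real_polynomial_function[of "{0..1}" g "\<epsilon>/4"] \<epsilon> by auto
  then obtain a N where pa: "p = (\<lambda>x. \<Sum>i\<le>N. a i * x ^ i)"
    using real_polynomial_function_imp_sum by blast
  have close: "\<bar>f v - (\<Sum>i\<le>N. a i * exp (- (real i * v)))\<bar> \<le> \<epsilon> / 4" if "v \<ge> 0" for v
  proof -
    have "g (exp (-v)) = f v" using f0[of v] by (auto simp: g_def)
    moreover have "p (exp (-v)) = (\<Sum>i\<le>N. a i * exp (- (real i * v)))"
      by (simp add: pa flip: exp_of_nat_mult)
    ultimately show ?thesis using p[of "exp (-v)"] that by simp
  qed
  note [measurable] = borel_measurable_continuous_onI[OF f]
  have approx: "\<bar>(\<integral>x. f (h x) \<partial>S) - (\<Sum>i\<le>N. a i * (\<integral>x. exp (- (real i * h x)) \<partial>S))\<bar> \<le> \<epsilon> / 4"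
    if S: "prob_space S" and [measurable]: "h \<in> borel_measurable S" and nn: "AE x in S. 0 \<le> h x" for S :: "'x measure" and h
  proof -
    interpret S: prob_space S by fact
    have ie: "integrable S (\<lambda>x. exp (- (real i * h x)))" for i
      by (rule S.integrable_const_bound[where B=1]) (use nn in \<open>auto elim: eventually_mono\<close>)
    have is_: "integrable S (\<lambda>x. \<Sum>i\<le>N. a i * exp (- (real i * h x)))"
      by (intro Bochner_Integration.integrable_sum integrable_mult_right ie)
    have id: "integrable S (\<lambda>x. f (h x) - (\<Sum>i\<le>N. a i * exp (- (real i * h x))))"
      by (rule S.integrable_const_bound[where B="\<epsilon>/4"]) (use nn in \<open>auto elim!: eventually_mono dest!: close\<close>)
    have if_: "integrable S (\<lambda>x. f (h x))"
      using Bochner_Integration.integrable_add[OF id is_] by simp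
    have "(\<integral>x. f (h x) \<partial>S) - (\<Sum>i\<le>N. a i * (\<integral>x. exp (- (real i * h x)) \<partial>S))
      = (\<integral>x. f (h x) - (\<Sum>i\<le>N. a i * exp (- (real i * h x))) \<partial>S)"
      by (subst Bochner_Integration.integral_diff[OF if_ is_], subst Bochner_Integration.integral_sum) (auto intro: ie)
    also have "\<bar>\<dots>\<bar> \<le> (\<integral>x. \<bar>f (h x) - (\<Sum>i\<le>N. a i * exp (- (real i * h x)))\<bar> \<partial>S)"
      by (rule integral_abs_bound)
    also have "\<dots> \<le> (\<integral>x. \<epsilon> / 4 \<partial>S)"
      using nn id by (intro integral_mono_AE) (auto elim!: eventually_mono dest!: close)
    finally show ?thesis by (simp add: S.prob_space)
  qed
  have "(\<lambda>n. \<Sum>i\<le>N. a i * (\<integral>\<omega>. exp (- (real i * V n \<omega>)) \<partial>M)) \<longlonglongrightarrow> (\<Sum>i\<le>N. a i * (\<integral>z. exp (- (real i * Q z)) \<partial>P))"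
    by (intro tendsto_intros lap)
  then obtain n0 where n0: "\<forall>n\<ge>n0. norm ((\<Sum>i\<le>N. a i * (\<integral>\<omega>. exp (- (real i * V n \<omega>)) \<partial>M)) - (\<Sum>i\<le>N. a i * (\<integral>z. exp (- (real i * Q z)) \<partial>P))) < \<epsilon> / 4"
    using \<epsilon> LIMSEQ_D[of _ _ "\<epsilon> / 4"] by (meson divide_pos_pos zero_less_numeral)
  have "norm ((\<integral>\<omega>. f (V n \<omega>) \<partial>M) - (\<integral>z. f (Q z) \<partial>P)) < \<epsilon>" if "n \<ge> n0" for n
    using n0[rule_format, OF that] approx[OF M assms(3) V_nn, of n] approx[OF P assms(4) Q_nn] \<epsilon>
    unfolding real_norm_def by linarith
  then show "\<exists>n0. \<forall>n\<ge>n0. norm ((\<integral>\<omega>. f (V n \<omega>) \<partial>M) - (\<integral>z. f (Q z) \<partial>P)) < \<epsilon>" by blast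
qed

text \<open>Weak convergence is tested on the ramps \<open>cts_step x y\<close>. They vanish for
  large arguments, which suits the preceding lemma after a shift by \<open>\<tau>\<close>, and they
  are Lipschitz, so replacing \<open>D n\<close> by \<open>V n - \<tau>\<close> costs at most a
  multiple of the L1 distance.\<close>

lemma weak_conv_of_laplace:
  fixes D V :: "nat \<Rightarrow> 'a \<Rightarrow> real" and Q L :: "'b \<Rightarrow> real"
  assumes M: "prob_space M" and P: "prob_space P"
    and [measurable]: "\<And>n. D n \<in> borel_measurable M" "\<And>n. V n \<in> borel_measurable M" "Q \<in> borel_measurable P" "L \<in> borel_measurable P"
    and V_nn: "\<And>n. AE \<omega> in M. 0 \<le> V n \<omega>" and Q_nn: "AE z in P. 0 \<le> Q z"
    and lap: "\<And>m::nat. (\<lambda>n. \<integral>\<omega>. exp (- (real m * V n \<omega>)) \<partial>M) \<longlonglongrightarrow> (\<integral>z. exp (- (real m * Q z)) \<partial>P)"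
    and L: "AE z in P. L z = Q z - \<tau>"
    and int: "\<forall>\<^sub>F n in sequentially. integrable M (\<lambda>\<omega>. D n \<omega> + \<tau> - V n \<omega>)"
    and small: "(\<lambda>n. \<integral>\<omega>. \<bar>D n \<omega> + \<tau> - V n \<omega>\<bar> \<partial>M) \<longlonglongrightarrow> 0"
  shows "weak_conv_m (\<lambda>n. distr M borel (D n)) (distr P borel L)"
proof (rule integral_cts_step_conv_imp_weak_conv)
  interpret M: prob_space M by fact
  interpret P: prob_space P by fact
  show "real_distribution (distr M borel (D n))" for n by (rule M.real_distribution_distr) simp
  show "real_distribution (distr P borel L)" by (rule P.real_distribution_distr) simp
  fix x y :: real assume xy: "x < y"
  have cont: "continuous_on UNIV (cts_step x y)"
    using cts_step_uniformly_continuous[OF xy] by (rule uniformly_continuous_imp_continuous)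
  note [measurable] = borel_measurable_continuous_onI[OF cont]
  define f where "f v = cts_step x y (v - \<tau>)" for v
  have fc: "continuous_on UNIV f" unfolding f_def by (intro continuous_on_compose2[OF cont] continuous_intros) auto
  note [measurable] = borel_measurable_continuous_onI[OF fc]
  have f0: "f v = 0" if "v \<ge> y + \<tau>" for v using that xy by (auto simp: f_def cts_step_def)
  have lim: "(\<lambda>n. \<integral>\<omega>. f (V n \<omega>) \<partial>M) \<longlonglongrightarrow> (\<integral>z. f (Q z) \<partial>P)"
    by (rule laplace_transforms_tendsto_imp_integral_tendsto[OF M P _ _ V_nn Q_nn lap fc f0]) auto
  have fQ: "(\<integral>z. f (Q z) \<partial>P) = (\<integral>z. cts_step x y (L z) \<partial>P)"
    using L by (intro integral_cong_AE) (auto simp: f_def)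
  have lip: "\<bar>cts_step x y a - cts_step x y b\<bar> \<le> \<bar>a - b\<bar> / (y - x)" for a b
  proof -
    \<comment> \<open>Written as a clamped linear function, the ramp visibly has Lipschitz constant
      \<open>1 / (y - x)\<close>.\<close>
    have cs: "cts_step x y c = (y - max x (min y c)) / (y - x)" for c
      using xy by (simp add: cts_step_def max_def min_def)
    have "\<bar>(y - max x (min y a)) - (y - max x (min y b))\<bar> \<le> \<bar>a - b\<bar>"
      by (simp add: max_def min_def abs_minus_commute)
    then show ?thesis unfolding cs diff_divide_distrib[symmetric] using xy by (simp add: divide_right_mono)
  qed
  have bd: "\<bar>cts_step x y a\<bar> \<le> 1" for a using xy by (auto simp: cts_step_def field_simps)
  have i1: "integrable M (\<lambda>\<omega>. cts_step x y (D n \<omega>))" "integrable M (\<lambda>\<omega>. f (V n \<omega>))" for n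
    by (rule M.integrable_const_bound[where B=1]; simp add: f_def bd)+
  have "(\<lambda>n. (\<integral>\<omega>. cts_step x y (D n \<omega>) \<partial>M) - (\<integral>\<omega>. f (V n \<omega>) \<partial>M)) \<longlonglongrightarrow> 0"
  proof (rule Lim_null_comparison)
    show "\<forall>\<^sub>F n in sequentially. norm ((\<integral>\<omega>. cts_step x y (D n \<omega>) \<partial>M) - (\<integral>\<omega>. f (V n \<omega>) \<partial>M)) \<le> (\<integral>\<omega>. \<bar>D n \<omega> + \<tau> - V n \<omega>\<bar> \<partial>M) / (y - x)"
      using int
    proof eventually_elim
      case (elim n)
      have "norm ((\<integral>\<omega>. cts_step x y (D n \<omega>) \<partial>M) - (\<integral>\<omega>. f (V n \<omega>) \<partial>M)) = \<bar>\<integral>\<omega>. cts_step x y (D n \<omega>) - f (V n \<omega>) \<partial>M\<bar>"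
        by (subst Bochner_Integration.integral_diff[OF i1]) simp
      also have "\<dots> \<le> (\<integral>\<omega>. \<bar>cts_step x y (D n \<omega>) - f (V n \<omega>)\<bar> \<partial>M)" by (rule integral_abs_bound)
      also have "\<dots> \<le> (\<integral>\<omega>. \<bar>D n \<omega> + \<tau> - V n \<omega>\<bar> / (y - x) \<partial>M)"
      proof (rule integral_mono)
        show "integrable M (\<lambda>\<omega>. \<bar>cts_step x y (D n \<omega>) - f (V n \<omega>)\<bar>)" using i1 by auto
        show "integrable M (\<lambda>\<omega>. \<bar>D n \<omega> + \<tau> - V n \<omega>\<bar> / (y - x))" using elim by auto
        fix \<omega> show "\<bar>cts_step x y (D n \<omega>) - f (V n \<omega>)\<bar> \<le> \<bar>D n \<omega> + \<tau> - V n \<omega>\<bar> / (y - x)"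
          using lip[of "D n \<omega>" "V n \<omega> - \<tau>"] by (simp add: f_def algebra_simps)
      qed
      finally show ?case by simp
    qed
    show "(\<lambda>n. (\<integral>\<omega>. \<bar>D n \<omega> + \<tau> - V n \<omega>\<bar> \<partial>M) / (y - x)) \<longlonglongrightarrow> 0"
      using tendsto_divide[OF small tendsto_const[of "y - x"]] xy by simp
  qed
  from tendsto_add[OF this lim] have "(\<lambda>n. \<integral>\<omega>. cts_step x y (D n \<omega>) \<partial>M) \<longlonglongrightarrow> (\<integral>z. cts_step x y (L z) \<partial>P)"
    by (simp add: fQ)
  then show "(\<lambda>n. integral\<^sup>L (distr M borel (D n)) (cts_step x y)) \<longlonglongrightarrow> integral\<^sup>L (distr P borel L) (cts_step x y)"
    by (simp add: integral_distr)
qed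

lemma (in prob_space) distr_pair_of_indep_vars:
  assumes ind: "indep_vars (\<lambda>_. N) Z UNIV" and "j \<noteq> l"
  shows "indep_var N (Z j) N (Z l)"
    and "distr M (N \<Otimes>\<^sub>M N) (\<lambda>\<omega>. (Z j \<omega>, Z l \<omega>)) = distr M N (Z j) \<Otimes>\<^sub>M distr M N (Z l)"
proof -
  have "indep_var N ((\<lambda>f. f j) \<circ> (\<lambda>\<omega>. restrict (\<lambda>i. Z i \<omega>) {j})) N ((\<lambda>f. f l) \<circ> (\<lambda>\<omega>. restrict (\<lambda>i. Z i \<omega>) {l}))"
    using assms(2) by (intro indep_var_compose[OF indep_var_restrict[OF ind]]) auto
  then show i: "indep_var N (Z j) N (Z l)" by (simp add: comp_def)
  then show "distr M (N \<Otimes>\<^sub>M N) (\<lambda>\<omega>. (Z j \<omega>, Z l \<omega>)) = distr M N (Z j) \<Otimes>\<^sub>M distr M N (Z l)"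
    by (simp add: indep_var_distribution_eq)
qed

text \<open>The central limit theorem normalises by the standard deviation; evaluating the
  characteristic function at \<open>\<sigma>\<close> instead of 1 undoes this. A vanishing variance
  is treated separately, the sums then being almost surely 0.\<close>

lemma (in prob_space) clt_char:
  assumes ind: "indep_vars (\<lambda>_. N) Z UNIV" and law: "\<And>j. distr M N (Z j) = N"
    and f: "f \<in> L2 N" and mean: "(\<integral>z. f z \<partial>N) = 0"
  shows "(\<lambda>n. \<integral>\<omega>. iexp ((\<Sum>j<n. f (Z j \<omega>)) / sqrt (real n)) \<partial>M) \<longlonglongrightarrow> of_real (exp (- nrm2 N f / 2))"
proof -
  have [measurable]: "Z j \<in> measurable M N" for j using ind by (auto simp: indep_vars_def)
  note [measurable] = L2_measurable[OF f]
  define X where "X j \<omega> = f (Z j \<omega>)" for j \<omega>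
  have [measurable]: "X j \<in> borel_measurable M" for j unfolding X_def by measurable
  have int_X: "(\<integral>\<omega>. h (X j \<omega>) \<partial>M) = (\<integral>z. h (f z) \<partial>N)" if [measurable]: "h \<in> borel_measurable borel" for h :: "real \<Rightarrow> real" and j
    using integral_distr[of "Z j" M N "\<lambda>z. h (f z)"] by (simp add: law X_def)
  have sq: "integrable M (\<lambda>\<omega>. (X j \<omega>)\<^sup>2)" for j
    using integrable_distr_eq[of "Z j" M N "\<lambda>z. (f z)\<^sup>2"] f by (simp add: law X_def L2_def)
  show ?thesis
  proof (cases "nrm2 N f = 0")
    case True
    then have "AE z in N. f z = 0" using nrm2_zero_iff[OF f] by simp
    then have "AE z in distr M N (Z j). f z = 0" for j unfolding law .
    then have "AE \<omega> in M. f (Z j \<omega>) = 0" for j by (subst (asm) AE_distr_iff) auto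
    then have "AE \<omega> in M. \<forall>j. f (Z j \<omega>) = 0" by (simp add: AE_all_countable)
    then have "(\<integral>\<omega>. iexp ((\<Sum>j<n. f (Z j \<omega>)) / sqrt (real n)) \<partial>M) = (\<integral>\<omega>. 1 \<partial>M)" for n
      by (intro integral_cong_AE) (auto elim: eventually_mono)
    then show ?thesis using True by (simp add: prob_space)
  next
    case False
    define \<sigma> where "\<sigma> = sqrt (nrm2 N f)"
    have \<sigma>: "\<sigma> > 0" "\<sigma>\<^sup>2 = nrm2 N f" using False nrm2_nonneg[of N f] by (auto simp: \<sigma>_def)
    have iX: "indep_vars (\<lambda>_. borel) X UNIV"
      unfolding X_def by (rule indep_vars_compose2[OF ind]) simp
    have m0: "expectation (X j) = 0" for j using int_X[of "\<lambda>x. x" j] mean by simp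
    have v: "variance (X j) = \<sigma>\<^sup>2" for j
      using int_X[of "\<lambda>x. x * x" j] unfolding \<sigma>(2) by (simp add: m0 ip_def power2_eq_square)
    have "distr M borel (X j) = distr N borel f" for j
      using distr_distr[of f N borel "Z j" M] by (simp add: law X_def[abs_def] comp_def)
    then have "weak_conv_m (\<lambda>n. distr M borel (\<lambda>\<omega>. (\<Sum>j<n. X j \<omega>) / sqrt (n * \<sigma>\<^sup>2))) std_normal_distribution"
      using central_limit_theorem_zero_mean[OF iX m0 \<sigma>(1) sq v] by blast
    then have "(\<lambda>n. char (distr M borel (\<lambda>\<omega>. (\<Sum>j<n. X j \<omega>) / sqrt (n * \<sigma>\<^sup>2))) \<sigma>) \<longlonglongrightarrow> char std_normal_distribution \<sigma>"
      by (intro levy_continuity1 real_distribution_distr real_dist_normal_dist) auto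
    moreover have "char (distr M borel (\<lambda>\<omega>. (\<Sum>j<n. X j \<omega>) / sqrt (n * \<sigma>\<^sup>2))) \<sigma> = (\<integral>\<omega>. iexp ((\<Sum>j<n. f (Z j \<omega>)) / sqrt (real n)) \<partial>M)" for n
    proof -
      have e: "\<sigma> * (S / sqrt (real n * \<sigma>\<^sup>2)) = S / sqrt (real n)" for S
        using \<sigma>(1) by (simp add: real_sqrt_mult)
      have "char (distr M borel (\<lambda>\<omega>. (\<Sum>j<n. X j \<omega>) / sqrt (n * \<sigma>\<^sup>2))) \<sigma> = (\<integral>\<omega>. iexp (\<sigma> * ((\<Sum>j<n. X j \<omega>) / sqrt (n * \<sigma>\<^sup>2))) \<partial>M)"
        unfolding char_def by (rule integral_distr) auto
      then show ?thesis unfolding e X_def .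
    qed
    ultimately show ?thesis by (simp add: char_std_normal_distribution \<sigma>(2))
  qed
qed

section \<open>Sequences of independent standard normal variables\<close>

abbreviation gauss_seq :: "(nat \<Rightarrow> real) measure" where
  "gauss_seq \<equiv> \<Pi>\<^sub>M i\<in>UNIV. std_normal_distribution"

lemma prob_space_std_normal: "prob_space std_normal_distribution"
  using real_dist_normal_dist by (simp add: real_distribution_def)

lemma prob_space_gauss_seq: "prob_space gauss_seq"
  by (intro prob_space_PiM prob_space_std_normal)

lemma gauss_seq_component_measurable [measurable]: "(\<lambda>g. g i) \<in> borel_measurable gauss_seq"
proof -
  have "(\<lambda>g. g i) \<in> measurable gauss_seq std_normal_distribution" by measurable
  then show ?thesis by (simp add: measurable_def)
qed

lemma distr_gauss_seq: "distr gauss_seq borel (\<lambda>g. g i) = std_normal_distribution"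
proof -
  have "distr gauss_seq std_normal_distribution (\<lambda>g. g i) = std_normal_distribution"
    by (intro distr_PiM_component prob_space_std_normal) auto
  moreover have "distr gauss_seq std_normal_distribution (\<lambda>g. g i) = distr gauss_seq borel (\<lambda>g. g i)"
    by (intro distr_cong) auto
  ultimately show ?thesis by simp
qed

lemma indep_vars_gauss_seq:
  "prob_space.indep_vars gauss_seq (\<lambda>_. std_normal_distribution) (\<lambda>i g. g i) UNIV"
proof -
  interpret prob_space gauss_seq by (rule prob_space_gauss_seq)
  have "distr gauss_seq gauss_seq (\<lambda>x. \<lambda>i\<in>UNIV. x i) = gauss_seq"
    using distr_id2[of gauss_seq gauss_seq] by (simp add: restrict_def)
  moreover have "distr gauss_seq std_normal_distribution (\<lambda>g. g i) = std_normal_distribution" for i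
    by (intro distr_PiM_component prob_space_std_normal) auto
  ultimately show ?thesis
    by (subst indep_vars_iff_distr_eq_PiM) auto
qed

text \<open>Read from right to left, this linearises the exponential of minus a sum of squares (the
  Hubbard-Stratonovich identity).\<close>

lemma gauss_seq_char:
  "(\<integral>g. iexp (\<Sum>i<N. g i * c i) \<partial>gauss_seq) = of_real (exp (- (\<Sum>i<N. (c i)\<^sup>2) / 2))"
proof -
  interpret prob_space gauss_seq by (rule prob_space_gauss_seq)
  have "indep_vars (\<lambda>_. borel) (\<lambda>i g. g i * c i) {..<N}"
    by (rule indep_vars_compose2[OF indep_vars_subset[OF indep_vars_gauss_seq]]) auto
  then have "char (distr gauss_seq borel (\<lambda>g. \<Sum>i<N. g i * c i)) 1 = (\<Prod>i<N. char (distr gauss_seq borel (\<lambda>g. g i * c i)) 1)"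
    by (rule char_distr_sum)
  also have "\<dots> = (\<Prod>i<N. of_real (exp (- (c i)\<^sup>2 / 2)))"
  proof (rule prod.cong)
    fix i
    have "char (distr gauss_seq borel (\<lambda>g. g i * c i)) 1 = char (distr gauss_seq borel (\<lambda>g. g i)) (c i)"
      unfolding char_def by (subst (1 2) integral_distr) (auto simp: mult.commute)
    then show "char (distr gauss_seq borel (\<lambda>g. g i * c i)) 1 = of_real (exp (- (c i)\<^sup>2 / 2))"
      by (simp add: distr_gauss_seq char_std_normal_distribution)
  qed simp
  also have "\<dots> = of_real (exp (- (\<Sum>i<N. (c i)\<^sup>2) / 2))"
    by (simp add: exp_sum sum_divide_distrib flip: sum_negf of_real_prod)
  finally show ?thesis
    unfolding char_def by (subst (asm) integral_distr) auto
qed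

text \<open>A Gaussian average turns the Laplace transform of a quadratic form into an average of
  characteristic functions of linear forms, to which the one-dimensional CLT applies.\<close>

lemma (in prob_space) laplace_quadratic_form_tendsto:
  assumes ind: "indep_vars (\<lambda>_. N) Z UNIV" and law: "\<And>j. distr M N (Z j) = N"
    and \<phi>: "\<And>i. \<phi> i \<in> L2 N" and mean: "\<And>i. (\<integral>z. \<phi> i z \<partial>N) = 0" and N: "prob_space N"
    and orth: "\<And>i j. i \<noteq> j \<Longrightarrow> ip N (\<phi> i) (\<phi> j) = 0"
    and s: "\<And>i. (s i)\<^sup>2 * nrm2 N (\<phi> i) = (s i)\<^sup>2"
  shows "(\<lambda>n. \<integral>\<omega>. exp (- (\<Sum>i<K. (s i * ((\<Sum>j<n. \<phi> i (Z j \<omega>)) / sqrt (real n)))\<^sup>2) / 2) \<partial>M)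
    \<longlonglongrightarrow> (\<integral>g. exp (- (\<Sum>i<K. (s i * g i)\<^sup>2) / 2) \<partial>gauss_seq)"
proof -
  interpret N: prob_space N by fact
  interpret G: prob_space gauss_seq by (rule prob_space_gauss_seq)
  interpret MG: pair_prob_space M gauss_seq ..
  have [measurable]: "Z j \<in> measurable M N" for j using ind by (auto simp: indep_vars_def)
  have [measurable]: "\<phi> i \<in> borel_measurable N" for i using \<phi>[of i] by measurable
  have iN: "integrable N (\<phi> i)" for i
    by (rule N.square_integrable_imp_integrable) (use \<phi>[of i] in \<open>auto simp: L2_def\<close>)
  define F where "F g = (\<lambda>z. \<Sum>i<K. g i * s i * \<phi> i z)" for g :: "nat \<Rightarrow> real"
  have F_L2: "F g \<in> L2 N" for g unfolding F_def by (intro L2_intros \<phi>)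
  have F_mean: "(\<integral>z. F g z \<partial>N) = 0" for g
    unfolding F_def by (simp add: Bochner_Integration.integral_sum iN mean)
  \<comment> \<open>Hypothesis \<open>s\<close> says that \<open>\<phi> i\<close> is normalised
    unless the weight \<open>s i\<close> vanishes, so padded indices drop out.\<close>
  have F_nrm: "nrm2 N (F g) = (\<Sum>i<K. (s i * g i)\<^sup>2)" for g
  proof -
    have "nrm2 N (F g) = (\<Sum>i<K. g i * s i * ip N (\<phi> i) (F g))"
      by (subst (1) F_def) (simp add: ip_sum_left L2_cmult \<phi> F_L2 ip_cmult_left)
    also have "\<dots> = (\<Sum>i<K. (s i * g i)\<^sup>2)"
    proof (rule sum.cong)
      fix i assume i: "i \<in> {..<K}"
      have "ip N (\<phi> i) (F g) = (\<Sum>j<K. g j * s j * ip N (\<phi> i) (\<phi> j))"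
        unfolding F_def by (simp add: ip_sum_right L2_cmult \<phi> ip_cmult_right)
      also have "\<dots> = (\<Sum>j<K. if j = i then g i * s i * nrm2 N (\<phi> i) else 0)"
        by (intro sum.cong) (auto simp: orth)
      also have "\<dots> = g i * s i * nrm2 N (\<phi> i)" using i by simp
      finally have "g i * s i * ip N (\<phi> i) (F g) = (g i)\<^sup>2 * ((s i)\<^sup>2 * nrm2 N (\<phi> i))"
        by (simp add: power2_eq_square mult_ac)
      then show "g i * s i * ip N (\<phi> i) (F g) = (s i * g i)\<^sup>2"
        unfolding s by (simp add: power_mult_distrib mult.commute)
    qed simp
    finally show ?thesis .
  qed
  define c where "c n i \<omega> = (\<Sum>j<n. \<phi> i (Z j \<omega>)) / sqrt (real n)" for n i \<omega>
  have [measurable]: "c n i \<in> borel_measurable M" for n i unfolding c_def by measurable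
  have lin: "(\<Sum>i<K. g i * (s i * c n i \<omega>)) = (\<Sum>j<n. F g (Z j \<omega>)) / sqrt (real n)" for g n \<omega>
  proof -
    have "(\<Sum>j<n. F g (Z j \<omega>)) = (\<Sum>i<K. g i * s i * (\<Sum>j<n. \<phi> i (Z j \<omega>)))"
      unfolding F_def sum_distrib_left by (rule sum.swap)
    then have "(\<Sum>j<n. F g (Z j \<omega>)) / sqrt (real n) = (\<Sum>i<K. g i * s i * (\<Sum>j<n. \<phi> i (Z j \<omega>)) / sqrt (real n))"
      by (simp only: sum_divide_distrib)
    then show ?thesis by (simp add: c_def mult.assoc)
  qed
  \<comment> \<open>After \<open>gauss_seq_char\<close> is read backwards, exchanging the integrals
    leaves, for each fixed \<open>g\<close>, the characteristic function of a sum of real i.i.d.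
    variables.\<close>
  have eq: "of_real (\<integral>\<omega>. exp (- (\<Sum>i<K. (s i * c n i \<omega>)\<^sup>2) / 2) \<partial>M)
     = (\<integral>g. (\<integral>\<omega>. iexp ((\<Sum>j<n. F g (Z j \<omega>)) / sqrt (real n)) \<partial>M) \<partial>gauss_seq)" for n
  proof -
    have "of_real (\<integral>\<omega>. exp (- (\<Sum>i<K. (s i * c n i \<omega>)\<^sup>2) / 2) \<partial>M)
       = (\<integral>\<omega>. (\<integral>g. iexp (\<Sum>i<K. g i * (s i * c n i \<omega>)) \<partial>gauss_seq) \<partial>M)"
      unfolding gauss_seq_char integral_complex_of_real ..
    also have "\<dots> = (\<integral>g. (\<integral>\<omega>. iexp (\<Sum>i<K. g i * (s i * c n i \<omega>)) \<partial>M) \<partial>gauss_seq)"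
    proof (rule MG.Fubini_integral[symmetric])
      show "integrable (M \<Otimes>\<^sub>M gauss_seq) (\<lambda>(\<omega>, g). iexp (\<Sum>i<K. g i * (s i * c n i \<omega>)))"
        by (rule MG.P.integrable_const_bound[where B=1]) (auto simp: split_def)
    qed
    finally show ?thesis unfolding lin .
  qed
  have [measurable]: "(\<lambda>g. F g z) \<in> borel_measurable gauss_seq" for z unfolding F_def by measurable
  have [measurable]: "(\<lambda>p. F (fst p) (snd p)) \<in> borel_measurable (gauss_seq \<Otimes>\<^sub>M N)" unfolding F_def by measurable
  have F_m: "(\<lambda>p. F (fst p) (Z j (snd p))) \<in> borel_measurable (gauss_seq \<Otimes>\<^sub>M M)" for j unfolding F_def by measurable
  have "(\<lambda>n. \<integral>g. (\<integral>\<omega>. iexp ((\<Sum>j<n. F g (Z j \<omega>)) / sqrt (real n)) \<partial>M) \<partial>gauss_seq)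
    \<longlonglongrightarrow> (\<integral>g. of_real (exp (- (\<Sum>i<K. (s i * g i)\<^sup>2) / 2)) \<partial>gauss_seq)"
  proof (rule integral_dominated_convergence[where w = "\<lambda>_. 1"])
    show "(\<lambda>g. \<integral>\<omega>. iexp ((\<Sum>j<n. F g (Z j \<omega>)) / sqrt (real n)) \<partial>M) \<in> borel_measurable gauss_seq" for n
    proof (rule borel_measurable_lebesgue_integral)
      show "(\<lambda>(g, \<omega>). iexp ((\<Sum>j<n. F g (Z j \<omega>)) / sqrt (real n))) \<in> borel_measurable (gauss_seq \<Otimes>\<^sub>M M)"
        unfolding split_def using F_m by measurable
    qed
    show "AE g in gauss_seq. (\<lambda>n. \<integral>\<omega>. iexp ((\<Sum>j<n. F g (Z j \<omega>)) / sqrt (real n)) \<partial>M)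
        \<longlonglongrightarrow> of_real (exp (- (\<Sum>i<K. (s i * g i)\<^sup>2) / 2))"
      using clt_char[OF ind law F_L2 F_mean] unfolding F_nrm by simp
    show "AE g in gauss_seq. norm (\<integral>\<omega>. iexp ((\<Sum>j<n. F g (Z j \<omega>)) / sqrt (real n)) \<partial>M) \<le> 1" for n
    proof (rule AE_I2)
      fix g
      have "norm (\<integral>\<omega>. iexp ((\<Sum>j<n. F g (Z j \<omega>)) / sqrt (real n)) \<partial>M) \<le> (\<integral>\<omega>. norm (iexp ((\<Sum>j<n. F g (Z j \<omega>)) / sqrt (real n))) \<partial>M)"
        by (rule integral_norm_bound)
      also have "\<dots> = 1" by (simp add: prob_space)
      finally show "norm (\<integral>\<omega>. iexp ((\<Sum>j<n. F g (Z j \<omega>)) / sqrt (real n)) \<partial>M) \<le> 1" .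
    qed
  qed auto
  then have "(\<lambda>n. complex_of_real (\<integral>\<omega>. exp (- (\<Sum>i<K. (s i * c n i \<omega>)\<^sup>2) / 2) \<partial>M)) \<longlonglongrightarrow> complex_of_real (\<integral>g. exp (- (\<Sum>i<K. (s i * g i)\<^sup>2) / 2) \<partial>gauss_seq)"
    unfolding eq integral_complex_of_real .
  then show ?thesis unfolding tendsto_of_real_iff c_def .
qed

text \<open>The expected value of the nonnegative series is a multiple of the sum of
  \<open>lam\<close>, hence finite.\<close>

lemma gauss_seq_weighted_summable:
  assumes lam: "summable lam" "\<And>i. 0 \<le> lam i"
  shows "AE g in gauss_seq. summable (\<lambda>i. lam i * (g i)\<^sup>2)"
proof -
  define c where "c = (\<integral>x. x\<^sup>2 \<partial>std_normal_distribution)"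
  have m: "(\<integral>\<^sup>+g. ennreal ((g i)\<^sup>2) \<partial>gauss_seq) = ennreal c" for i
  proof -
    have "(\<integral>\<^sup>+g. ennreal ((g i)\<^sup>2) \<partial>gauss_seq) = (\<integral>\<^sup>+x. ennreal (x\<^sup>2) \<partial>distr gauss_seq borel (\<lambda>g. g i))"
      by (subst nn_integral_distr) auto
    also have "\<dots> = ennreal c"
      unfolding distr_gauss_seq c_def
      by (intro nn_integral_eq_integral integrable_std_normal_distribution_moment) auto
    finally show ?thesis .
  qed
  have c: "c \<ge> 0" by (simp add: c_def)
  have "(\<integral>\<^sup>+g. (\<Sum>i. ennreal (lam i * (g i)\<^sup>2)) \<partial>gauss_seq) = (\<Sum>i. \<integral>\<^sup>+g. ennreal (lam i * (g i)\<^sup>2) \<partial>gauss_seq)"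
    by (intro nn_integral_suminf) auto
  also have "\<dots> = (\<Sum>i. ennreal (lam i * c))"
    using lam c by (simp add: ennreal_mult nn_integral_cmult m)
  also have "\<dots> < \<infinity>"
    using lam c by (subst suminf_ennreal2) (auto intro: summable_mult2)
  finally have "AE g in gauss_seq. (\<Sum>i. ennreal (lam i * (g i)\<^sup>2)) \<noteq> \<infinity>"
    by (intro nn_integral_PInf_AE) auto
  then show ?thesis
    by eventually_elim (intro summable_suminf_not_top, auto simp: lam top_unique)
qed

section \<open>The V-statistic of an i.i.d. sample\<close>

locale iid_feature_kernel = feature_kernel \<mu> \<nu> \<Phi> lam \<phi> + prob_space M
  for \<mu> :: "'a measure" and \<nu> :: "'b measure" and \<Phi> lam \<phi> and M :: "'m measure" +
  fixes Z :: "nat \<Rightarrow> 'm \<Rightarrow> 'a"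
  assumes prob_\<mu>: "prob_space \<mu>"
    and ind: "indep_vars (\<lambda>_. \<mu>) Z UNIV" and law: "\<And>j. distr M \<mu> (Z j) = \<mu>"
    and slice: "\<And>z. z \<in> space \<mu> \<Longrightarrow> (\<lambda>w. \<Phi> (z, w)) \<in> L2 \<nu>"
    and degenerate: "\<And>z. z \<in> space \<mu> \<Longrightarrow> (\<integral>z'. hs_comp \<nu> \<Phi> (tr \<Phi>) (z, z') \<partial>\<mu>) = 0"
begin

sublocale \<mu>: prob_space \<mu> by (rule prob_\<mu>)

lemma Z_measurable [measurable]: "Z j \<in> measurable M \<mu>"
  using ind by (auto simp: indep_vars_def)

lemma \<phi>_measurable [measurable]: "\<phi> i \<in> borel_measurable \<mu>"
  using \<phi>[of i] by measurable

lemma \<kappa>_measurable [measurable]: "\<kappa> \<in> borel_measurable (\<mu> \<Otimes>\<^sub>M \<mu>)"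
  using \<kappa>_L2 by measurable

lemma \<kappa>_ip: "\<kappa> (z, z') = ip \<nu> (\<lambda>w. \<Phi> (z, w)) (\<lambda>w. \<Phi> (z', w))"
  by (simp add: \<kappa>_def hs_comp_def ip_def tr_def)

text \<open>Degeneracy puts the constants into the null space of the operator, and eigenfunctions
  with nonzero eigenvalue are orthogonal to it. Padded indices carry a null function.\<close>

lemma \<phi>_mean: "(\<integral>z. \<phi> i z \<partial>\<mu>) = 0"
proof (cases "lam i = 0")
  case True
  then have "AE z in \<mu>. \<phi> i z = 0" using orth[of i i] nrm2_zero_iff[OF \<phi>, of i] by simp
  then have "(\<integral>z. \<phi> i z \<partial>\<mu>) = (\<integral>z. 0 \<partial>\<mu>)" by (intro integral_cong_AE) auto
  then show ?thesis by simp
next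
  case False
  have one: "(\<lambda>_. 1) \<in> L2 \<mu>" by (simp add: L2_def)
  have k0: "(\<integral>b. \<kappa> (b, c) \<partial>\<mu>) = 0" if "c \<in> space \<mu>" for c
  proof -
    have "\<kappa> (b, c) = \<kappa> (c, b)" for b by (simp add: \<kappa>_ip ip_commute)
    then show ?thesis using degenerate[OF that] by (simp add: \<kappa>_def)
  qed
  have "lam i * (\<integral>z. \<phi> i z \<partial>\<mu>) = (\<integral>z. lam i * \<phi> i z \<partial>\<mu>)" by simp
  also have "\<dots> = (\<integral>b. 1 * (\<integral>c. \<kappa> (b, c) * \<phi> i c \<partial>\<mu>) \<partial>\<mu>)"
    using eig[of i] by (intro integral_cong_AE) (auto simp: \<kappa>_def[symmetric])
  also have "\<dots> = (\<integral>c. (\<integral>b. 1 * \<kappa> (b, c) \<partial>\<mu>) * \<phi> i c \<partial>\<mu>)"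
    by (rule Fubini_three(1)[OF sf_\<mu> sf_\<mu> one \<phi> \<kappa>_L2, symmetric])
  also have "\<dots> = (\<integral>c. 0 \<partial>\<mu>)"
    by (intro Bochner_Integration.integral_cong) (auto simp: k0)
  finally show ?thesis using False by simp
qed

definition V :: "nat \<Rightarrow> 'm \<Rightarrow> real" where
  "V n \<omega> = (\<Sum>j<n. \<Sum>l<n. \<kappa> (Z j \<omega>, Z l \<omega>)) / real n"

definition c :: "nat \<Rightarrow> nat \<Rightarrow> 'm \<Rightarrow> real" where
  "c n i \<omega> = (\<Sum>j<n. \<phi> i (Z j \<omega>)) / sqrt (real n)"

lemma V_measurable [measurable]: "V n \<in> borel_measurable M"
  unfolding V_def by measurable

lemma c_measurable [measurable]: "c n i \<in> borel_measurable M"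
  unfolding c_def by measurable

text \<open>The V-statistic is the squared norm of \<open>W\<close>, the normalised sum of the
  feature functions of the sample. The inner product of \<open>W\<close> with \<open>e i\<close> is
  \<open>lam i * c n i \<omega>\<close>, so \<open>R\<close> is its projection onto the first
  \<open>N\<close> of the \<open>e i\<close>, and the claim is Bessel's inequality.\<close>

lemma V_ge_truncation: "AE \<omega> in M. (\<Sum>i<N. lam i * (c n i \<omega>)\<^sup>2) \<le> V n \<omega>"
proof -
  have "AE z in \<mu>. ip \<nu> (\<lambda>w. \<Phi> (z, w)) (e i) = lam i * \<phi> i z" for i
    using hs_app_factor[OF sf_\<mu> sf_\<nu> \<Phi> \<phi>, of i] eig[of i]
    by eventually_elim (simp add: hs_app_def tr_def ip_def e_def)
  then have "AE z in \<mu>. \<forall>i. ip \<nu> (\<lambda>w. \<Phi> (z, w)) (e i) = lam i * \<phi> i z" by (simp add: AE_all_countable)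
  then have "AE z in distr M \<mu> (Z j). \<forall>i. ip \<nu> (\<lambda>w. \<Phi> (z, w)) (e i) = lam i * \<phi> i z" for j
    unfolding law .
  then have "AE \<omega> in M. \<forall>i. ip \<nu> (\<lambda>w. \<Phi> (Z j \<omega>, w)) (e i) = lam i * \<phi> i (Z j \<omega>)" for j
    by (rule AE_distrD[OF Z_measurable])
  then have "AE \<omega> in M. \<forall>j i. ip \<nu> (\<lambda>w. \<Phi> (Z j \<omega>, w)) (e i) = lam i * \<phi> i (Z j \<omega>)"
    unfolding AE_all_countable by blast
  then show ?thesis using AE_space
  proof eventually_elim
    case (elim \<omega>)
    define a where "a = 1 / sqrt (real n)"
    have a2: "a * a = 1 / real n" by (simp add: a_def)
    have Zs: "Z j \<omega> \<in> space \<mu>" for j using elim(2) measurable_space[OF Z_measurable] by blast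
    note sl = slice[OF Zs]
    define W where "W = (\<lambda>w. \<Sum>j<n. a * \<Phi> (Z j \<omega>, w))"
    define R where "R = (\<lambda>w. \<Sum>i<N. c n i \<omega> * e i w)"
    have W: "W \<in> L2 \<nu>" unfolding W_def by (intro L2_intros sl)
    have R: "R \<in> L2 \<nu>" unfolding R_def by (intro L2_intros e_L2)
    have WW: "nrm2 \<nu> W = V n \<omega>"
    proof -
      have "nrm2 \<nu> W = (\<Sum>j<n. a * ip \<nu> (\<lambda>w. \<Phi> (Z j \<omega>, w)) W)"
        by (subst (1) W_def) (simp add: ip_sum_left L2_cmult sl W ip_cmult_left)
      also have "\<dots> = (\<Sum>j<n. \<Sum>l<n. (a * a) * \<kappa> (Z j \<omega>, Z l \<omega>))"
        unfolding W_def by (simp add: ip_sum_right L2_cmult sl ip_cmult_right \<kappa>_ip sum_distrib_left mult_ac)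
      finally show ?thesis by (simp add: V_def a2 sum_divide_distrib)
    qed
    have We: "ip \<nu> W (e i) = lam i * c n i \<omega>" for i
    proof -
      have "ip \<nu> W (e i) = (\<Sum>j<n. a * (lam i * \<phi> i (Z j \<omega>)))"
        unfolding W_def using elim(1) by (simp add: ip_sum_left L2_cmult sl e_L2 ip_cmult_left)
      then show ?thesis by (simp add: c_def a_def sum_divide_distrib sum_distrib_left)
    qed
    have WR: "ip \<nu> W R = (\<Sum>i<N. lam i * (c n i \<omega>)\<^sup>2)"
    proof -
      have "ip \<nu> W R = (\<Sum>i<N. c n i \<omega> * (lam i * c n i \<omega>))"
        unfolding R_def by (simp add: ip_sum_right L2_cmult e_L2 W ip_cmult_right We)
      then show ?thesis by (simp add: power2_eq_square mult_ac)
    qed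
    have RR: "nrm2 \<nu> R = (\<Sum>i<N. lam i * (c n i \<omega>)\<^sup>2)"
    proof -
      have "ip \<nu> (e i) R = c n i \<omega> * lam i" if "i < N" for i
      proof -
        have "ip \<nu> (e i) R = (\<Sum>j<N. c n j \<omega> * ip \<nu> (e i) (e j))"
          unfolding R_def by (simp add: ip_sum_right L2_cmult e_L2 ip_cmult_right)
        also have "\<dots> = (\<Sum>j<N. if j = i then c n i \<omega> * lam i else 0)"
          by (intro sum.cong) (auto simp: ip_e)
        finally show ?thesis using that by simp
      qed
      then have "nrm2 \<nu> R = (\<Sum>i<N. c n i \<omega> * (c n i \<omega> * lam i))"
        by (subst (1) R_def) (simp add: ip_sum_left L2_cmult e_L2 R ip_cmult_left)
      then show ?thesis by (simp add: power2_eq_square mult_ac)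
    qed
    show ?case using nrm2_nonneg[of \<nu> "\<lambda>w. W w - R w"] by (simp add: nrm2_diff W R WW WR RR)
  qed
qed

lemma V_nonneg: "AE \<omega> in M. 0 \<le> V n \<omega>"
  using V_ge_truncation[of n 0] by simp

lemma integral_diag: "has_bochner_integral \<mu> (\<lambda>z. \<kappa> (z, z)) (nrm2 (\<mu> \<Otimes>\<^sub>M \<nu>) \<Phi>)"
proof -
  interpret \<nu>: sigma_finite_measure \<nu> by (rule sf_\<nu>)
  interpret MN: pair_sigma_finite \<mu> \<nu> ..
  have "integrable (\<mu> \<Otimes>\<^sub>M \<nu>) (\<lambda>(z, w). \<Phi> (z, w) * \<Phi> (z, w))"
    using L2_integrable_mult[OF \<Phi> \<Phi>] by (simp add: split_def)
  from MN.integrable_fst[OF this] have "integrable \<mu> (\<lambda>z. \<kappa> (z, z))"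
    by (simp add: \<kappa>_ip ip_def)
  then show ?thesis
    using ip_pair(1)[OF sf_\<mu> sf_\<nu> \<Phi> \<Phi>] by (simp add: has_bochner_integral_iff \<kappa>_ip)
qed

lemma has_integral_pair:
  "has_bochner_integral M (\<lambda>\<omega>. \<kappa> (Z j \<omega>, Z l \<omega>)) (if j = l then nrm2 (\<mu> \<Otimes>\<^sub>M \<nu>) \<Phi> else 0)"
proof (cases "j = l")
  case True
  have "has_bochner_integral (distr M \<mu> (Z j)) (\<lambda>z. \<kappa> (z, z)) (nrm2 (\<mu> \<Otimes>\<^sub>M \<nu>) \<Phi>)"
    unfolding law by (rule integral_diag)
  then show ?thesis using True by (simp add: has_bochner_integral_iff integrable_distr_eq integral_distr)
next
  case False
  interpret MM: pair_prob_space \<mu> \<mu> ..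
  have d: "distr M (\<mu> \<Otimes>\<^sub>M \<mu>) (\<lambda>\<omega>. (Z j \<omega>, Z l \<omega>)) = \<mu> \<Otimes>\<^sub>M \<mu>"
    using distr_pair_of_indep_vars(2)[OF ind False] by (simp add: law)
  have i: "integrable (\<mu> \<Otimes>\<^sub>M \<mu>) \<kappa>"
    by (rule MM.P.square_integrable_imp_integrable) (use \<kappa>_L2 in \<open>auto simp: L2_def\<close>)
  have "(\<integral>p. \<kappa> p \<partial>(\<mu> \<Otimes>\<^sub>M \<mu>)) = (\<integral>z. (\<integral>z'. \<kappa> (z, z') \<partial>\<mu>) \<partial>\<mu>)"
    using MM.integral_fst[of "\<lambda>z z'. \<kappa> (z, z')"] i by (simp add: split_def)
  also have "\<dots> = (\<integral>z. 0 \<partial>\<mu>)"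
    by (intro Bochner_Integration.integral_cong) (auto simp: degenerate \<kappa>_def)
  finally have "has_bochner_integral (distr M (\<mu> \<Otimes>\<^sub>M \<mu>) (\<lambda>\<omega>. (Z j \<omega>, Z l \<omega>))) \<kappa> 0"
    unfolding d using i by (simp add: has_bochner_integral_iff)
  then show ?thesis using False by (simp add: has_bochner_integral_iff integrable_distr_eq integral_distr)
qed

text \<open>Off-diagonal terms have mean 0 by degeneracy. The \<open>n\<close> diagonal terms each
  contribute the trace, so the mean does not depend on \<open>n\<close>.\<close>

lemma has_integral_V:
  assumes "n > 0"
  shows "has_bochner_integral M (V n) (nrm2 (\<mu> \<Otimes>\<^sub>M \<nu>) \<Phi>)"
proof -
  have "has_bochner_integral M (\<lambda>\<omega>. (\<Sum>j<n. \<Sum>l<n. \<kappa> (Z j \<omega>, Z l \<omega>)) / real n)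
    ((\<Sum>j<n. \<Sum>l<n. if j = l then nrm2 (\<mu> \<Otimes>\<^sub>M \<nu>) \<Phi> else 0) / real n)"
    by (intro has_bochner_integral_divide_zero has_bochner_integral_sum has_integral_pair)
  then show ?thesis using assms by (simp add: V_def[abs_def])
qed

lemma has_integral_\<phi>_pair:
  "has_bochner_integral M (\<lambda>\<omega>. \<phi> i (Z j \<omega>) * \<phi> i (Z l \<omega>)) (if j = l then nrm2 \<mu> (\<phi> i) else 0)"
proof (cases "j = l")
  case True
  have "has_bochner_integral (distr M \<mu> (Z j)) (\<lambda>z. \<phi> i z * \<phi> i z) (nrm2 \<mu> (\<phi> i))"
    unfolding law using L2_integrable_mult[OF \<phi> \<phi>, of i i] by (simp add: has_bochner_integral_iff ip_def)
  then show ?thesis using True by (simp add: has_bochner_integral_iff integrable_distr_eq integral_distr)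
next
  case False
  have i: "integrable \<mu> (\<phi> i)"
    by (rule \<mu>.square_integrable_imp_integrable) (use \<phi>[of i] in \<open>auto simp: L2_def\<close>)
  have "has_bochner_integral (distr M \<mu> (Z k)) (\<phi> i) 0" for k
    unfolding law using i \<phi>_mean by (simp add: has_bochner_integral_iff)
  then have k: "integrable M (\<lambda>\<omega>. \<phi> i (Z k \<omega>))" "(\<integral>\<omega>. \<phi> i (Z k \<omega>) \<partial>M) = 0" for k
    by (simp_all add: has_bochner_integral_iff integrable_distr_eq integral_distr)
  have "indep_var borel (\<phi> i \<circ> Z j) borel (\<phi> i \<circ> Z l)"
    by (rule indep_var_compose[OF distr_pair_of_indep_vars(1)[OF ind False]]) auto
  then have "indep_var borel (\<lambda>\<omega>. \<phi> i (Z j \<omega>)) borel (\<lambda>\<omega>. \<phi> i (Z l \<omega>))" by (simp add: comp_def)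
  from indep_var_integrable[OF this k(1) k(1)] indep_var_lebesgue_integral[OF this k(1) k(1)]
  show ?thesis using False by (simp add: has_bochner_integral_iff k(2))
qed

lemma has_integral_c_square:
  assumes "n > 0"
  shows "has_bochner_integral M (\<lambda>\<omega>. (c n i \<omega>)\<^sup>2) (nrm2 \<mu> (\<phi> i))"
proof -
  have "has_bochner_integral M (\<lambda>\<omega>. (\<Sum>j<n. \<Sum>l<n. \<phi> i (Z j \<omega>) * \<phi> i (Z l \<omega>)) / real n)
    ((\<Sum>j<n. \<Sum>l<n. if j = l then nrm2 \<mu> (\<phi> i) else 0) / real n)"
    by (intro has_bochner_integral_divide_zero has_bochner_integral_sum has_integral_\<phi>_pair)
  moreover have "(\<Sum>j<n. \<Sum>l<n. \<phi> i (Z j \<omega>) * \<phi> i (Z l \<omega>)) / real n = (c n i \<omega>)\<^sup>2" for \<omega>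
    by (simp add: c_def power_divide power2_eq_square sum_product)
  ultimately show ?thesis using assms by simp
qed

lemma lam_nrm2_\<phi>: "lam i * nrm2 \<mu> (\<phi> i) = lam i"
  by (simp add: orth)

text \<open>On the half-line \<open>exp (- x)\<close> has Lipschitz constant 1, so the error is at
  most \<open>t\<close> times the mean of the nonnegative difference between \<open>V n\<close> and
  its truncation. Both means are known exactly, whence a bound free of \<open>n\<close>.\<close>

lemma laplace_truncation:
  assumes "n > 0" "t \<ge> 0"
  shows "\<bar>(\<integral>\<omega>. exp (- (t * V n \<omega>)) \<partial>M) - (\<integral>\<omega>. exp (- (t * (\<Sum>i<N. lam i * (c n i \<omega>)\<^sup>2))) \<partial>M)\<bar>
    \<le> t * (nrm2 (\<mu> \<Otimes>\<^sub>M \<nu>) \<Phi> - (\<Sum>i<N. lam i))"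
proof -
  define Q where "Q \<omega> = (\<Sum>i<N. lam i * (c n i \<omega>)\<^sup>2)" for \<omega>
  have [measurable]: "Q \<in> borel_measurable M" unfolding Q_def by measurable
  have Q_nn: "0 \<le> Q \<omega>" for \<omega> unfolding Q_def by (intro sum_nonneg mult_nonneg_nonneg lam_nonneg) auto
  have QV: "AE \<omega> in M. Q \<omega> \<le> V n \<omega>" unfolding Q_def by (rule V_ge_truncation)
  have "has_bochner_integral M Q (\<Sum>i<N. lam i * nrm2 \<mu> (\<phi> i))"
    unfolding Q_def by (intro has_bochner_integral_sum has_bochner_integral_mult_right has_integral_c_square assms)
  then have bQ: "has_bochner_integral M Q (\<Sum>i<N. lam i)" by (simp add: lam_nrm2_\<phi>)
  note bd = has_bochner_integral_diff[OF has_integral_V[OF assms(1)] bQ]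
  have le1: "AE \<omega> in M. norm (exp (- (t * V n \<omega>))) \<le> 1"
    using V_nonneg[of n] by eventually_elim (use assms(2) in simp)
  have i1: "integrable M (\<lambda>\<omega>. exp (- (t * V n \<omega>)))"
    by (rule integrable_const_bound[OF le1]) simp
  have i2: "integrable M (\<lambda>\<omega>. exp (- (t * Q \<omega>)))"
    by (rule integrable_const_bound[where B=1]) (use Q_nn assms(2) in auto)
  have exp_diff: "\<bar>exp (- x) - exp (- y)\<bar> \<le> x - y" if "0 \<le> y" "y \<le> x" for x y :: real
  proof -
    have "exp (-y) - exp (-x) = exp (-y) * (1 - exp (- (x - y)))"
      by (simp add: right_diff_distrib flip: exp_add)
    also have "\<dots> \<le> 1 * (x - y)"
    proof (rule mult_mono)
      show "1 - exp (- (x - y)) \<le> x - y" using exp_ge_add_one_self[of "- (x - y)"] by linarith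
    qed (use that in auto)
    finally show ?thesis using that by simp
  qed
  have "\<bar>(\<integral>\<omega>. exp (- (t * V n \<omega>)) \<partial>M) - (\<integral>\<omega>. exp (- (t * Q \<omega>)) \<partial>M)\<bar>
     = \<bar>\<integral>\<omega>. exp (- (t * V n \<omega>)) - exp (- (t * Q \<omega>)) \<partial>M\<bar>"
    by (subst Bochner_Integration.integral_diff[OF i1 i2]) simp
  also have "\<dots> \<le> (\<integral>\<omega>. \<bar>exp (- (t * V n \<omega>)) - exp (- (t * Q \<omega>))\<bar> \<partial>M)"
    by (rule integral_abs_bound)
  also have "\<dots> \<le> (\<integral>\<omega>. t * (V n \<omega> - Q \<omega>) \<partial>M)"
  proof (rule integral_mono_AE)
    show "AE \<omega> in M. \<bar>exp (- (t * V n \<omega>)) - exp (- (t * Q \<omega>))\<bar> \<le> t * (V n \<omega> - Q \<omega>)"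
      using QV
    proof eventually_elim
      case (elim \<omega>)
      show ?case using exp_diff[of "t * Q \<omega>" "t * V n \<omega>"] elim Q_nn[of \<omega>] assms(2)
        by (simp add: mult_left_mono right_diff_distrib)
    qed
    show "integrable M (\<lambda>\<omega>. t * (V n \<omega> - Q \<omega>))" using bd by (auto simp: has_bochner_integral_iff)
  qed (use i1 i2 in auto)
  also have "\<dots> = t * (nrm2 (\<mu> \<Otimes>\<^sub>M \<nu>) \<Phi> - (\<Sum>i<N. lam i))"
    using bd by (simp add: has_bochner_integral_iff)
  finally show ?thesis unfolding Q_def .
qed

text \<open>The truncation level \<open>N\<close> is fixed first, which is possible because the
  truncation error is uniform in \<open>n\<close>; only then does \<open>n\<close> grow.\<close>

theorem laplace_V_tendsto:
  assumes t: "t \<ge> 0"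
  shows "(\<lambda>n. \<integral>\<omega>. exp (- (t * V n \<omega>)) \<partial>M) \<longlonglongrightarrow> (\<integral>g. exp (- (t * (\<Sum>i. lam i * (g i)\<^sup>2))) \<partial>gauss_seq)"
proof (rule LIMSEQ_I)
  let ?G = "(\<integral>g. exp (- (t * (\<Sum>i. lam i * (g i)\<^sup>2))) \<partial>gauss_seq)"
  let ?GN = "\<lambda>N. (\<integral>g. exp (- (t * (\<Sum>i<N. lam i * (g i)\<^sup>2))) \<partial>gauss_seq)"
  let ?CN = "\<lambda>n N. (\<integral>\<omega>. exp (- (t * (\<Sum>i<N. lam i * (c n i \<omega>)\<^sup>2))) \<partial>M)"
  let ?VN = "\<lambda>n. (\<integral>\<omega>. exp (- (t * V n \<omega>)) \<partial>M)"
  let ?T = "\<lambda>N. t * (nrm2 (\<mu> \<Otimes>\<^sub>M \<nu>) \<Phi> - (\<Sum>i<N. lam i))"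
  fix \<epsilon> :: real assume \<epsilon>: "\<epsilon> > 0"
  interpret G: prob_space gauss_seq by (rule prob_space_gauss_seq)
  have "(\<lambda>N. \<integral>g. exp (- (t * (\<Sum>i<N. lam i * (g i)\<^sup>2))) \<partial>gauss_seq) \<longlonglongrightarrow> ?G"
  proof (rule integral_dominated_convergence[where w = "\<lambda>_. 1"])
    show "AE g in gauss_seq. (\<lambda>N. exp (- (t * (\<Sum>i<N. lam i * (g i)\<^sup>2)))) \<longlonglongrightarrow> exp (- (t * (\<Sum>i. lam i * (g i)\<^sup>2)))"
      using gauss_seq_weighted_summable[OF lam_summable lam_nonneg]
      by eventually_elim (intro tendsto_intros summable_LIMSEQ)
    show "AE g in gauss_seq. norm (exp (- (t * (\<Sum>i<N. lam i * (g i)\<^sup>2)))) \<le> 1" for N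
      using t by (auto intro!: mult_nonneg_nonneg sum_nonneg lam_nonneg)
  qed auto
  then have "\<exists>N0. \<forall>N\<ge>N0. norm (?GN N - ?G) < \<epsilon> / 3"
    using \<epsilon> by (intro LIMSEQ_D) auto
  then obtain N1 where N1: "\<And>N. N \<ge> N1 \<Longrightarrow> \<bar>?GN N - ?G\<bar> < \<epsilon> / 3"
    by auto
  have "(\<lambda>N. ?T N) \<longlonglongrightarrow> t * (nrm2 (\<mu> \<Otimes>\<^sub>M \<nu>) \<Phi> - nrm2 (\<mu> \<Otimes>\<^sub>M \<nu>) \<Phi>)"
    using lam_sums unfolding sums_def by (intro tendsto_intros)
  then have "\<exists>N0. \<forall>N\<ge>N0. norm (?T N - 0) < \<epsilon> / 3"
    using \<epsilon> by (intro LIMSEQ_D) auto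
  then obtain N2 where N2': "\<forall>N\<ge>N2. norm (?T N - 0) < \<epsilon> / 3"
    by blast
  have N2: "?T N < \<epsilon> / 3" if "N \<ge> N2" for N
    using N2'[rule_format, OF that] unfolding real_norm_def diff_zero by linarith
  define N where "N = max N1 N2"
  \<comment> \<open>Chosen so that half of \<open>(s i * x)^2\<close> is
    \<open>t * lam i * x^2\<close>.\<close>
  define s where "s i = sqrt (2 * t * lam i)" for i
  have s2: "(s i)\<^sup>2 = 2 * t * lam i" for i using t lam_nonneg[of i] by (simp add: s_def)
  have quad: "- (\<Sum>i<N. (s i * x i)\<^sup>2) / 2 = - (t * (\<Sum>i<N. lam i * (x i)\<^sup>2))" for x :: "nat \<Rightarrow> real"
    by (simp add: power_mult_distrib s2 sum_distrib_left sum_divide_distrib mult_ac)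
  have "(\<lambda>n. \<integral>\<omega>. exp (- (\<Sum>i<N. (s i * c n i \<omega>)\<^sup>2) / 2) \<partial>M) \<longlonglongrightarrow> (\<integral>g. exp (- (\<Sum>i<N. (s i * g i)\<^sup>2) / 2) \<partial>gauss_seq)"
    unfolding c_def using laplace_quadratic_form_tendsto[OF ind law \<phi> \<phi>_mean prob_\<mu>, where s = s and K = N]
    by (simp add: orth s2)
  then have "\<exists>n0. \<forall>n\<ge>n0. norm (?CN n N - ?GN N) < \<epsilon> / 3"
    unfolding quad using \<epsilon> by (intro LIMSEQ_D) auto
  then obtain n0 where n0: "\<And>n. n \<ge> n0 \<Longrightarrow> \<bar>?CN n N - ?GN N\<bar> < \<epsilon> / 3"
    by auto
  have "norm (?VN n - ?G) < \<epsilon>" if "n \<ge> max n0 1" for n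
  proof -
    have "n > 0" "n \<ge> n0" "N \<ge> N1" "N \<ge> N2" using that by (auto simp: N_def)
    from laplace_truncation[OF this(1) t, of N] n0[OF this(2)] N1[OF this(3)] N2[OF this(4)]
    show ?thesis unfolding real_norm_def by arith
  qed
  then show "\<exists>n0. \<forall>n\<ge>n0. norm (?VN n - ?G) < \<epsilon>" by blast
qed

end

section \<open>Moments of degenerate kernels\<close>

text \<open>Integrating over the independent variable \<open>U\<close> first, with \<open>R\<close>
  frozen, gives 0 pointwise.\<close>

lemma (in prob_space) integral_indep_zero:
  fixes h :: "'b \<times> 'c \<Rightarrow> real"
  assumes [measurable]: "U \<in> measurable M N" "R \<in> measurable M N'"
    and d: "distr M N U \<Otimes>\<^sub>M distr M N' R = distr M (N \<Otimes>\<^sub>M N') (\<lambda>\<omega>. (U \<omega>, R \<omega>))"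
    and h[measurable]: "h \<in> borel_measurable (N \<Otimes>\<^sub>M N')"
    and int: "integrable M (\<lambda>\<omega>. h (U \<omega>, R \<omega>))"
    and z: "\<And>r. r \<in> space N' \<Longrightarrow> (\<integral>u. h (u, r) \<partial>distr M N U) = 0"
  shows "(\<integral>\<omega>. h (U \<omega>, R \<omega>) \<partial>M) = 0"
proof -
  interpret U: prob_space "distr M N U" by (rule prob_space_distr) simp
  interpret R: prob_space "distr M N' R" by (rule prob_space_distr) simp
  interpret UR: pair_prob_space "distr M N U" "distr M N' R" ..
  have i: "integrable (distr M N U \<Otimes>\<^sub>M distr M N' R) (\<lambda>(u, r). h (u, r))"
    unfolding d using int by (simp add: integrable_distr_eq split_def)
  have "(\<integral>\<omega>. h (U \<omega>, R \<omega>) \<partial>M) = (\<integral>p. h p \<partial>(distr M N U \<Otimes>\<^sub>M distr M N' R))"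
    unfolding d by (subst integral_distr) auto
  also have "\<dots> = (\<integral>r. (\<integral>u. h (u, r) \<partial>distr M N U) \<partial>distr M N' R)"
    using UR.integral_snd[OF i] by (simp add: split_def)
  also have "\<dots> = (\<integral>r. 0 \<partial>distr M N' R)"
    by (intro Bochner_Integration.integral_cong) (auto simp: z)
  finally show ?thesis by simp
qed

text \<open>Independence across indices and independence within each pair combine into independence
  of one family indexed by \<open>bool \<times> nat\<close>; functionals of the \<open>True\<close>
  half and of the \<open>False\<close> half are then independent.\<close>

lemma (in prob_space) indep_var_sequences:
  fixes X :: "nat \<Rightarrow> 'a \<Rightarrow> 'x::second_countable_topology" and Y :: "nat \<Rightarrow> 'a \<Rightarrow> 'y::second_countable_topology"
  assumes ind: "indep_vars (\<lambda>_. borel) (\<lambda>i \<omega>. (X i \<omega>, Y i \<omega>)) UNIV"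
    and [measurable]: "\<And>i. X i \<in> borel_measurable M" "\<And>i. Y i \<in> borel_measurable M"
    and pair: "\<And>i. distr M borel (\<lambda>\<omega>. (X i \<omega>, Y i \<omega>)) = distr M borel (X i) \<Otimes>\<^sub>M distr M borel (Y i)"
    and f: "f \<in> borel_measurable (\<Pi>\<^sub>M i\<in>UNIV. borel)" and g: "g \<in> borel_measurable (\<Pi>\<^sub>M i\<in>UNIV. borel)"
  shows "indep_var borel (\<lambda>\<omega>. f (\<lambda>i. X i \<omega>)) borel (\<lambda>\<omega>. g (\<lambda>i. Y i \<omega>))"
proof -
  \<comment> \<open>\<open>indep_vars\<close> needs one value type, so both sequences are embedded into the product type.\<close>
  obtain x0 :: 'x and y0 :: 'y where True by simp
  define W where "W j \<omega> = (if fst j then (X (snd j) \<omega>, y0) else (x0, Y (snd j) \<omega>))" for j :: "bool \<times> nat" and \<omega>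
  have W_m[measurable]: "W j \<in> borel_measurable M" for j
    unfolding W_def borel_prod[symmetric] by (cases "fst j") auto
  have "indep_vars (\<lambda>_. borel) W UNIV"
    unfolding indep_vars_def2
  proof (intro conjI ballI indep_setsI)
    fix j show "W j \<in> borel_measurable M" by simp
    show "{W j -` A \<inter> space M |A. A \<in> sets borel} \<subseteq> events" by auto
  next
    fix E and J :: "(bool \<times> nat) set"
    assume J: "J \<noteq> {}" "finite J" and E: "\<forall>j\<in>J. E j \<in> {W j -` A \<inter> space M |A. A \<in> sets borel}"
    from E have "\<forall>j\<in>J. \<exists>A. A \<in> sets borel \<and> E j = W j -` A \<inter> space M" by auto
    then obtain B where B: "\<And>j. j \<in> J \<Longrightarrow> B j \<in> sets borel" "\<And>j. j \<in> J \<Longrightarrow> E j = W j -` B j \<inter> space M"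
      by metis
    define I where "I = snd ` J"
    have I: "finite I" "I \<noteq> {}" using J by (auto simp: I_def)
    \<comment> \<open>A coordinate on which \<open>J\<close> imposes no condition receives
      \<open>UNIV\<close>, so that every \<open>i\<close> in \<open>I\<close> contributes a full
      rectangle.\<close>
    define C where "C i = (if (True, i) \<in> J then (\<lambda>x. (x, y0)) -` B (True, i) else UNIV)" for i
    define D where "D i = (if (False, i) \<in> J then (\<lambda>y. (x0, y)) -` B (False, i) else UNIV)" for i
    have "(\<lambda>x::'x. (x, y0)) \<in> measurable borel (borel \<Otimes>\<^sub>M borel)" "(\<lambda>y::'y. (x0, y)) \<in> measurable borel (borel \<Otimes>\<^sub>M borel)"
      by measurable
    then have mx: "(\<lambda>x::'x. (x, y0)) \<in> measurable borel borel" "(\<lambda>y::'y. (x0, y)) \<in> measurable borel borel"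
      unfolding borel_prod .
    have C: "C i \<in> sets borel" for i
      using measurable_sets[OF mx(1) B(1)[of "(True, i)"]] by (auto simp: C_def)
    have D: "D i \<in> sets borel" for i
      using measurable_sets[OF mx(2) B(1)[of "(False, i)"]] by (auto simp: D_def)
    have CD: "C i \<times> D i \<in> sets (borel :: ('x \<times> 'y) measure)" for i
      unfolding borel_prod[symmetric] using C D by (intro pair_measureI)
    have "(\<Inter>j\<in>J. E j) = (\<Inter>i\<in>I. (\<lambda>\<omega>. (X i \<omega>, Y i \<omega>)) -` (C i \<times> D i) \<inter> space M)"
    proof -
      have "\<omega> \<in> (\<Inter>j\<in>J. E j) \<longleftrightarrow> \<omega> \<in> space M \<and> (\<forall>j\<in>J. W j \<omega> \<in> B j)" for \<omega> using B(2) J by auto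
      moreover have "(\<forall>j\<in>J. W j \<omega> \<in> B j) \<longleftrightarrow> (\<forall>i\<in>I. X i \<omega> \<in> C i \<and> Y i \<omega> \<in> D i)" for \<omega>
      proof -
        have "(\<forall>j\<in>J. W j \<omega> \<in> B j) \<longleftrightarrow> (\<forall>i. ((True, i) \<in> J \<longrightarrow> W (True, i) \<omega> \<in> B (True, i)) \<and> ((False, i) \<in> J \<longrightarrow> W (False, i) \<omega> \<in> B (False, i)))"
          by (metis (full_types) surj_pair)
        also have "\<dots> \<longleftrightarrow> (\<forall>i. X i \<omega> \<in> C i \<and> Y i \<omega> \<in> D i)"
          by (auto simp: C_def D_def W_def)
        also have "\<dots> \<longleftrightarrow> (\<forall>i\<in>I. X i \<omega> \<in> C i \<and> Y i \<omega> \<in> D i)"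
          by (force simp: C_def D_def I_def)
        finally show ?thesis .
      qed
      ultimately show ?thesis using I by auto
    qed
    also have "prob \<dots> = (\<Prod>i\<in>I. prob ((\<lambda>\<omega>. (X i \<omega>, Y i \<omega>)) -` (C i \<times> D i) \<inter> space M))"
      by (rule indep_varsD[OF ind]) (use I CD in auto)
    also have "\<dots> = (\<Prod>i\<in>I. prob (X i -` C i \<inter> space M) * prob (Y i -` D i \<inter> space M))"
    proof (rule prod.cong)
      fix i
      show "prob ((\<lambda>\<omega>. (X i \<omega>, Y i \<omega>)) -` (C i \<times> D i) \<inter> space M) = prob (X i -` C i \<inter> space M) * prob (Y i -` D i \<inter> space M)"
      proof -
        interpret X: prob_space "distr M borel (X i)" by (rule prob_space_distr) simp
        interpret Y: prob_space "distr M borel (Y i)" by (rule prob_space_distr) simp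
        have m: "(\<lambda>\<omega>. (X i \<omega>, Y i \<omega>)) \<in> borel_measurable M" unfolding borel_prod[symmetric] by measurable
        have "prob ((\<lambda>\<omega>. (X i \<omega>, Y i \<omega>)) -` (C i \<times> D i) \<inter> space M) = measure (distr M borel (\<lambda>\<omega>. (X i \<omega>, Y i \<omega>))) (C i \<times> D i)"
          by (rule measure_distr[symmetric, OF m CD])
        also have "\<dots> = measure (distr M borel (X i)) (C i) * measure (distr M borel (Y i)) (D i)"
          unfolding pair measure_def using C D
          by (subst Y.emeasure_pair_measure_Times) (auto simp: enn2real_mult)
        finally show ?thesis using C D by (simp add: measure_distr)
      qed
    qed simp
    \<comment> \<open>Unconstrained coordinates contribute the factor 1, so the product over both
      coordinates of all indices can be cut back to \<open>J\<close>.\<close>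
    also have "\<dots> = (\<Prod>i\<in>I. \<Prod>b\<in>UNIV. if (b, i) \<in> J then prob (E (b, i)) else 1)"
    proof (rule prod.cong)
      fix i
      have "X i -` C i \<inter> space M = (if (True, i) \<in> J then E (True, i) else space M)"
        using B(2)[of "(True, i)"] by (auto simp: C_def W_def)
      moreover have "Y i -` D i \<inter> space M = (if (False, i) \<in> J then E (False, i) else space M)"
        using B(2)[of "(False, i)"] by (auto simp: D_def W_def)
      ultimately show "prob (X i -` C i \<inter> space M) * prob (Y i -` D i \<inter> space M) = (\<Prod>b\<in>UNIV. if (b, i) \<in> J then prob (E (b, i)) else 1)"
        by (simp add: UNIV_bool prob_space mult.commute)
    qed simp
    also have "\<dots> = (\<Prod>b\<in>UNIV. \<Prod>i\<in>I. if (b, i) \<in> J then prob (E (b, i)) else 1)"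
      by (rule prod.swap)
    also have "\<dots> = (\<Prod>j\<in>UNIV \<times> I. if j \<in> J then prob (E j) else 1)"
      by (simp add: prod.cartesian_product split_def cong: if_cong)
    also have "\<dots> = (\<Prod>j\<in>J. prob (E j))"
    proof (rule prod.mono_neutral_cong_right)
      show "J \<subseteq> UNIV \<times> I" by (force simp: I_def)
    qed (use I in auto)
    finally show "prob (\<Inter>j\<in>J. E j) = (\<Prod>j\<in>J. prob (E j))" .
  qed
  then have "indep_var (\<Pi>\<^sub>M j\<in>{True} \<times> UNIV. borel) (\<lambda>\<omega>. restrict (\<lambda>j. W j \<omega>) ({True} \<times> UNIV))
      (\<Pi>\<^sub>M j\<in>{False} \<times> UNIV. borel) (\<lambda>\<omega>. restrict (\<lambda>j. W j \<omega>) ({False} \<times> UNIV))"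
    by (rule indep_var_restrict) auto
  then have "indep_var borel ((\<lambda>w. f (\<lambda>i. fst (w (True, i)))) \<circ> (\<lambda>\<omega>. restrict (\<lambda>j. W j \<omega>) ({True} \<times> UNIV)))
      borel ((\<lambda>w. g (\<lambda>i. snd (w (False, i)))) \<circ> (\<lambda>\<omega>. restrict (\<lambda>j. W j \<omega>) ({False} \<times> UNIV)))"
  proof (rule indep_var_compose)
    have m: "(\<lambda>f. f (b, i)) \<in> measurable (\<Pi>\<^sub>M j\<in>{b} \<times> UNIV. borel) (borel \<Otimes>\<^sub>M borel :: ('x \<times> 'y) measure)" for b and i :: nat
      unfolding borel_prod by (rule measurable_component_singleton) auto
    have "(\<lambda>w i. fst (w (True, i))) \<in> measurable (\<Pi>\<^sub>M j\<in>{True} \<times> (UNIV :: nat set). (borel :: ('x \<times> 'y) measure)) (\<Pi>\<^sub>M i\<in>UNIV. borel)"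
      by (rule measurable_PiM_single') (auto intro!: measurable_compose[OF m measurable_fst])
    from measurable_compose[OF this f]
    show "(\<lambda>w. f (\<lambda>i. fst (w (True, i)))) \<in> borel_measurable (\<Pi>\<^sub>M j\<in>{True} \<times> (UNIV :: nat set). (borel :: ('x \<times> 'y) measure))" .
    have "(\<lambda>w i. snd (w (False, i))) \<in> measurable (\<Pi>\<^sub>M j\<in>{False} \<times> (UNIV :: nat set). (borel :: ('x \<times> 'y) measure)) (\<Pi>\<^sub>M i\<in>UNIV. borel)"
      by (rule measurable_PiM_single') (auto intro!: measurable_compose[OF m measurable_snd])
    from measurable_compose[OF this g]
    show "(\<lambda>w. g (\<lambda>i. snd (w (False, i)))) \<in> borel_measurable (\<Pi>\<^sub>M j\<in>{False} \<times> (UNIV :: nat set). (borel :: ('x \<times> 'y) measure))" .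
  qed
  then show ?thesis by (simp add: comp_def W_def)
qed

text \<open>Covariances of degenerate kernels survive only when the two unordered index pairs
  coincide, and this counts the coincidences: \<open>l = j\<close> with \<open>j\<close> different
  from \<open>i\<close> when \<open>i = k\<close>, and only \<open>j = k\<close>,
  \<open>l = i\<close> otherwise.\<close>

lemma pair_index_sum:
  fixes n :: nat
  assumes "i < n" "k < n"
  shows "(\<Sum>j<n. \<Sum>l<n. if i \<noteq> j \<and> {i, j} = {k, l} then (1::real) else 0) = (if i = k then real n - 1 else 1)"
proof (cases "i = k")
  case True
  have "(\<Sum>j<n. \<Sum>l<n. if i \<noteq> j \<and> {i, j} = {k, l} then (1::real) else 0) = (\<Sum>j<n. \<Sum>l<n. if l = j then (if j \<noteq> i then 1 else 0) else 0)"
    using True by (intro sum.cong) (auto simp: doubleton_eq_iff)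
  also have "\<dots> = (\<Sum>j<n. if j \<noteq> i then 1 else 0)" by simp
  also have "\<dots> = (\<Sum>j\<in>{..<n} - {i}. 1)" by (rule sum.mono_neutral_cong_right) auto
  finally show ?thesis using True assms by (simp add: of_nat_diff)
next
  case False
  have "(\<Sum>j<n. \<Sum>l<n. if i \<noteq> j \<and> {i, j} = {k, l} then (1::real) else 0) = (\<Sum>j<n. \<Sum>l<n. if l = i then (if j = k then 1 else 0) else 0)"
    using False by (intro sum.cong) (auto simp: doubleton_eq_iff)
  then show ?thesis using False assms by simp
qed

locale degenerate_kernel = prob_space M
  for M :: "'m measure" +
  fixes N :: "'x measure" and X :: "nat \<Rightarrow> 'm \<Rightarrow> 'x" and A :: "'x \<times> 'x \<Rightarrow> real"
  assumes prob_N: "prob_space N"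
    and X_indep: "indep_vars (\<lambda>_. N) X UNIV" and X_law: "\<And>j. distr M N (X j) = N"
    and A_L2: "A \<in> L2 (N \<Otimes>\<^sub>M N)" and A_sym: "\<And>x y. A (x, y) = A (y, x)"
    and A_degenerate: "\<And>x. x \<in> space N \<Longrightarrow> (\<integral>y. A (x, y) \<partial>N) = 0"
begin

sublocale N: prob_space N by (rule prob_N)

lemma X_measurable [measurable]: "X j \<in> measurable M N"
  using X_indep by (auto simp: indep_vars_def)

lemma A_measurable [measurable]: "A \<in> borel_measurable (N \<Otimes>\<^sub>M N)"
  using A_L2 by measurable

text \<open>Defined on whole sequences, not on sample points, so that sums and products of entries
  are functionals to which independence of the two samples applies.\<close>

definition offdiag :: "nat \<Rightarrow> nat \<Rightarrow> (nat \<Rightarrow> 'x) \<Rightarrow> real" where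
  "offdiag i j x = (if i = j then 0 else A (x i, x j))"

abbreviation \<alpha> :: real where "\<alpha> \<equiv> nrm2 (N \<Otimes>\<^sub>M N) A"

lemma offdiag_sym: "offdiag i j x = offdiag j i x"
  by (simp add: offdiag_def A_sym[of "x i"])

lemma offdiag_measurable [measurable]: "offdiag i j \<in> borel_measurable (\<Pi>\<^sub>M i\<in>UNIV. N)"
  unfolding offdiag_def by measurable

lemma offdiag_square:
  assumes "i \<noteq> j"
  shows "has_bochner_integral M (\<lambda>\<omega>. offdiag i j (\<lambda>m. X m \<omega>) * offdiag i j (\<lambda>m. X m \<omega>)) \<alpha>"
proof -
  have d: "distr M (N \<Otimes>\<^sub>M N) (\<lambda>\<omega>. (X i \<omega>, X j \<omega>)) = N \<Otimes>\<^sub>M N"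
    using distr_pair_of_indep_vars(2)[OF X_indep assms] by (simp add: X_law)
  have "has_bochner_integral (distr M (N \<Otimes>\<^sub>M N) (\<lambda>\<omega>. (X i \<omega>, X j \<omega>))) (\<lambda>p. A p * A p) \<alpha>"
    unfolding d using L2_integrable_mult[OF A_L2 A_L2] by (simp add: has_bochner_integral_iff ip_def)
  then show ?thesis using assms by (simp add: has_bochner_integral_iff integrable_distr_eq integral_distr offdiag_def)
qed

lemma offdiag_L2: "(\<lambda>\<omega>. offdiag i j (\<lambda>m. X m \<omega>)) \<in> L2 M"
proof (cases "i = j")
  case True then show ?thesis by (simp add: offdiag_def L2_zero)
next
  case False
  then have "(\<lambda>\<omega>. offdiag i j (\<lambda>m. X m \<omega>)) \<in> borel_measurable M" by (simp add: offdiag_def)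
  then show ?thesis using offdiag_square[OF False] by (simp add: L2_iff has_bochner_integral_iff)
qed

text \<open>The index \<open>j\<close> occurs exactly once among the four. Integrating over
  \<open>X j\<close> with the other variables frozen therefore gives 0 by degeneracy; coincidences
  among the other indices do not matter.\<close>

lemma offdiag_orth:
  assumes "j \<noteq> i" "j \<noteq> k" "j \<noteq> l" "k \<noteq> l"
  shows "(\<integral>\<omega>. offdiag i j (\<lambda>m. X m \<omega>) * offdiag k l (\<lambda>m. X m \<omega>) \<partial>M) = 0"
proof -
  let ?U = "\<lambda>\<omega>. restrict (\<lambda>i. X i \<omega>) {j}" and ?R = "\<lambda>\<omega>. restrict (\<lambda>i. X i \<omega>) {i, k, l}"
  let ?NU = "\<Pi>\<^sub>M i\<in>{j}. N" and ?NR = "\<Pi>\<^sub>M i\<in>{i, k, l}. N"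
  have "indep_var ?NU ?U ?NR ?R"
    using assms by (intro indep_var_restrict[OF X_indep]) auto
  then have ind: "?U \<in> measurable M ?NU" "?R \<in> measurable M ?NR"
    "distr M ?NU ?U \<Otimes>\<^sub>M distr M ?NR ?R = distr M (?NU \<Otimes>\<^sub>M ?NR) (\<lambda>\<omega>. (?U \<omega>, ?R \<omega>))"
    by (simp_all add: indep_var_distribution_eq)
  define h where "h = (\<lambda>(u, r). A (r i, u j) * A (r k, r l))"
  have [measurable]: "h \<in> borel_measurable (?NU \<Otimes>\<^sub>M ?NR)"
    unfolding h_def by measurable
  have h_eq: "h (?U \<omega>, ?R \<omega>) = offdiag i j (\<lambda>m. X m \<omega>) * offdiag k l (\<lambda>m. X m \<omega>)" for \<omega>
    using assms by (simp add: h_def offdiag_def)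
  have "(\<integral>\<omega>. h (?U \<omega>, ?R \<omega>) \<partial>M) = 0"
  proof (rule integral_indep_zero[OF ind])
    show "integrable M (\<lambda>\<omega>. h (?U \<omega>, ?R \<omega>))"
      unfolding h_eq by (intro L2_integrable_mult offdiag_L2)
    fix r assume "r \<in> space ?NR"
    then have r[measurable]: "r i \<in> space N" "r k \<in> space N" "r l \<in> space N" by (auto simp: space_PiM PiE_iff)
    have "(\<integral>u. h (u, r) \<partial>distr M ?NU ?U) = (\<integral>\<omega>. A (r i, X j \<omega>) * A (r k, r l) \<partial>M)"
      unfolding h_def using ind(1) by (subst integral_distr) auto
    also have "\<dots> = (\<integral>x. A (r i, x) \<partial>distr M N (X j)) * A (r k, r l)"
      by (subst integral_distr) auto
    finally show "(\<integral>u. h (u, r) \<partial>distr M ?NU ?U) = 0"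
      unfolding X_law using A_degenerate[OF r(1)] by simp
  qed simp
  then show ?thesis unfolding h_eq .
qed

text \<open>If the unordered pairs differ, one endpoint of the first is missing from the second; the
  last two cases distinguish which one, and symmetry reduces both to
  \<open>offdiag_orth\<close>.\<close>

lemma offdiag_moment:
  "has_bochner_integral M (\<lambda>\<omega>. offdiag i j (\<lambda>m. X m \<omega>) * offdiag k l (\<lambda>m. X m \<omega>))
     (\<alpha> * (if i \<noteq> j \<and> {i, j} = {k, l} then 1 else 0))"
proof -
  have int: "integrable M (\<lambda>\<omega>. offdiag i j (\<lambda>m. X m \<omega>) * offdiag k l (\<lambda>m. X m \<omega>))"
    by (intro L2_integrable_mult offdiag_L2)
  consider "i = j" | "k = l" | "i \<noteq> j" "{i, j} = {k, l}" | "i \<noteq> j" "k \<noteq> l" "j \<noteq> k" "j \<noteq> l" | "i \<noteq> j" "k \<noteq> l" "i \<noteq> k" "i \<noteq> l"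
    by (auto simp: doubleton_eq_iff)
  then show ?thesis
  proof cases
    case 1 then show ?thesis by (simp add: offdiag_def has_bochner_integral_zero)
  next
    case 2 then show ?thesis by (auto simp: offdiag_def has_bochner_integral_zero)
  next
    case 3
    then have "offdiag k l x = offdiag i j x" for x by (auto simp: doubleton_eq_iff offdiag_sym)
    then show ?thesis using 3 offdiag_square[of i j] by simp
  next
    case 4
    then have "(\<integral>\<omega>. offdiag i j (\<lambda>m. X m \<omega>) * offdiag k l (\<lambda>m. X m \<omega>) \<partial>M) = 0" by (intro offdiag_orth) auto
    then show ?thesis using 4 int by (auto simp: has_bochner_integral_iff doubleton_eq_iff)
  next
    case 5
    then have "(\<integral>\<omega>. offdiag j i (\<lambda>m. X m \<omega>) * offdiag k l (\<lambda>m. X m \<omega>) \<partial>M) = 0" by (intro offdiag_orth) auto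
    then show ?thesis using 5 int by (auto simp: has_bochner_integral_iff doubleton_eq_iff offdiag_sym[of i j])
  qed
qed

lemma row_moment:
  assumes "i < n" "k < n"
  shows "has_bochner_integral M (\<lambda>\<omega>. (\<Sum>j<n. offdiag i j (\<lambda>m. X m \<omega>)) * (\<Sum>l<n. offdiag k l (\<lambda>m. X m \<omega>)))
    (\<alpha> * (if i = k then real n - 1 else 1))"
proof -
  have "has_bochner_integral M (\<lambda>\<omega>. \<Sum>j<n. \<Sum>l<n. offdiag i j (\<lambda>m. X m \<omega>) * offdiag k l (\<lambda>m. X m \<omega>))
    (\<Sum>j<n. \<Sum>l<n. \<alpha> * (if i \<noteq> j \<and> {i, j} = {k, l} then 1 else 0))"
    by (intro has_bochner_integral_sum offdiag_moment)
  then show ?thesis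
    unfolding sum_product by (simp only: pair_index_sum[OF assms] sum_distrib_left[symmetric])
qed

text \<open>Each of the \<open>n (n - 1)\<close> ordered pairs correlates with itself and with its
  reversal, hence the factor 2.\<close>

lemma total_moment:
  "has_bochner_integral M (\<lambda>\<omega>. (\<Sum>i<n. \<Sum>j<n. offdiag i j (\<lambda>m. X m \<omega>)) * (\<Sum>i<n. \<Sum>j<n. offdiag i j (\<lambda>m. X m \<omega>)))
    (\<alpha> * (2 * real n * (real n - 1)))"
proof -
  have "has_bochner_integral M (\<lambda>\<omega>. \<Sum>i<n. \<Sum>k<n. (\<Sum>j<n. offdiag i j (\<lambda>m. X m \<omega>)) * (\<Sum>l<n. offdiag k l (\<lambda>m. X m \<omega>)))
    (\<Sum>i<n. \<Sum>k<n. \<alpha> * (if i = k then real n - 1 else 1))"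
    by (intro has_bochner_integral_sum row_moment) auto
  moreover have "(\<Sum>i<n. \<Sum>k<n. \<alpha> * (if i = k then real n - 1 else 1)) = \<alpha> * (2 * real n * (real n - 1))"
  proof -
    have "(\<Sum>k<n. if i = k then real n - 1 else 1) = 2 * (real n - 1)" if "i < n" for i
    proof -
      have "(\<Sum>k<n. if i = k then real n - 1 else 1) = (\<Sum>k<n. 1 + (if i = k then real n - 2 else 0))"
        by (intro sum.cong) auto
      also have "\<dots> = real n + (real n - 2)" unfolding sum.distrib using that by simp
      finally show ?thesis by simp
    qed
    then show ?thesis by (simp add: sum_distrib_left[symmetric])
  qed
  ultimately show ?thesis by (simp add: sum_product)
qed

end

section \<open>The statistic as a bilinear form in two matrices\<close>

definition ucov :: "nat \<Rightarrow> (nat \<Rightarrow> nat \<Rightarrow> real) \<Rightarrow> (nat \<Rightarrow> nat \<Rightarrow> real) \<Rightarrow> real" where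
  "ucov n a b = (\<Sum>i<n. \<Sum>j<n. a i j * b i j) / (real n * (real n - 3))
     - 2 / (real n * (real n - 2) * (real n - 3)) * (\<Sum>i<n. (\<Sum>j<n. a i j) * (\<Sum>j<n. b i j))
     + (\<Sum>i<n. \<Sum>j<n. a i j) * (\<Sum>i<n. \<Sum>j<n. b i j) / (real n * (real n - 1) * (real n - 2) * (real n - 3))"

lemma ucov_commute: "ucov n a b = ucov n b a"
  by (simp add: ucov_def mult.commute)

lemma ucov_cong:
  assumes "\<And>i j. i < n \<Longrightarrow> j < n \<Longrightarrow> a i j = a' i j" "\<And>i j. i < n \<Longrightarrow> j < n \<Longrightarrow> b i j = b' i j"
  shows "ucov n a b = ucov n a' b'"
proof -
  have "(\<Sum>i<n. \<Sum>j<n. a i j * b i j) = (\<Sum>i<n. \<Sum>j<n. a' i j * b' i j)"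
    by (intro sum.cong) (auto simp: assms)
  moreover have r: "i < n \<Longrightarrow> (\<Sum>j<n. a i j) = (\<Sum>j<n. a' i j)" "i < n \<Longrightarrow> (\<Sum>j<n. b i j) = (\<Sum>j<n. b' i j)" for i
    by (auto intro!: sum.cong simp: assms)
  have "(\<Sum>i<n. (\<Sum>j<n. a i j) * (\<Sum>j<n. b i j)) = (\<Sum>i<n. (\<Sum>j<n. a' i j) * (\<Sum>j<n. b' i j))"
    "(\<Sum>i<n. \<Sum>j<n. a i j) = (\<Sum>i<n. \<Sum>j<n. a' i j)" "(\<Sum>i<n. \<Sum>j<n. b i j) = (\<Sum>i<n. \<Sum>j<n. b' i j)"
    by (auto intro!: sum.cong simp: r)
  ultimately show ?thesis unfolding ucov_def by simp
qed

lemma Omega_n_eq_ucov: "Omega_n n x y = ucov n (\<lambda>i j. \<bar>x i - x j\<bar>) (\<lambda>i j. \<bar>y i - y j\<bar>)"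
proof -
  have "(\<Sum>i<n. \<Sum>j<n. if i \<noteq> j then \<bar>x i - x j\<bar> * \<bar>y i - y j\<bar> else 0) = (\<Sum>i<n. \<Sum>j<n. \<bar>x i - x j\<bar> * \<bar>y i - y j\<bar>)"
    by (intro sum.cong) auto
  then show ?thesis by (simp add: Omega_n_def ucov_def Let_def)
qed

text \<open>The coefficients 1/4, 1/4 and 1/24 of the kernel are those of the statistic itself at
  sample size 4, so facts on \<open>ucov\<close> serve for both.\<close>

lemma h4_eq_ucov: "h4 x y = ucov 4 (\<lambda>i j. \<bar>x i - x j\<bar>) (\<lambda>i j. \<bar>y i - y j\<bar>)"
proof -
  have 1: "(\<Sum>i<4. \<Sum>j<4. if i \<noteq> j then \<bar>x i - x j\<bar> * \<bar>y i - y j\<bar> else 0) = (\<Sum>i<4. \<Sum>j<4. \<bar>x i - x j\<bar> * \<bar>y i - y j\<bar>)"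
    by (intro sum.cong) auto
  have 2: "(\<Sum>j<4. if j \<noteq> i then \<bar>z i - z j\<bar> else 0) = (\<Sum>j<4. \<bar>z i - z j\<bar>)" for z :: "nat \<Rightarrow> real" and i
    by (intro sum.cong) auto
  have 3: "(\<Sum>j<4. if i \<noteq> j then \<bar>z i - z j\<bar> else 0) = (\<Sum>j<4. \<bar>z i - z j\<bar>)" for z :: "nat \<Rightarrow> real" and i
    by (intro sum.cong) auto
  show ?thesis unfolding h4_def ucov_def 1 2 3 by simp
qed

text \<open>The statistic does not see additive perturbations of the off-diagonal distances, so that
  distances can be replaced by doubly centred ones.\<close>

lemma ucov_additive_left:
  assumes n: "n \<ge> 4" and b0: "\<And>i. b i i = 0" and bs: "\<And>i j. b i j = b j i"
  shows "ucov n (\<lambda>i j. a i j + (if i \<noteq> j then g i + g j else 0)) b = ucov n a b"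
proof -
  define G where "G = (\<Sum>j<n. g j)"
  define br where "br i = (\<Sum>j<n. b i j)" for i
  define sb where "sb = (\<Sum>i<n. br i)"
  define S where "S = (\<Sum>i<n. g i * br i)"
  have row: "(\<Sum>j<n. if i \<noteq> j then g i + g j else 0) = (real n - 2) * g i + G" if "i < n" for i
  proof -
    have "(\<Sum>j<n. if i \<noteq> j then g i + g j else 0) = (\<Sum>j<n. (g i + g j) - (if i = j then 2 * g i else 0))"
      by (intro sum.cong) auto
    also have "\<dots> = real n * g i + G - 2 * g i"
      unfolding sum_subtractf sum.distrib G_def using that by simp
    finally show ?thesis by (simp add: algebra_simps)
  qed
  have "(\<Sum>i<n. \<Sum>j<n. (if i \<noteq> j then g i + g j else 0) * b i j) = (\<Sum>i<n. \<Sum>j<n. g i * b i j + g j * b j i)"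
    by (intro sum.cong) (auto simp: b0 bs algebra_simps)
  also have "\<dots> = (\<Sum>i<n. \<Sum>j<n. g i * b i j) + (\<Sum>i<n. \<Sum>j<n. g j * b j i)"
    by (simp add: sum.distrib)
  also have "(\<Sum>i<n. \<Sum>j<n. g j * b j i) = (\<Sum>j<n. \<Sum>i<n. g j * b j i)" by (rule sum.swap)
  finally have 1: "(\<Sum>i<n. \<Sum>j<n. (if i \<noteq> j then g i + g j else 0) * b i j) = 2 * S"
    by (simp add: S_def br_def sum_distrib_left)
  have 2: "(\<Sum>i<n. (\<Sum>j<n. if i \<noteq> j then g i + g j else 0) * br i) = (real n - 2) * S + G * sb"
  proof -
    have "(\<Sum>i<n. (\<Sum>j<n. if i \<noteq> j then g i + g j else 0) * br i) = (\<Sum>i<n. (real n - 2) * (g i * br i) + G * br i)"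
      by (intro sum.cong) (auto simp: row distrib_right)
    then show ?thesis by (simp add: S_def sb_def sum.distrib sum_distrib_left)
  qed
  have 3: "(\<Sum>i<n. \<Sum>j<n. if i \<noteq> j then g i + g j else 0) = 2 * (real n - 1) * G"
  proof -
    have "(\<Sum>i<n. \<Sum>j<n. if i \<noteq> j then g i + g j else 0) = (\<Sum>i<n. (real n - 2) * g i + G)"
      by (intro sum.cong) (auto simp: row)
    also have "\<dots> = (real n - 2) * G + real n * G"
      by (simp add: sum.distrib G_def sum_distrib_left)
    finally show ?thesis by (simp add: algebra_simps)
  qed
  have nz: "real n \<noteq> 0" "real n - 1 \<noteq> 0" "real n - 2 \<noteq> 0" "real n - 3 \<noteq> 0" using n by auto
  have lin: "(p + s) / d - k * (q + t) + (r + w) / e = (p / d - k * q + r / e) + (s / d - k * t + w / e)" for p q r s t w d e k :: real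
    by (simp add: add_divide_distrib algebra_simps)
  have "ucov n (\<lambda>i j. a i j + (if i \<noteq> j then g i + g j else 0)) b =
    ucov n a b + (2 * S / (real n * (real n - 3)) - 2 / (real n * (real n - 2) * (real n - 3)) * ((real n - 2) * S + G * sb)
      + 2 * (real n - 1) * G * sb / (real n * (real n - 1) * (real n - 2) * (real n - 3)))"
    by (simp only: ucov_def distrib_right sum.distrib 1 2[unfolded br_def] 3 lin sb_def br_def)
  \<comment> \<open>The \<open>S\<close> terms of the first two sums cancel, and so do the
    \<open>G * sb\<close> terms of the last two; this is what the normalising constants of the
    statistic are made for.\<close>
  also have "2 * S / (real n * (real n - 3)) - 2 / (real n * (real n - 2) * (real n - 3)) * ((real n - 2) * S + G * sb)
      + 2 * (real n - 1) * G * sb / (real n * (real n - 1) * (real n - 2) * (real n - 3)) = 0"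
    using nz by (simp add: divide_simps)
  finally show ?thesis by simp
qed

lemma ucov_centered:
  assumes n: "n \<ge> 4" and a0: "\<And>i. a i i = 0" and as: "\<And>i j. a i j = a j i"
    and b0: "\<And>i. b i i = 0" and bs: "\<And>i j. b i j = b j i"
  shows "ucov n a b = ucov n (\<lambda>i j. if i = j then 0 else a i j - f i - f j + c) (\<lambda>i j. if i = j then 0 else b i j - g i - g j + d)"
proof -
  \<comment> \<open>Half of the constant goes to each of the two indices, so that
    \<open>f' i + f' j\<close> equals \<open>f i + f j - c\<close>.\<close>
  define f' where "f' i = f i - c / 2" for i
  define g' where "g' i = g i - d / 2" for i
  let ?A = "\<lambda>i j. if i = j then 0 else a i j - f i - f j + c" and ?B = "\<lambda>i j. if i = j then 0 else b i j - g i - g j + d"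
  have "ucov n a b = ucov n (\<lambda>i j. ?A i j + (if i \<noteq> j then f' i + f' j else 0)) b"
    by (intro ucov_cong) (auto simp: a0 f'_def)
  also have "\<dots> = ucov n ?A b" by (rule ucov_additive_left[OF n b0 bs])
  also have "\<dots> = ucov n b ?A" by (rule ucov_commute)
  also have "\<dots> = ucov n (\<lambda>i j. ?B i j + (if i \<noteq> j then g' i + g' j else 0)) ?A"
    by (intro ucov_cong) (auto simp: b0 g'_def)
  also have "\<dots> = ucov n ?B ?A" by (rule ucov_additive_left[OF n]) (auto simp: as)
  also have "\<dots> = ucov n ?A ?B" by (rule ucov_commute)
  finally show ?thesis .
qed

lemma nrm2_prob_abs_le:
  assumes "prob_space M" and f: "f \<in> L2 M"
  shows "(\<integral>x. \<bar>f x\<bar> \<partial>M) \<le> sqrt (nrm2 M f)"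
proof -
  interpret prob_space M by fact
  have "(\<lambda>x. \<bar>f x\<bar>) \<in> L2 M" "(\<lambda>_. 1) \<in> L2 M" using f by (auto simp: L2_def)
  from Cauchy_Schwarz_L2[OF this] have "(\<integral>x. \<bar>f x\<bar> \<partial>M)\<^sup>2 \<le> nrm2 M f"
    by (simp add: ip_def prob_space)
  then show ?thesis by (rule real_le_rsqrt)
qed

lemma sum_pair_index: "(\<Sum>i<n. \<Sum>k<n. if i = k then a else b) = real n * a + real n * (real n - 1) * (b::real)"
proof -
  have "(\<Sum>k<n. if i = k then a else b) = a + (real n - 1) * b" if "i < n" for i
  proof -
    have "(\<Sum>k<n. if i = k then a else b) = (\<Sum>k<n. b + (if i = k then a - b else 0))" by (intro sum.cong) auto
    then show ?thesis using that by (simp add: sum.distrib algebra_simps)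
  qed
  then have "(\<Sum>i<n. \<Sum>k<n. if i = k then a else b) = (\<Sum>i<n. a + (real n - 1) * b)"
    by (intro sum.cong) auto
  then show ?thesis by (simp add: algebra_simps)
qed

lemma (in prob_space) diag_moment:
  assumes [measurable]: "f \<in> borel_measurable N" and f: "f \<in> L2 N"
    and ind: "indep_vars (\<lambda>_. N) U UNIV" and law: "\<And>j. distr M N (U j) = N" and N: "prob_space N"
  shows "has_bochner_integral M (\<lambda>\<omega>. f (U i \<omega>)) (\<integral>x. f x \<partial>N)"
    and "has_bochner_integral M (\<lambda>\<omega>. f (U i \<omega>) * f (U j \<omega>)) (if i = j then nrm2 N f else (\<integral>x. f x \<partial>N) * (\<integral>x. f x \<partial>N))"
proof -
  interpret N: prob_space N by fact
  have [measurable]: "U j \<in> measurable M N" for j using ind by (auto simp: indep_vars_def)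
  have int: "integrable N f" by (rule N.square_integrable_imp_integrable) (use f in \<open>auto simp: L2_def\<close>)
  have "has_bochner_integral (distr M N (U j)) f (\<integral>x. f x \<partial>N)" for j
    unfolding law using int by (simp add: has_bochner_integral_iff)
  then have b: "has_bochner_integral M (\<lambda>\<omega>. f (U j \<omega>)) (\<integral>x. f x \<partial>N)" for j
    by (simp add: has_bochner_integral_iff integrable_distr_eq integral_distr)
  show "has_bochner_integral M (\<lambda>\<omega>. f (U i \<omega>)) (\<integral>x. f x \<partial>N)" by (rule b)
  show "has_bochner_integral M (\<lambda>\<omega>. f (U i \<omega>) * f (U j \<omega>)) (if i = j then nrm2 N f else (\<integral>x. f x \<partial>N) * (\<integral>x. f x \<partial>N))"
  proof (cases "i = j")
    case True
    have "has_bochner_integral (distr M N (U j)) (\<lambda>x. f x * f x) (nrm2 N f)"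
      unfolding law using L2_integrable_mult[OF f f] by (simp add: has_bochner_integral_iff ip_def)
    then show ?thesis using True by (simp add: has_bochner_integral_iff integrable_distr_eq integral_distr)
  next
    case False
    have "indep_var borel (f \<circ> U i) borel (f \<circ> U j)"
      by (rule indep_var_compose[OF distr_pair_of_indep_vars(1)[OF ind False]]) auto
    then have i: "indep_var borel (\<lambda>\<omega>. f (U i \<omega>)) borel (\<lambda>\<omega>. f (U j \<omega>))" by (simp add: comp_def)
    from indep_var_integrable[OF i] indep_var_lebesgue_integral[OF i] b False
    show ?thesis by (simp add: has_bochner_integral_iff)
  qed
qed

section \<open>Comparison of the U-statistic and the V-statistic for one projection\<close>

locale independent_kernels =
  A: degenerate_kernel M N1 X A + B: degenerate_kernel M N2 Y B
  for M :: "'m measure" and N1 :: "'x measure" and X A and N2 :: "'y measure" and Y B +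
  assumes seq_indep: "\<And>(f :: (nat \<Rightarrow> 'x) \<Rightarrow> real) (g :: (nat \<Rightarrow> 'y) \<Rightarrow> real). f \<in> borel_measurable (\<Pi>\<^sub>M i\<in>UNIV. N1) \<Longrightarrow> g \<in> borel_measurable (\<Pi>\<^sub>M i\<in>UNIV. N2) \<Longrightarrow>
      prob_space.indep_var M borel (\<lambda>\<omega>. f (\<lambda>i. X i \<omega>)) borel (\<lambda>\<omega>. g (\<lambda>i. Y i \<omega>))"
    and A_diag: "(\<lambda>x. A (x, x)) \<in> L2 N1" and B_diag: "(\<lambda>y. B (y, y)) \<in> L2 N2"
begin

text \<open>This factorisation is what lets second moments of \<open>A\<close> and of
  \<open>B\<close> control second moments of products of the two kernels, with no fourth
  moments.\<close>

lemma indep_product: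
  fixes f :: "(nat \<Rightarrow> 'x) \<Rightarrow> real" and g :: "(nat \<Rightarrow> 'y) \<Rightarrow> real"
  assumes "f \<in> borel_measurable (\<Pi>\<^sub>M i\<in>UNIV. N1)" "g \<in> borel_measurable (\<Pi>\<^sub>M i\<in>UNIV. N2)"
    and "has_bochner_integral M (\<lambda>\<omega>. f (\<lambda>i. X i \<omega>)) a" "has_bochner_integral M (\<lambda>\<omega>. g (\<lambda>i. Y i \<omega>)) b"
  shows "has_bochner_integral M (\<lambda>\<omega>. f (\<lambda>i. X i \<omega>) * g (\<lambda>i. Y i \<omega>)) (a * b)"
proof -
  note i = seq_indep[OF assms(1,2)]
  show ?thesis
    using A.indep_var_integrable[OF i] A.indep_var_lebesgue_integral[OF i] assms(3,4)
    by (simp add: has_bochner_integral_iff)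
qed

abbreviation oA :: "nat \<Rightarrow> nat \<Rightarrow> 'm \<Rightarrow> real" where "oA i j \<omega> \<equiv> A.offdiag i j (\<lambda>m. X m \<omega>)"
abbreviation oB :: "nat \<Rightarrow> nat \<Rightarrow> 'm \<Rightarrow> real" where "oB i j \<omega> \<equiv> B.offdiag i j (\<lambda>m. Y m \<omega>)"
abbreviation \<alpha>\<beta> :: real where "\<alpha>\<beta> \<equiv> A.\<alpha> * B.\<alpha>"

lemma oA_measurable [measurable]: "oA i j \<in> borel_measurable M" using A.offdiag_L2[of i j] by measurable
lemma oB_measurable [measurable]: "oB i j \<in> borel_measurable M" using B.offdiag_L2[of i j] by measurable

text \<open>The first three are the sums that enter \<open>ucov\<close>; \<open>T4\<close> is the
  fluctuation of the diagonal of the V-statistic about its mean.\<close>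

definition T1 :: "nat \<Rightarrow> 'm \<Rightarrow> real" where "T1 n \<omega> = (\<Sum>i<n. \<Sum>j<n. oA i j \<omega> * oB i j \<omega>)"
definition T2 :: "nat \<Rightarrow> 'm \<Rightarrow> real" where "T2 n \<omega> = (\<Sum>i<n. (\<Sum>j<n. oA i j \<omega>) * (\<Sum>j<n. oB i j \<omega>))"
definition T3 :: "nat \<Rightarrow> 'm \<Rightarrow> real" where "T3 n \<omega> = (\<Sum>i<n. \<Sum>j<n. oA i j \<omega>) * (\<Sum>i<n. \<Sum>j<n. oB i j \<omega>)"
definition diag :: "nat \<Rightarrow> 'm \<Rightarrow> real" where "diag i \<omega> = A (X i \<omega>, X i \<omega>) * B (Y i \<omega>, Y i \<omega>)"
definition \<tau> :: real where "\<tau> = (\<integral>x. A (x, x) \<partial>N1) * (\<integral>y. B (y, y) \<partial>N2)"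
definition T4 :: "nat \<Rightarrow> 'm \<Rightarrow> real" where "T4 n \<omega> = (\<Sum>i<n. diag i \<omega> - \<tau>)"

lemma T_measurable [measurable]: "T1 n \<in> borel_measurable M" "T2 n \<in> borel_measurable M"
  "T3 n \<in> borel_measurable M" "T4 n \<in> borel_measurable M" "diag i \<in> borel_measurable M"
  unfolding T1_def T2_def T3_def T4_def diag_def by measurable

text \<open>Both kernels have the same matching condition on index pairs, and its indicator is
  idempotent, so the count is that for a single kernel.\<close>

lemma T1_moment: "has_bochner_integral M (\<lambda>\<omega>. T1 n \<omega> * T1 n \<omega>) (\<alpha>\<beta> * (2 * real n * (real n - 1)))"
proof -
  let ?d = "\<lambda>i j k l::nat. if i \<noteq> j \<and> {i, j} = {k, l} then 1 else 0 :: real"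
  have "has_bochner_integral M (\<lambda>\<omega>. \<Sum>i<n. \<Sum>k<n. \<Sum>j<n. \<Sum>l<n. (oA i j \<omega> * oA k l \<omega>) * (oB i j \<omega> * oB k l \<omega>))
     (\<Sum>i<n. \<Sum>k<n. \<Sum>j<n. \<Sum>l<n. (A.\<alpha> * ?d i j k l) * (B.\<alpha> * ?d i j k l))"
  proof (intro has_bochner_integral_sum)
    fix i j k l
    show "has_bochner_integral M (\<lambda>\<omega>. (oA i j \<omega> * oA k l \<omega>) * (oB i j \<omega> * oB k l \<omega>)) ((A.\<alpha> * ?d i j k l) * (B.\<alpha> * ?d i j k l))"
      by (rule indep_product[of "\<lambda>x. A.offdiag i j x * A.offdiag k l x" "\<lambda>y. B.offdiag i j y * B.offdiag k l y"])
        (rule A.offdiag_moment B.offdiag_moment | simp)+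
  qed
  moreover have "(\<Sum>i<n. \<Sum>k<n. \<Sum>j<n. \<Sum>l<n. (A.\<alpha> * ?d i j k l) * (B.\<alpha> * ?d i j k l)) = \<alpha>\<beta> * (2 * real n * (real n - 1))"
  proof -
    have "(\<Sum>j<n. \<Sum>l<n. (A.\<alpha> * ?d i j k l) * (B.\<alpha> * ?d i j k l)) = \<alpha>\<beta> * (if i = k then real n - 1 else 1)" if "i < n" "k < n" for i k
    proof -
      have "(\<Sum>j<n. \<Sum>l<n. (A.\<alpha> * ?d i j k l) * (B.\<alpha> * ?d i j k l)) = (\<Sum>j<n. \<Sum>l<n. \<alpha>\<beta> * ?d i j k l)"
        by (intro sum.cong) auto
      then show ?thesis by (simp only: pair_index_sum[OF that] sum_distrib_left[symmetric])
    qed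
    then have "(\<Sum>i<n. \<Sum>k<n. \<Sum>j<n. \<Sum>l<n. (A.\<alpha> * ?d i j k l) * (B.\<alpha> * ?d i j k l)) = (\<Sum>i<n. \<Sum>k<n. \<alpha>\<beta> * (if i = k then real n - 1 else 1))"
      by (intro sum.cong) auto
    then show ?thesis by (simp only: sum_distrib_left[symmetric] sum_pair_index) (simp add: algebra_simps)
  qed
  moreover have "(\<Sum>i<n. \<Sum>k<n. \<Sum>j<n. \<Sum>l<n. (oA i j \<omega> * oA k l \<omega>) * (oB i j \<omega> * oB k l \<omega>)) = T1 n \<omega> * T1 n \<omega>" for \<omega>
    unfolding T1_def sum_product by (intro sum.cong) (auto simp: mult_ac)
  ultimately show ?thesis by simp
qed

text \<open>Rows with the same index correlate with weight \<open>(n - 1)^2\<close> after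
  multiplication, distinct rows with weight 1; the total \<open>n (n - 1)^2 + n (n - 1)\<close> is
  \<open>n^2 (n - 1)\<close>.\<close>

lemma T2_moment: "has_bochner_integral M (\<lambda>\<omega>. T2 n \<omega> * T2 n \<omega>) (\<alpha>\<beta> * ((real n)\<^sup>2 * (real n - 1)))"
proof -
  have "has_bochner_integral M (\<lambda>\<omega>. \<Sum>i<n. \<Sum>k<n. ((\<Sum>j<n. oA i j \<omega>) * (\<Sum>j<n. oA k j \<omega>)) * ((\<Sum>j<n. oB i j \<omega>) * (\<Sum>j<n. oB k j \<omega>)))
     (\<Sum>i<n. \<Sum>k<n. (A.\<alpha> * (if i = k then real n - 1 else 1)) * (B.\<alpha> * (if i = k then real n - 1 else 1)))"
  proof (intro has_bochner_integral_sum)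
    fix i k assume "i \<in> {..<n}" "k \<in> {..<n}"
    then have "i < n" "k < n" by auto
    from indep_product[OF _ _ A.row_moment[OF this] B.row_moment[OF this]]
    show "has_bochner_integral M (\<lambda>\<omega>. ((\<Sum>j<n. oA i j \<omega>) * (\<Sum>j<n. oA k j \<omega>)) * ((\<Sum>j<n. oB i j \<omega>) * (\<Sum>j<n. oB k j \<omega>)))
      ((A.\<alpha> * (if i = k then real n - 1 else 1)) * (B.\<alpha> * (if i = k then real n - 1 else 1)))"
      by simp
  qed
  moreover have "(\<Sum>i<n. \<Sum>k<n. (A.\<alpha> * (if i = k then real n - 1 else 1)) * (B.\<alpha> * (if i = k then real n - 1 else 1))) = \<alpha>\<beta> * ((real n)\<^sup>2 * (real n - 1))"
  proof -
    have "(\<Sum>i<n. \<Sum>k<n. (A.\<alpha> * (if i = k then real n - 1 else 1)) * (B.\<alpha> * (if i = k then real n - 1 else 1)))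
      = (\<Sum>i<n. \<Sum>k<n. if i = k then \<alpha>\<beta> * (real n - 1)\<^sup>2 else \<alpha>\<beta>)"
      by (intro sum.cong) (auto simp: power2_eq_square)
    also have "\<dots> = \<alpha>\<beta> * ((real n)\<^sup>2 * (real n - 1))"
      unfolding sum_pair_index by (simp add: algebra_simps power2_eq_square)
    finally show ?thesis .
  qed
  moreover have "(\<Sum>i<n. \<Sum>k<n. ((\<Sum>j<n. oA i j \<omega>) * (\<Sum>j<n. oA k j \<omega>)) * ((\<Sum>j<n. oB i j \<omega>) * (\<Sum>j<n. oB k j \<omega>))) = T2 n \<omega> * T2 n \<omega>" for \<omega>
  proof -
    have "T2 n \<omega> * T2 n \<omega> = (\<Sum>i<n. \<Sum>k<n. ((\<Sum>j<n. oA i j \<omega>) * (\<Sum>j<n. oB i j \<omega>)) * ((\<Sum>j<n. oA k j \<omega>) * (\<Sum>j<n. oB k j \<omega>)))"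
      unfolding T2_def by (rule sum_product)
    then show ?thesis by (simp only: mult_ac)
  qed
  ultimately show ?thesis by simp
qed

lemma T3_moment: "has_bochner_integral M (\<lambda>\<omega>. T3 n \<omega> * T3 n \<omega>) (\<alpha>\<beta> * (2 * real n * (real n - 1))\<^sup>2)"
proof -
  have "has_bochner_integral M (\<lambda>\<omega>. ((\<Sum>i<n. \<Sum>j<n. oA i j \<omega>) * (\<Sum>i<n. \<Sum>j<n. oA i j \<omega>)) * ((\<Sum>i<n. \<Sum>j<n. oB i j \<omega>) * (\<Sum>i<n. \<Sum>j<n. oB i j \<omega>)))
     ((A.\<alpha> * (2 * real n * (real n - 1))) * (B.\<alpha> * (2 * real n * (real n - 1))))"
    by (rule indep_product[OF _ _ A.total_moment B.total_moment]) simp_all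
  then show ?thesis by (simp add: T3_def[abs_def] power2_eq_square mult_ac)
qed

text \<open>The variance of one term \<open>diag i\<close>, whose second moment factors by
  independence and whose mean is \<open>\<tau>\<close>.\<close>

definition \<sigma>2 :: real where "\<sigma>2 = nrm2 N1 (\<lambda>x. A (x, x)) * nrm2 N2 (\<lambda>y. B (y, y)) - \<tau> * \<tau>"

lemma T4_moment: "has_bochner_integral M (\<lambda>\<omega>. T4 n \<omega> * T4 n \<omega>) (\<sigma>2 * real n)"
proof -
  note a = A.diag_moment[OF L2_measurable[OF A_diag] A_diag A.X_indep A.X_law A.prob_N]
  note b = A.diag_moment[OF L2_measurable[OF B_diag] B_diag B.X_indep B.X_law B.prob_N]
  note [measurable] = L2_measurable[OF A_diag] L2_measurable[OF B_diag]
  have m: "(\<lambda>x. A (x i, x i)) \<in> borel_measurable (\<Pi>\<^sub>M i\<in>UNIV. N1)" "(\<lambda>y. B (y i, y i)) \<in> borel_measurable (\<Pi>\<^sub>M i\<in>UNIV. N2)" for i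
    by measurable
  have d1: "has_bochner_integral M (diag i) \<tau>" for i
    using indep_product[OF m a(1) b(1)] by (simp add: diag_def[abs_def] \<tau>_def)
  have d2: "has_bochner_integral M (\<lambda>\<omega>. diag i \<omega> * diag j \<omega>) (if i = j then \<sigma>2 + \<tau> * \<tau> else \<tau> * \<tau>)" for i j
  proof -
    have "has_bochner_integral M (\<lambda>\<omega>. (A (X i \<omega>, X i \<omega>) * A (X j \<omega>, X j \<omega>)) * (B (Y i \<omega>, Y i \<omega>) * B (Y j \<omega>, Y j \<omega>)))
      ((if i = j then nrm2 N1 (\<lambda>x. A (x, x)) else (\<integral>x. A (x, x) \<partial>N1) * (\<integral>x. A (x, x) \<partial>N1)) *
       (if i = j then nrm2 N2 (\<lambda>y. B (y, y)) else (\<integral>y. B (y, y) \<partial>N2) * (\<integral>y. B (y, y) \<partial>N2)))"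
    proof (rule indep_product[of "\<lambda>x. A (x i, x i) * A (x j, x j)" "\<lambda>y. B (y i, y i) * B (y j, y j)"])
      show "(\<lambda>x. A (x i, x i) * A (x j, x j)) \<in> borel_measurable (\<Pi>\<^sub>M i\<in>UNIV. N1)"
        "(\<lambda>y. B (y i, y i) * B (y j, y j)) \<in> borel_measurable (\<Pi>\<^sub>M i\<in>UNIV. N2)"
        by (intro borel_measurable_times m)+
    qed (rule a(2) b(2))+
    moreover have "(if i = j then nrm2 N1 (\<lambda>x. A (x, x)) else (\<integral>x. A (x, x) \<partial>N1) * (\<integral>x. A (x, x) \<partial>N1)) *
       (if i = j then nrm2 N2 (\<lambda>y. B (y, y)) else (\<integral>y. B (y, y) \<partial>N2) * (\<integral>y. B (y, y) \<partial>N2)) = (if i = j then \<sigma>2 + \<tau> * \<tau> else \<tau> * \<tau>)"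
      by (simp add: \<sigma>2_def \<tau>_def)
    moreover have "(A (X i \<omega>, X i \<omega>) * A (X j \<omega>, X j \<omega>)) * (B (Y i \<omega>, Y i \<omega>) * B (Y j \<omega>, Y j \<omega>)) = diag i \<omega> * diag j \<omega>" for \<omega>
      by (simp add: diag_def)
    ultimately show ?thesis by simp
  qed
  have one: "has_bochner_integral M (\<lambda>\<omega>. \<tau> * \<tau>) (\<tau> * \<tau>)"
    by (simp add: has_bochner_integral_iff A.prob_space)
  have "has_bochner_integral M (\<lambda>\<omega>. (diag i \<omega> * diag j \<omega> - \<tau> * diag i \<omega>) - (\<tau> * diag j \<omega> - \<tau> * \<tau>))
     (((if i = j then \<sigma>2 + \<tau> * \<tau> else \<tau> * \<tau>) - \<tau> * \<tau>) - (\<tau> * \<tau> - \<tau> * \<tau>))" for i j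
    by (intro has_bochner_integral_diff has_bochner_integral_mult_right d1 d2 one)
  moreover have "((if i = j then \<sigma>2 + \<tau> * \<tau> else \<tau> * \<tau>) - \<tau> * \<tau>) - (\<tau> * \<tau> - \<tau> * \<tau>) = (if i = j then \<sigma>2 else 0)" for i j :: nat
    by simp
  moreover have "(diag i \<omega> * diag j \<omega> - \<tau> * diag i \<omega>) - (\<tau> * diag j \<omega> - \<tau> * \<tau>) = (diag i \<omega> - \<tau>) * (diag j \<omega> - \<tau>)" for i j \<omega>
    by (simp add: algebra_simps)
  ultimately have c: "has_bochner_integral M (\<lambda>\<omega>. (diag i \<omega> - \<tau>) * (diag j \<omega> - \<tau>)) (if i = j then \<sigma>2 else 0)" for i j
    by (simp only:)
  have "has_bochner_integral M (\<lambda>\<omega>. \<Sum>i<n. \<Sum>j<n. (diag i \<omega> - \<tau>) * (diag j \<omega> - \<tau>)) (\<Sum>i<n. \<Sum>j<n. if i = j then \<sigma>2 else 0)"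
    by (intro has_bochner_integral_sum c)
  then show ?thesis by (simp add: T4_def sum_product mult.commute)
qed

text \<open>The error, for one projection, of replacing \<open>n\<close> times the U-statistic by
  the V-statistic minus its mean.\<close>

definition remainder :: "nat \<Rightarrow> 'm \<Rightarrow> real" where
  "remainder n \<omega> = real n * ucov n (\<lambda>i j. oA i j \<omega>) (\<lambda>i j. oB i j \<omega>) + \<tau>
     - (\<Sum>i<n. \<Sum>j<n. A (X i \<omega>, X j \<omega>) * B (Y i \<omega>, Y j \<omega>)) / real n"

lemma remainder_eq:
  assumes n: "n \<ge> 4"
  shows "remainder n \<omega> = ((3 / (real n * (real n - 3))) * T1 n \<omega> + (- 2 / ((real n - 2) * (real n - 3))) * T2 n \<omega>)
    + ((1 / ((real n - 1) * (real n - 2) * (real n - 3))) * T3 n \<omega> + (- 1 / real n) * T4 n \<omega>)"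
proof -
  have nz: "real n \<noteq> 0" "real n - 1 \<noteq> 0" "real n - 2 \<noteq> 0" "real n - 3 \<noteq> 0" using n by auto
  have "(\<Sum>i<n. \<Sum>j<n. A (X i \<omega>, X j \<omega>) * B (Y i \<omega>, Y j \<omega>)) = (\<Sum>i<n. \<Sum>j<n. oA i j \<omega> * oB i j \<omega> + (if j = i then diag i \<omega> else 0))"
    by (intro sum.cong) (auto simp: A.offdiag_def B.offdiag_def diag_def)
  also have "\<dots> = T1 n \<omega> + (\<Sum>i<n. diag i \<omega>)" by (simp add: sum.distrib T1_def)
  also have "(\<Sum>i<n. diag i \<omega>) = T4 n \<omega> + real n * \<tau>" by (simp add: T4_def sum_subtractf)
  finally have V: "(\<Sum>i<n. \<Sum>j<n. A (X i \<omega>, X j \<omega>) * B (Y i \<omega>, Y j \<omega>)) = T1 n \<omega> + (T4 n \<omega> + real n * \<tau>)" .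
  have scale: "m * (a / (m * d) - 2 / (m * p * d) * b + c / (m * q * p * d)) = a / d - 2 / (p * d) * b + c / (q * p * d)"
    if "m \<noteq> 0" "q \<noteq> 0" "p \<noteq> 0" "d \<noteq> 0" for a b c d m p q :: real
    using that by (simp add: field_simps)
  have U: "real n * ucov n (\<lambda>i j. oA i j \<omega>) (\<lambda>i j. oB i j \<omega>) = T1 n \<omega> / (real n - 3) - 2 / ((real n - 2) * (real n - 3)) * T2 n \<omega>
    + T3 n \<omega> / ((real n - 1) * (real n - 2) * (real n - 3))"
    unfolding ucov_def T1_def[symmetric] T2_def[symmetric] T3_def[symmetric]
    using scale[OF nz] .
  \<comment> \<open>The coefficient of \<open>T1\<close> is \<open>1 / (n - 3)\<close> from the
    U-statistic minus \<open>1 / n\<close> from the V-statistic; this cancellation gains an order of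
    \<open>n\<close>.\<close>
  have c: "3 / (real n * (real n - 3)) = 1 / (real n - 3) - 1 / real n" using nz by (simp add: field_simps)
  show ?thesis unfolding remainder_def V U c using nz
    by (simp add: algebra_simps add_divide_distrib diff_divide_distrib)
qed

lemmas remainder_fun_eq = ext[of "remainder n" for n, OF remainder_eq]

lemma T_L2: "T1 n \<in> L2 M" "T2 n \<in> L2 M" "T3 n \<in> L2 M" "T4 n \<in> L2 M"
  using T1_moment[of n] T2_moment[of n] T3_moment[of n] T4_moment[of n]
  by (auto simp: L2_iff has_bochner_integral_iff)

lemma remainder_L2: "n \<ge> 4 \<Longrightarrow> remainder n \<in> L2 M"
  unfolding remainder_fun_eq by (intro L2_add L2_cmult T_L2)

text \<open>The second moments of \<open>T1\<close> to \<open>T4\<close> grow like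
  \<open>n^2\<close>, \<open>n^3\<close>, \<open>n^4\<close>, \<open>n\<close>, and their squared
  coefficients decay like \<open>n^-4\<close>, \<open>n^-4\<close>, \<open>n^-6\<close>,
  \<open>n^-2\<close>, so the second moment of the remainder is of order \<open>1/n\<close>.\<close>

lemma remainder_tendsto: "(\<lambda>n. \<integral>\<omega>. \<bar>remainder n \<omega>\<bar> \<partial>M) \<longlonglongrightarrow> 0"
proof -
  define bnd where "bnd x = 4 * ((3 / (x * (x - 3)))\<^sup>2 * (\<alpha>\<beta> * (2 * x * (x - 1))) + (- 2 / ((x - 2) * (x - 3)))\<^sup>2 * (\<alpha>\<beta> * (x\<^sup>2 * (x - 1)))
    + (1 / ((x - 1) * (x - 2) * (x - 3)))\<^sup>2 * (\<alpha>\<beta> * (2 * x * (x - 1))\<^sup>2) + (- 1 / x)\<^sup>2 * (\<sigma>2 * x))" for x :: real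
  have lim: "(bnd \<longlongrightarrow> 0) at_top"   proof -
    have "((\<lambda>x::real. (3 / (x * (x - 3)))\<^sup>2 * (2 * x * (x - 1))) \<longlongrightarrow> 0) at_top"
      "((\<lambda>x::real. (- 2 / ((x - 2) * (x - 3)))\<^sup>2 * (x\<^sup>2 * (x - 1))) \<longlongrightarrow> 0) at_top"
      "((\<lambda>x::real. (1 / ((x - 1) * (x - 2) * (x - 3)))\<^sup>2 * (2 * x * (x - 1))\<^sup>2) \<longlongrightarrow> 0) at_top"
      "((\<lambda>x::real. (- 1 / x)\<^sup>2 * x) \<longlongrightarrow> 0) at_top"
      by real_asymp+
    then have "((\<lambda>x. 4 * (\<alpha>\<beta> * ((3 / (x * (x - 3)))\<^sup>2 * (2 * x * (x - 1))) + \<alpha>\<beta> * ((- 2 / ((x - 2) * (x - 3)))\<^sup>2 * (x\<^sup>2 * (x - 1)))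
      + \<alpha>\<beta> * ((1 / ((x - 1) * (x - 2) * (x - 3)))\<^sup>2 * (2 * x * (x - 1))\<^sup>2) + \<sigma>2 * ((- 1 / x)\<^sup>2 * x))) \<longlongrightarrow> 4 * (\<alpha>\<beta> * 0 + \<alpha>\<beta> * 0 + \<alpha>\<beta> * 0 + \<sigma>2 * 0)) at_top"
      by (intro tendsto_add tendsto_mult tendsto_const)
    moreover have "bnd = (\<lambda>x. 4 * (\<alpha>\<beta> * ((3 / (x * (x - 3)))\<^sup>2 * (2 * x * (x - 1))) + \<alpha>\<beta> * ((- 2 / ((x - 2) * (x - 3)))\<^sup>2 * (x\<^sup>2 * (x - 1)))
      + \<alpha>\<beta> * ((1 / ((x - 1) * (x - 2) * (x - 3)))\<^sup>2 * (2 * x * (x - 1))\<^sup>2) + \<sigma>2 * ((- 1 / x)\<^sup>2 * x)))"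
      by (rule ext) (simp only: bnd_def mult.left_commute)
    ultimately show ?thesis by (simp only: mult_zero_right add_0_right)
  qed
  have lim': "(\<lambda>n. sqrt (bnd (real n))) \<longlonglongrightarrow> 0"
    using tendsto_real_sqrt[OF filterlim_compose[OF lim filterlim_real_sequentially]] by simp
  have nT: "nrm2 M (T1 n) = \<alpha>\<beta> * (2 * real n * (real n - 1))" "nrm2 M (T2 n) = \<alpha>\<beta> * ((real n)\<^sup>2 * (real n - 1))"
    "nrm2 M (T3 n) = \<alpha>\<beta> * (2 * real n * (real n - 1))\<^sup>2" "nrm2 M (T4 n) = \<sigma>2 * real n" for n
    using T1_moment[of n] T2_moment[of n] T3_moment[of n] T4_moment[of n] by (auto simp: ip_def has_bochner_integral_iff)
  have le: "(\<integral>\<omega>. \<bar>remainder n \<omega>\<bar> \<partial>M) \<le> sqrt (bnd (real n))" if n: "n \<ge> 4" for n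
  proof -
    \<comment> \<open>The factor 4 comes from using the two-term bound \<open>nrm2_add_le\<close>
      twice; no covariances between the four sums are needed.\<close>
    have 4: "nrm2 M (\<lambda>\<omega>. (a * T1 n \<omega> + b * T2 n \<omega>) + (c * T3 n \<omega> + d * T4 n \<omega>))
      \<le> 4 * (a\<^sup>2 * nrm2 M (T1 n) + b\<^sup>2 * nrm2 M (T2 n) + c\<^sup>2 * nrm2 M (T3 n) + d\<^sup>2 * nrm2 M (T4 n))" for a b c d
    proof -
      note L = L2_cmult[OF T_L2(1), of a n] L2_cmult[OF T_L2(2), of b n] L2_cmult[OF T_L2(3), of c n] L2_cmult[OF T_L2(4), of d n]
      have "nrm2 M (\<lambda>\<omega>. (a * T1 n \<omega> + b * T2 n \<omega>) + (c * T3 n \<omega> + d * T4 n \<omega>))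
        \<le> 2 * nrm2 M (\<lambda>\<omega>. a * T1 n \<omega> + b * T2 n \<omega>) + 2 * nrm2 M (\<lambda>\<omega>. c * T3 n \<omega> + d * T4 n \<omega>)"
        by (intro nrm2_add_le L2_add L)
      also have "\<dots> \<le> 2 * (2 * nrm2 M (\<lambda>\<omega>. a * T1 n \<omega>) + 2 * nrm2 M (\<lambda>\<omega>. b * T2 n \<omega>)) + 2 * (2 * nrm2 M (\<lambda>\<omega>. c * T3 n \<omega>) + 2 * nrm2 M (\<lambda>\<omega>. d * T4 n \<omega>))"
        by (intro add_mono mult_left_mono nrm2_add_le L) auto
      finally show ?thesis by (simp add: ip_cmult_left ip_cmult_right power2_eq_square algebra_simps)
    qed
    have "nrm2 M (remainder n) \<le> bnd (real n)"
      unfolding remainder_fun_eq[OF n] bnd_def nT[symmetric] by (rule 4)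
    then show ?thesis
      using nrm2_prob_abs_le[OF A.prob_space_axioms remainder_L2[OF n]] by (meson order_trans real_sqrt_le_mono)
  qed
  show ?thesis
    by (rule tendsto_sandwich[OF _ _ tendsto_const lim'])
      (auto intro!: eventually_sequentiallyI[of 4] le)
qed

end

section \<open>Doubly centred distances\<close>

text \<open>The signed indicator of the interval between \<open>a\<close> and \<open>b\<close>. A
  half-line indicator is not square integrable, but the difference of two is, and its squared norm
  is the distance.\<close>

definition step_diff :: "real \<Rightarrow> real \<Rightarrow> real \<Rightarrow> real" where
  "step_diff a b r = (if a \<le> r then 1 else 0) - (if b \<le> r then 1 else 0)"

lemma step_diff_measurable [measurable]: "step_diff a b \<in> borel_measurable borel"
  unfolding step_diff_def by measurable

lemma has_bochner_integral_step_diff_square: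
  "has_bochner_integral lborel (\<lambda>r. step_diff a b r * step_diff a b r) \<bar>a - b\<bar>"
proof -
  have "(\<lambda>r. step_diff a b r * step_diff a b r) = indicator {min a b..<max a b}"
    by (auto simp: step_diff_def fun_eq_iff split: split_indicator)
  moreover have "has_bochner_integral lborel (indicator {min a b..<max a b}) (measure lborel {min a b..<max a b})"
    by (rule has_bochner_integral_real_indicator) auto
  ultimately show ?thesis by (auto simp: min_def max_def)
qed

lemma step_diff_L2: "step_diff a b \<in> L2 lborel"
  using has_bochner_integral_step_diff_square[of a b] by (simp add: L2_iff has_bochner_integral_iff)

text \<open>Polarisation: the product of two differences of indicators is half a signed sum of four
  squares of such differences, each of which integrates to a distance.\<close>

lemma ip_step_diff:
  "ip lborel (step_diff a b) (step_diff c d) = (\<bar>a - d\<bar> + \<bar>b - c\<bar> - \<bar>a - c\<bar> - \<bar>b - d\<bar>) / 2"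
proof -
  have e: "step_diff a b r * step_diff c d r = (step_diff a d r * step_diff a d r + step_diff b c r * step_diff b c r
     - step_diff a c r * step_diff a c r - step_diff b d r * step_diff b d r) / 2" for r
    by (simp add: step_diff_def)
  have "has_bochner_integral lborel (\<lambda>r. (step_diff a d r * step_diff a d r + step_diff b c r * step_diff b c r
     - step_diff a c r * step_diff a c r - step_diff b d r * step_diff b d r) / 2) ((\<bar>a - d\<bar> + \<bar>b - c\<bar> - \<bar>a - c\<bar> - \<bar>b - d\<bar>) / 2)"
    by (intro has_bochner_integral_divide_zero has_bochner_integral_diff has_bochner_integral_add has_bochner_integral_step_diff_square)
  then show ?thesis unfolding ip_def e by (rule has_bochner_integral_integral_eq)
qed

lemma L2_abs: "f \<in> L2 M \<Longrightarrow> (\<lambda>x. \<bar>f x\<bar>) \<in> L2 M"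
  by (auto simp: L2_def)

section \<open>Double centring of a square integrable projection\<close>

locale centered_distance = prob_space N
  for N :: "'x measure" +
  fixes p :: "'x \<Rightarrow> real"
  assumes p_L2: "p \<in> L2 N"
begin

lemma p_measurable [measurable]: "p \<in> borel_measurable N"
  using p_L2 by measurable

lemma one_L2: "(\<lambda>_. 1) \<in> L2 N"
  by (simp add: L2_def)

lemma L2_integrable: "f \<in> L2 N \<Longrightarrow> integrable N f"
  using L2_integrable_mult[OF _ one_L2] by simp

lemma dist_L2: "(\<lambda>y. \<bar>a - p y\<bar>) \<in> L2 N"
  using L2_cmult[OF one_L2, of a] by (intro L2_abs L2_diff p_L2) simp

definition mdist :: "'x \<Rightarrow> real" where "mdist x = (\<integral>y. \<bar>p x - p y\<bar> \<partial>N)"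
definition mmdist :: real where "mmdist = (\<integral>x. mdist x \<partial>N)"
definition A :: "'x \<times> 'x \<Rightarrow> real" where
  "A = (\<lambda>(x, y). \<bar>p x - p y\<bar> - mdist x - mdist y + mmdist)"

lemma mdist_measurable [measurable]: "mdist \<in> borel_measurable N"
  unfolding mdist_def by measurable

lemma mdist_L2: "mdist \<in> L2 N"
proof -
  define m where "m = (\<integral>y. \<bar>p y\<bar> \<partial>N)"
  have ip: "integrable N (\<lambda>y. \<bar>p y\<bar>)" by (intro L2_integrable L2_abs p_L2)
  have le: "mdist x \<le> \<bar>p x\<bar> + m" and nn: "0 \<le> mdist x" for x
  proof -
    have "mdist x \<le> (\<integral>y. \<bar>p x\<bar> + \<bar>p y\<bar> \<partial>N)"
      unfolding mdist_def by (rule integral_mono[OF L2_integrable[OF dist_L2]]) (use ip in auto)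
    then show "mdist x \<le> \<bar>p x\<bar> + m" using ip by (simp add: m_def prob_space)
    show "0 \<le> mdist x" by (simp add: mdist_def)
  qed
  have b: "(\<lambda>x. \<bar>p x\<bar> + m * 1) \<in> L2 N" by (intro L2_intros L2_abs p_L2 one_L2)
  have "integrable N (\<lambda>x. (\<bar>p x\<bar> + m * 1)\<^sup>2)" using b by (simp add: L2_def)
  then have "integrable N (\<lambda>x. (mdist x)\<^sup>2)"
    by (rule Bochner_Integration.integrable_bound) (use le nn in \<open>auto intro!: power_mono\<close>)
  then show ?thesis by (simp add: L2_def)
qed

lemma A_sym: "A (x, y) = A (y, x)"
  by (simp add: A_def abs_minus_commute)

lemma A_degenerate: "(\<integral>y. A (x, y) \<partial>N) = 0"
proof -
  have "(\<integral>y. A (x, y) \<partial>N) = (\<integral>y. \<bar>p x - p y\<bar> \<partial>N) - mdist x - (\<integral>y. mdist y \<partial>N) + mmdist"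
    unfolding A_def using L2_integrable[OF dist_L2] L2_integrable[OF mdist_L2] by (simp add: prob_space)
  then show ?thesis by (simp add: mdist_def[symmetric] mmdist_def)
qed

lemma A_L2: "A \<in> L2 (N \<Otimes>\<^sub>M N)"
proof -
  note sf = sigma_finite_measure_axioms
  have "(\<lambda>q. \<bar>tensor p (\<lambda>_. 1) q - tensor (\<lambda>_. 1) p q\<bar> - tensor mdist (\<lambda>_. 1) q - tensor (\<lambda>_. 1) mdist q + mmdist * tensor (\<lambda>_. 1) (\<lambda>_. 1) q) \<in> L2 (N \<Otimes>\<^sub>M N)"
    by (intro L2_add L2_diff L2_abs L2_cmult tensor_L2 sf one_L2 p_L2 mdist_L2)
  then show ?thesis by (simp add: A_def tensor_def split_def)
qed

lemma A_diag_L2: "(\<lambda>x. A (x, x)) \<in> L2 N"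
proof -
  have "(\<lambda>x. mmdist * 1 - 2 * mdist x) \<in> L2 N" by (intro L2_intros one_L2 mdist_L2)
  then show ?thesis by (simp add: A_def)
qed

text \<open>On the diagonal the distance is 0, which leaves \<open>mmdist - 2 * mdist x\<close>. The
  negative sign disappears once two such traces are multiplied.\<close>

lemma A_trace: "(\<integral>x. A (x, x) \<partial>N) = - mmdist"
  unfolding A_def using L2_integrable[OF mdist_L2] by (simp add: prob_space mmdist_def)

text \<open>\<open>feat x r\<close> is the centred indicator of \<open>p x \<le> r\<close>; centred distances are \<open>-2\<close> times the
  Gram kernel of these indicators, since \<open>\<bar>a - b\<bar>\<close> is the integral of the squared difference of two indicators.\<close>

definition feat :: "'x \<Rightarrow> real \<Rightarrow> real" where
  "feat x r = (\<integral>a. step_diff (p x) (p a) r \<partial>N)"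

text \<open>By Tonelli the squared norm is the mean distance from \<open>x\<close>, which is finite.
  This allows the integrals over \<open>a\<close> and \<open>r\<close> to be exchanged when
  \<open>feat\<close> is paired with other functions.\<close>

lemma step_kernel_L2: "(\<lambda>(a, r). step_diff (p x) (p a) r) \<in> L2 (N \<Otimes>\<^sub>M lborel)"
proof (rule L2_bound_nn(1))
  show m[measurable]: "(\<lambda>(a, r). step_diff (p x) (p a) r) \<in> borel_measurable (N \<Otimes>\<^sub>M lborel)"
    unfolding step_diff_def by measurable
  have "(\<integral>\<^sup>+q. ennreal ((case q of (a, r) \<Rightarrow> step_diff (p x) (p a) r) * (case q of (a, r) \<Rightarrow> step_diff (p x) (p a) r)) \<partial>(N \<Otimes>\<^sub>M lborel))
    = (\<integral>\<^sup>+a. \<integral>\<^sup>+r. ennreal (step_diff (p x) (p a) r * step_diff (p x) (p a) r) \<partial>lborel \<partial>N)"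
    by (subst lborel.nn_integral_fst[symmetric]) (auto simp: split_def)
  also have "\<dots> = (\<integral>\<^sup>+a. ennreal \<bar>p x - p a\<bar> \<partial>N)"
    using has_bochner_integral_step_diff_square by (simp add: nn_integral_eq_integral has_bochner_integral_iff)
  also have "\<dots> = ennreal (mdist x)"
    unfolding mdist_def by (intro nn_integral_eq_integral L2_integrable dist_L2) auto
  finally show "(\<integral>\<^sup>+q. ennreal ((case q of (a, r) \<Rightarrow> step_diff (p x) (p a) r) * (case q of (a, r) \<Rightarrow> step_diff (p x) (p a) r)) \<partial>(N \<Otimes>\<^sub>M lborel)) \<le> ennreal (mdist x)"
    by simp
  show "0 \<le> mdist x" by (simp add: mdist_def)
qed

lemma feat_hs_app: "feat x = hs_app N (\<lambda>(a, r). step_diff (p x) (p a) r) (\<lambda>_. 1)"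
  by (simp add: feat_def[abs_def] hs_app_def)

lemma feat_L2: "feat x \<in> L2 lborel"
  unfolding feat_hs_app
  by (intro hs_app_L2 sigma_finite_measure_axioms lborel.sigma_finite_measure_axioms step_kernel_L2 one_L2)

lemma ip_feat_step: "ip lborel (feat y) (step_diff a b) = (\<bar>p y - b\<bar> + (\<integral>z. \<bar>a - p z\<bar> \<partial>N) - \<bar>p y - a\<bar> - (\<integral>z. \<bar>b - p z\<bar> \<partial>N)) / 2"
proof -
  have "ip lborel (feat y) (step_diff a b) = ip N (\<lambda>_. 1) (hs_app lborel (tr (\<lambda>(z, r). step_diff (p y) (p z) r)) (step_diff a b))"
    unfolding feat_hs_app
    by (rule hs_app_adjoint(1)) (intro sigma_finite_measure_axioms lborel.sigma_finite_measure_axioms step_kernel_L2 one_L2 step_diff_L2)+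
  also have "\<dots> = (\<integral>z. ip lborel (step_diff (p y) (p z)) (step_diff a b) \<partial>N)"
    by (simp add: ip_def hs_app_def tr_def)
  also have "\<dots> = (\<integral>z. (\<bar>p y - b\<bar> + \<bar>a - p z\<bar> - \<bar>p y - a\<bar> - \<bar>b - p z\<bar>) / 2 \<partial>N)"
    by (simp add: ip_step_diff abs_minus_commute)
  also have "\<dots> = (\<bar>p y - b\<bar> + (\<integral>z. \<bar>a - p z\<bar> \<partial>N) - \<bar>p y - a\<bar> - (\<integral>z. \<bar>b - p z\<bar> \<partial>N)) / 2"
    using L2_integrable[OF dist_L2] by (simp add: prob_space)
  finally show ?thesis .
qed

text \<open>Averaging the polarised identity over the auxiliary point of each feature subtracts the
  row means and adds the grand mean; sign and factor one half are those of
  \<open>ip_step_diff\<close>.\<close>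

lemma ip_feat: "ip lborel (feat x) (feat y) = - A (x, y) / 2"
proof -
  have "ip lborel (feat x) (feat y) = ip N (\<lambda>_. 1) (hs_app lborel (tr (\<lambda>(z, r). step_diff (p x) (p z) r)) (feat y))"
    unfolding feat_hs_app[of x]
    by (rule hs_app_adjoint(1)) (intro sigma_finite_measure_axioms lborel.sigma_finite_measure_axioms step_kernel_L2 one_L2 feat_L2)+
  also have "\<dots> = (\<integral>z. ip lborel (feat y) (step_diff (p x) (p z)) \<partial>N)"
    by (simp add: ip_def hs_app_def tr_def mult.commute)
  also have "\<dots> = (\<integral>z. (\<bar>p y - p z\<bar> + mdist x - \<bar>p y - p x\<bar> - mdist z) / 2 \<partial>N)"
    unfolding ip_feat_step by (simp add: mdist_def[symmetric] algebra_simps)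
  also have "\<dots> = (mdist y + mdist x - \<bar>p y - p x\<bar> - mmdist) / 2"
    using L2_integrable[OF dist_L2] L2_integrable[OF mdist_L2] by (simp add: prob_space mdist_def[symmetric] mmdist_def)
  finally show ?thesis by (simp add: A_def abs_minus_commute)
qed

lemma feat_measurable [measurable]: "(\<lambda>q. feat (fst q) (snd q)) \<in> borel_measurable (N \<Otimes>\<^sub>M lborel)"
  unfolding feat_def step_diff_def by measurable

end

section \<open>Distance covariance as an inner product of centred kernels\<close>

lemma ip_tensor:
  assumes A: "sigma_finite_measure A" and B: "sigma_finite_measure B"
    and "f \<in> L2 A" "f' \<in> L2 A" "g \<in> L2 B" "g' \<in> L2 B"
  shows "ip (A \<Otimes>\<^sub>M B) (tensor f g) (tensor f' g') = ip A f f' * ip B g g'"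
  using hs_app_adjoint(2)[OF A B tensor_L2[OF A B assms(4,6)] assms(3,5)]
  by (simp add: hs_app_tensor ip_cmult_left ip_commute)

text \<open>Degeneracy is orthogonality to all functions of one variable. It is what allows centring
  terms to be dropped in inner products.\<close>

lemma (in centered_distance) ip_tensor_A:
  assumes g: "g \<in> L2 N"
  shows "ip (N \<Otimes>\<^sub>M N) (tensor g (\<lambda>_. 1)) A = 0" and "ip (N \<Otimes>\<^sub>M N) (tensor (\<lambda>_. 1) g) A = 0"
proof -
  note sf = sigma_finite_measure_axioms
  have A': "(\<integral>y. A (y, x) \<partial>N) = 0" for x using A_degenerate[of x] by (simp add: A_sym[of _ x])
  show "ip (N \<Otimes>\<^sub>M N) (tensor g (\<lambda>_. 1)) A = 0"
    using Fubini_three(2)[OF sf sf g one_L2 A_L2] by (simp add: A_degenerate)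
  show "ip (N \<Otimes>\<^sub>M N) (tensor (\<lambda>_. 1) g) A = 0"
    using Fubini_three[OF sf sf one_L2 g A_L2] by (simp add: A')
qed

definition dist_kernel :: "('x \<Rightarrow> real) \<Rightarrow> 'x \<times> 'x \<Rightarrow> real" where
  "dist_kernel p = (\<lambda>(x, y). \<bar>p x - p y\<bar>)"

lemma (in centered_distance) dist_kernel_L2: "dist_kernel p \<in> L2 (N \<Otimes>\<^sub>M N)"
proof -
  note sf = sigma_finite_measure_axioms
  have "(\<lambda>q. \<bar>tensor p (\<lambda>_. 1) q - tensor (\<lambda>_. 1) p q\<bar>) \<in> L2 (N \<Otimes>\<^sub>M N)"
    by (intro L2_diff L2_abs tensor_L2 sf one_L2 p_L2)
  then show ?thesis by (simp add: dist_kernel_def tensor_def split_def)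
qed

lemma (in centered_distance) A_eq:
  "A = (\<lambda>q. dist_kernel p q - tensor mdist (\<lambda>_. 1) q - tensor (\<lambda>_. 1) mdist q + mmdist * tensor (\<lambda>_. 1) (\<lambda>_. 1) q)"
  by (auto simp: A_def dist_kernel_def tensor_def)

lemma (in centered_distance) ip_tensor_dist_kernel:
  assumes g: "g \<in> L2 N"
  shows "ip (N \<Otimes>\<^sub>M N) (tensor g (\<lambda>_. 1)) (dist_kernel p) = ip N g mdist"
    and "ip (N \<Otimes>\<^sub>M N) (tensor (\<lambda>_. 1) g) (dist_kernel p) = ip N g mdist"
proof -
  note sf = sigma_finite_measure_axioms
  show "ip (N \<Otimes>\<^sub>M N) (tensor g (\<lambda>_. 1)) (dist_kernel p) = ip N g mdist"
    using Fubini_three(2)[OF sf sf g one_L2 dist_kernel_L2] by (simp add: dist_kernel_def ip_def mdist_def)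
  have "(\<integral>b. \<bar>p b - p c\<bar> \<partial>N) = mdist c" for c by (simp add: mdist_def abs_minus_commute)
  then show "ip (N \<Otimes>\<^sub>M N) (tensor (\<lambda>_. 1) g) (dist_kernel p) = ip N g mdist"
    using Fubini_three[OF sf sf one_L2 g dist_kernel_L2] by (simp add: dist_kernel_def ip_def mult.commute)
qed

text \<open>Against the centred kernel of \<open>q\<close> the centring of the first kernel
  contributes nothing, so only the second has to be expanded; its three kinds of terms are the three
  terms of \<open>dcov\<close>.\<close>

lemma dcov_eq_ip:
  assumes p: "centered_distance N p" and q: "centered_distance N q"
  shows "dcov (distr N borel (\<lambda>x. (p x, q x))) = ip (N \<Otimes>\<^sub>M N) (centered_distance.A N p) (centered_distance.A N q)"
proof -
  interpret p: centered_distance N p by fact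
  interpret q: centered_distance N q by fact
  note sf = p.sigma_finite_measure_axioms
  note t = tensor_L2[OF sf sf]
  note mp = t[OF p.mdist_L2 p.one_L2] t[OF p.one_L2 p.mdist_L2] t[OF p.one_L2 p.one_L2]
  note mq = t[OF q.mdist_L2 p.one_L2] t[OF p.one_L2 q.mdist_L2]
  have "ip (N \<Otimes>\<^sub>M N) p.A q.A = ip (N \<Otimes>\<^sub>M N) (dist_kernel p) q.A"
    unfolding p.A_eq
    by (simp add: ip_add_left ip_diff_left ip_cmult_left L2_add L2_diff L2_cmult p.dist_kernel_L2 mp q.A_L2
        q.ip_tensor_A p.mdist_L2 p.one_L2)
  also have "\<dots> = ip (N \<Otimes>\<^sub>M N) (dist_kernel p) (dist_kernel q) - 2 * ip N p.mdist q.mdist + p.mmdist * q.mmdist"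
    unfolding q.A_eq
    by (simp add: ip_add_right ip_diff_right ip_cmult_right L2_add L2_diff L2_cmult p.dist_kernel_L2 q.dist_kernel_L2 mq mp
        ip_commute[of _ "dist_kernel p" "tensor _ _"] p.ip_tensor_dist_kernel q.mdist_L2 p.one_L2 ip_commute[of N q.mdist])
      (simp add: ip_def p.mmdist_def)
  finally have 1: "ip (N \<Otimes>\<^sub>M N) p.A q.A = ip (N \<Otimes>\<^sub>M N) (dist_kernel p) (dist_kernel q) - 2 * ip N p.mdist q.mdist + p.mmdist * q.mmdist" .
  have m: "(\<lambda>x. (p x, q x)) \<in> measurable N (borel \<Otimes>\<^sub>M borel)" by measurable
  then have m'[measurable]: "(\<lambda>x. (p x, q x)) \<in> borel_measurable N" by (simp add: borel_prod)
  let ?D = "distr N borel (\<lambda>x. (p x, q x))"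
  have fs: "fst \<in> borel_measurable (borel :: (real \<times> real) measure)" "snd \<in> borel_measurable (borel :: (real \<times> real) measure)"
    unfolding borel_prod[symmetric] by measurable
  note [measurable] = fs
  have d1: "(\<integral>z'. \<bar>fst z - fst z'\<bar> * \<bar>snd z - snd z'\<bar> \<partial>?D) = (\<integral>y. \<bar>fst z - p y\<bar> * \<bar>snd z - q y\<bar> \<partial>N)"
    and d2: "(\<integral>z'. \<bar>fst z - fst z'\<bar> \<partial>?D) = (\<integral>y. \<bar>fst z - p y\<bar> \<partial>N)"
    and d3: "(\<integral>z'. \<bar>snd z - snd z'\<bar> \<partial>?D) = (\<integral>y. \<bar>snd z - q y\<bar> \<partial>N)" for z :: "real \<times> real"
    by (subst integral_distr[OF m']; simp)+
  have e1: "(\<integral>z. (\<integral>z'. \<bar>fst z - fst z'\<bar> * \<bar>snd z - snd z'\<bar> \<partial>?D) \<partial>?D) = (\<integral>x. (\<integral>y. \<bar>p x - p y\<bar> * \<bar>q x - q y\<bar> \<partial>N) \<partial>N)"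
    unfolding d1 by (subst integral_distr[OF m']) simp_all
  have e2: "(\<integral>z. (\<integral>z'. (\<integral>z''. \<bar>fst z - fst z'\<bar> * \<bar>snd z - snd z''\<bar> \<partial>?D) \<partial>?D) \<partial>?D) = (\<integral>x. p.mdist x * q.mdist x \<partial>N)"
  proof -
    have "(\<integral>z. (\<integral>z'. (\<integral>z''. \<bar>fst z - fst z'\<bar> * \<bar>snd z - snd z''\<bar> \<partial>?D) \<partial>?D) \<partial>?D) = (\<integral>z. (\<integral>z'. \<bar>fst z - fst z'\<bar> \<partial>?D) * (\<integral>z''. \<bar>snd z - snd z''\<bar> \<partial>?D) \<partial>?D)"
      by (simp only: integral_mult_right_zero integral_mult_left_zero)
    also have "\<dots> = (\<integral>x. p.mdist x * q.mdist x \<partial>N)"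
      unfolding p.mdist_def q.mdist_def d2 d3 by (subst integral_distr[OF m']) simp_all
    finally show ?thesis .
  qed
  have e3: "(\<integral>z. (\<integral>z'. \<bar>fst z - fst z'\<bar> \<partial>?D) \<partial>?D) = p.mmdist"
    unfolding p.mmdist_def p.mdist_def d2 by (subst integral_distr[OF m']) simp_all
  have e4: "(\<integral>z. (\<integral>z'. \<bar>snd z - snd z'\<bar> \<partial>?D) \<partial>?D) = q.mmdist"
    unfolding q.mmdist_def q.mdist_def d3 by (subst integral_distr[OF m']) simp_all
  have e5: "(\<integral>x. (\<integral>y. \<bar>p x - p y\<bar> * \<bar>q x - q y\<bar> \<partial>N) \<partial>N) = ip (N \<Otimes>\<^sub>M N) (dist_kernel p) (dist_kernel q)"
    using ip_pair(1)[OF sf sf p.dist_kernel_L2 q.dist_kernel_L2] by (simp add: dist_kernel_def ip_def)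
  show ?thesis unfolding dcov_def e1 e2 e3 e4 e5 1 ip_def[of N] by simp
qed

lemma ip_slice_integrable:
  assumes A: "sigma_finite_measure A" and B: "sigma_finite_measure B"
    and F: "F \<in> L2 (A \<Otimes>\<^sub>M B)" and G: "G \<in> L2 (A \<Otimes>\<^sub>M B)"
  shows "integrable A (\<lambda>a. ip B (\<lambda>b. F (a, b)) (\<lambda>b. G (a, b)))"
proof -
  interpret A: sigma_finite_measure A by fact
  interpret B: sigma_finite_measure B by fact
  interpret AB: pair_sigma_finite A B ..
  have "integrable (A \<Otimes>\<^sub>M B) (\<lambda>(a, b). F (a, b) * G (a, b))"
    using L2_integrable_mult[OF F G] by (simp add: split_def)
  from AB.integrable_fst[OF this] show ?thesis by (simp add: ip_def)
qed

section \<open>The feature map of a sum of products of centred distances\<close>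

locale product_features =
  fixes N1 :: "'x measure" and N2 :: "'y measure" and K :: nat
    and p :: "nat \<Rightarrow> 'x \<Rightarrow> real" and q :: "nat \<Rightarrow> 'y \<Rightarrow> real" and c :: real
  assumes P: "\<And>k. centered_distance N1 (p k)" and Q: "\<And>k. centered_distance N2 (q k)" and c: "c \<ge> 0"
begin

sublocale P: centered_distance N1 "p k" for k by (rule P)
sublocale Q: centered_distance N2 "q k" for k by (rule Q)
sublocale PQ: pair_prob_space N1 N2
  by (simp add: pair_prob_space_def pair_sigma_finite_def P.prob_space_axioms Q.prob_space_axioms
      P.sigma_finite_measure_axioms Q.sigma_finite_measure_axioms)

abbreviation \<mu> :: "('x \<times> 'y) measure" where "\<mu> \<equiv> N1 \<Otimes>\<^sub>M N2"

text \<open>The counting component keeps the projections in orthogonal summands, so that the Gram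
  kernel is a sum over \<open>k\<close> without cross terms.\<close>

abbreviation \<nu> :: "(nat \<times> real \<times> real) measure" where
  "\<nu> \<equiv> count_space {..<K} \<Otimes>\<^sub>M (lborel \<Otimes>\<^sub>M lborel)"

definition \<kappa>\<mu> :: "('x \<times> 'y) \<times> ('x \<times> 'y) \<Rightarrow> real" where
  "\<kappa>\<mu> = (\<lambda>(z, z'). c * (\<Sum>k<K. P.A k (fst z, fst z') * Q.A k (snd z, snd z')))"

text \<open>Each of the two factors of \<open>\<Phi>\<close> reproduces minus one half of a centred distance, whence the factor
  \<open>2 * sqrt c\<close>.\<close>

definition \<Phi> :: "('x \<times> 'y) \<times> (nat \<times> real \<times> real) \<Rightarrow> real" where
  "\<Phi> = (\<lambda>(z, w). \<Sum>k<K. (2 * sqrt c) * tensor (indicator {k}) (tensor (P.feat k (fst z)) (Q.feat k (snd z))) w)"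

lemma sf_ll: "sigma_finite_measure (lborel \<Otimes>\<^sub>M lborel :: (real \<times> real) measure)"
  by (simp add: lborel_prod lborel.sigma_finite_measure_axioms)

lemma sf_count: "sigma_finite_measure (count_space {..<K})"
  by (rule sigma_finite_measure_count_space_finite) simp

lemma sf_\<nu>: "sigma_finite_measure \<nu>"
proof -
  interpret c: sigma_finite_measure "count_space {..<K}" by (rule sf_count)
  interpret l: sigma_finite_measure "lborel \<Otimes>\<^sub>M lborel :: (real \<times> real) measure" by (rule sf_ll)
  interpret pair_sigma_finite "count_space {..<K}" "lborel \<Otimes>\<^sub>M lborel :: (real \<times> real) measure" ..
  show ?thesis by (rule sigma_finite_measure_axioms)
qed

lemma prob_\<mu>: "prob_space \<mu>"
  by (rule PQ.P.prob_space_axioms)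

lemma sf_\<mu>: "sigma_finite_measure \<mu>"
  by (rule PQ.P.sigma_finite_measure_axioms)

lemma ind_L2: "indicator {k} \<in> L2 (count_space {..<K})"
  by (simp add: L2_iff integrable_count_space)

lemma ip_ind: "k < K \<Longrightarrow> ip (count_space {..<K}) (indicator {k}) (indicator {l}) = (if k = l then 1 else 0)"
proof -
  assume "k < K"
  have "ip (count_space {..<K}) (indicator {k}) (indicator {l}) = (\<Sum>i<K. indicator {k} i * indicator {l} i)"
    unfolding ip_def by (rule lebesgue_integral_count_space_finite) simp
  also have "\<dots> = (\<Sum>i<K. if i = k then (if k = l then 1 else 0) else 0)"
    by (intro sum.cong) (auto split: split_indicator)
  finally show ?thesis using \<open>k < K\<close> by simp
qed

lemma term_L2: "tensor (indicator {k}) (tensor (P.feat k x) (Q.feat k y)) \<in> L2 \<nu>"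
  by (intro tensor_L2 sf_count sf_ll ind_L2 P.feat_L2 Q.feat_L2 lborel.sigma_finite_measure_axioms)

lemma \<Phi>_slice_L2: "(\<lambda>w. \<Phi> (z, w)) \<in> L2 \<nu>"
  unfolding \<Phi>_def by (simp, intro L2_sum L2_cmult term_L2)

lemma ip_term:
  assumes "k < K"
  shows "ip \<nu> (tensor (indicator {k}) (tensor (P.feat k x) (Q.feat k y))) (tensor (indicator {l}) (tensor (P.feat l x') (Q.feat l y')))
    = (if k = l then P.A k (x, x') * Q.A k (y, y') / 4 else 0)"
  using assms
  by (simp add: ip_tensor sf_count sf_ll ind_L2 P.feat_L2 Q.feat_L2 tensor_L2 lborel.sigma_finite_measure_axioms ip_ind P.ip_feat Q.ip_feat)

lemma ip_\<Phi>: "ip \<nu> (\<lambda>w. \<Phi> (z, w)) (\<lambda>w. \<Phi> (z', w)) = \<kappa>\<mu> (z, z')"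
proof -
  let ?t = "\<lambda>k z. tensor (indicator {k}) (tensor (P.feat k (fst z)) (Q.feat k (snd z)))"
  have slice_eq: "(\<lambda>w. \<Phi> (z, w)) = (\<lambda>w. \<Sum>k<K. (2 * sqrt c) * ?t k z w)" for z
    by (simp add: \<Phi>_def)
  have "ip \<nu> (\<lambda>w. \<Phi> (z, w)) (\<lambda>w. \<Phi> (z', w)) = (\<Sum>k<K. (2 * sqrt c) * ip \<nu> (?t k z) (\<lambda>w. \<Phi> (z', w)))"
    unfolding slice_eq[of z]
    by (subst ip_sum_left) (auto intro!: L2_cmult term_L2 \<Phi>_slice_L2 simp: ip_cmult_left)
  also have "\<dots> = (\<Sum>k<K. c * (P.A k (fst z, fst z') * Q.A k (snd z, snd z')))"
  proof (rule sum.cong)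
    fix k assume "k \<in> {..<K}"
    then have k: "k < K" by simp
    have "ip \<nu> (?t k z) (\<lambda>w. \<Phi> (z', w)) = (\<Sum>l<K. (2 * sqrt c) * ip \<nu> (?t k z) (?t l z'))"
      unfolding slice_eq[of z']
      by (subst ip_sum_right) (auto intro!: L2_cmult term_L2 simp: ip_cmult_right)
    also have "\<dots> = (\<Sum>l<K. if l = k then (2 * sqrt c) * (P.A k (fst z, fst z') * Q.A k (snd z, snd z') / 4) else 0)"
      by (intro sum.cong) (auto simp: ip_term[OF k])
    also have "\<dots> = (2 * sqrt c) * (P.A k (fst z, fst z') * Q.A k (snd z, snd z') / 4)" using k by simp
    finally have e: "ip \<nu> (?t k z) (\<lambda>w. \<Phi> (z', w)) = (2 * sqrt c) * (P.A k (fst z, fst z') * Q.A k (snd z, snd z') / 4)" .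
    have "(2 * s) * ((2 * s) * (t / 4)) = (s * s) * t" for s t :: real by simp
    then show "(2 * sqrt c) * ip \<nu> (?t k z) (\<lambda>w. \<Phi> (z', w)) = c * (P.A k (fst z, fst z') * Q.A k (snd z, snd z'))"
      unfolding e using c by simp
  qed simp
  finally show ?thesis by (simp add: \<kappa>\<mu>_def sum_distrib_left)
qed

lemma hs_comp_\<Phi>: "hs_comp \<nu> \<Phi> (tr \<Phi>) = \<kappa>\<mu>"
proof (rule ext, clarify)
  fix x y x' y'
  show "hs_comp \<nu> \<Phi> (tr \<Phi>) ((x, y), (x', y')) = \<kappa>\<mu> ((x, y), (x', y'))"
    using ip_\<Phi>[of "(x, y)" "(x', y')"] by (simp add: hs_comp_def tr_def ip_def)
qed

lemma has_integral_product:
  assumes f: "integrable N1 f" and g: "integrable N2 g"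
  shows "has_bochner_integral \<mu> (\<lambda>z. f (fst z) * g (snd z)) ((\<integral>x. f x \<partial>N1) * (\<integral>y. g y \<partial>N2 :: real))"
proof -
  note [measurable] = borel_measurable_integrable[OF f] borel_measurable_integrable[OF g]
  have i: "integrable \<mu> (\<lambda>(x, y). f x * g y)"
  proof (rule PQ.Fubini_integrable)
    show "integrable N1 (\<lambda>x. \<integral>y. norm (case (x, y) of (x, y) \<Rightarrow> f x * g y) \<partial>N2)"
      using f by (simp add: abs_mult)
    show "AE x in N1. integrable N2 (\<lambda>y. case (x, y) of (x, y) \<Rightarrow> f x * g y)"
      using g by simp
  qed simp
  show ?thesis
    using i PQ.integral_fst[OF i] by (simp add: has_bochner_integral_iff split_def mult.commute)
qed

lemma A_slice_L2: "(\<lambda>x'. P.A k (x, x')) \<in> L2 N1" "(\<lambda>y'. Q.A k (y, y')) \<in> L2 N2"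
proof -
  have "(\<lambda>x'. \<bar>p k x - p k x'\<bar> - P.mdist k x * 1 - P.mdist k x' + P.mmdist k * 1) \<in> L2 N1"
    by (intro L2_add L2_diff L2_cmult P.one_L2 P.mdist_L2 P.dist_L2)
  then show "(\<lambda>x'. P.A k (x, x')) \<in> L2 N1" by (simp add: P.A_def)
  have "(\<lambda>x'. \<bar>q k y - q k x'\<bar> - Q.mdist k y * 1 - Q.mdist k x' + Q.mmdist k * 1) \<in> L2 N2"
    by (intro L2_add L2_diff L2_cmult Q.one_L2 Q.mdist_L2 Q.dist_L2)
  then show "(\<lambda>x'. Q.A k (y, x')) \<in> L2 N2" by (simp add: Q.A_def)
qed

lemma \<kappa>\<mu>_degenerate: "(\<integral>z'. \<kappa>\<mu> (z, z') \<partial>\<mu>) = 0"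
proof -
  have "has_bochner_integral \<mu> (\<lambda>z'. c * (\<Sum>k<K. P.A k (fst z, fst z') * Q.A k (snd z, snd z')))
    (c * (\<Sum>k<K. (\<integral>x. P.A k (fst z, x) \<partial>N1) * (\<integral>y. Q.A k (snd z, y) \<partial>N2)))"
    by (intro has_bochner_integral_mult_right has_bochner_integral_sum has_integral_product P.L2_integrable Q.L2_integrable A_slice_L2)
  then show ?thesis by (simp add: \<kappa>\<mu>_def has_bochner_integral_iff P.A_degenerate)
qed

lemma \<kappa>\<mu>_diag: "has_bochner_integral \<mu> (\<lambda>z. \<kappa>\<mu> (z, z)) (c * (\<Sum>k<K. P.mmdist k * Q.mmdist k))"
proof -
  have "has_bochner_integral \<mu> (\<lambda>z. c * (\<Sum>k<K. P.A k (fst z, fst z) * Q.A k (snd z, snd z)))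
    (c * (\<Sum>k<K. (\<integral>x. P.A k (x, x) \<partial>N1) * (\<integral>y. Q.A k (y, y) \<partial>N2)))"
    by (intro has_bochner_integral_mult_right has_bochner_integral_sum
        has_integral_product[of "\<lambda>x. P.A _ (x, x)" "\<lambda>y. Q.A _ (y, y)"] P.L2_integrable Q.L2_integrable P.A_diag_L2 Q.A_diag_L2)
  then show ?thesis by (simp add: \<kappa>\<mu>_def P.A_trace Q.A_trace)
qed

lemma \<Phi>_measurable [measurable]: "\<Phi> \<in> borel_measurable (\<mu> \<Otimes>\<^sub>M \<nu>)"
  unfolding \<Phi>_def tensor_def split_def
proof (intro borel_measurable_sum borel_measurable_times borel_measurable_const)
  fix k
  have "(\<lambda>x. fst (snd x)) \<in> measurable (\<mu> \<Otimes>\<^sub>M \<nu>) (count_space {..<K})" by measurable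
  then show "(\<lambda>x. indicator {k} (fst (snd x)) :: real) \<in> borel_measurable (\<mu> \<Otimes>\<^sub>M \<nu>)"
    by (rule measurable_compose) simp
  have "(\<lambda>x. (fst (fst x), fst (snd (snd x)))) \<in> measurable (\<mu> \<Otimes>\<^sub>M \<nu>) (N1 \<Otimes>\<^sub>M lborel)" by measurable
  from measurable_compose[OF this P.feat_measurable[of k]]
  show "(\<lambda>x. P.feat k (fst (fst x)) (fst (snd (snd x)))) \<in> borel_measurable (\<mu> \<Otimes>\<^sub>M \<nu>)" by simp
  have "(\<lambda>x. (snd (fst x), snd (snd (snd x)))) \<in> measurable (\<mu> \<Otimes>\<^sub>M \<nu>) (N2 \<Otimes>\<^sub>M lborel)" by measurable
  from measurable_compose[OF this Q.feat_measurable[of k]]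
  show "(\<lambda>x. Q.feat k (snd (fst x)) (snd (snd (snd x)))) \<in> borel_measurable (\<mu> \<Otimes>\<^sub>M \<nu>)" by simp
qed

text \<open>By Tonelli the squared norm is the integral of the kernel over the diagonal, already
  known to be finite.\<close>

lemma \<Phi>_L2: "\<Phi> \<in> L2 (\<mu> \<Otimes>\<^sub>M \<nu>)"
proof (rule L2_bound_nn(1)[OF \<Phi>_measurable])
  interpret n: sigma_finite_measure \<nu> by (rule sf_\<nu>)
  have "(\<integral>\<^sup>+x. ennreal (\<Phi> x * \<Phi> x) \<partial>(\<mu> \<Otimes>\<^sub>M \<nu>)) = (\<integral>\<^sup>+z. \<integral>\<^sup>+w. ennreal (\<Phi> (z, w) * \<Phi> (z, w)) \<partial>\<nu> \<partial>\<mu>)"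
    by (subst n.nn_integral_fst[symmetric]) auto
  also have "\<dots> = (\<integral>\<^sup>+z. ennreal (\<kappa>\<mu> (z, z)) \<partial>\<mu>)"
    by (simp add: nn_integral_L2[OF \<Phi>_slice_L2] ip_\<Phi>)
  also have "\<dots> = ennreal (\<integral>z. \<kappa>\<mu> (z, z) \<partial>\<mu>)"
  proof (rule nn_integral_eq_integral)
    show "integrable \<mu> (\<lambda>z. \<kappa>\<mu> (z, z))" using \<kappa>\<mu>_diag by (simp add: has_bochner_integral_iff)
    show "AE z in \<mu>. 0 \<le> \<kappa>\<mu> (z, z)" using nrm2_nonneg[of \<nu> "\<lambda>w. \<Phi> (_, w)"] by (simp add: ip_\<Phi>)
  qed
  finally show "(\<integral>\<^sup>+x. ennreal (\<Phi> x * \<Phi> x) \<partial>(\<mu> \<Otimes>\<^sub>M \<nu>)) \<le> ennreal (\<integral>z. \<kappa>\<mu> (z, z) \<partial>\<mu>)" by simp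
  show "0 \<le> (\<integral>z. \<kappa>\<mu> (z, z) \<partial>\<mu>)"
  proof (rule integral_nonneg_AE)
    show "AE z in \<mu>. 0 \<le> \<kappa>\<mu> (z, z)" using nrm2_nonneg[of \<nu> "\<lambda>w. \<Phi> (_, w)"] by (simp add: ip_\<Phi>)
  qed
qed

lemma nrm2_\<Phi>: "nrm2 (\<mu> \<Otimes>\<^sub>M \<nu>) \<Phi> = c * (\<Sum>k<K. P.mmdist k * Q.mmdist k)"
  using ip_pair(1)[OF sf_\<mu> sf_\<nu> \<Phi>_L2 \<Phi>_L2] \<kappa>\<mu>_diag by (simp add: ip_\<Phi> has_bochner_integral_iff)

text \<open>Squaring the sum over \<open>k\<close> gives a double sum. In each term independence
  separates the two coordinates, once for the inner and once for the outer integral, leaving two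
  inner products of centred kernels.\<close>

lemma nrm2_\<kappa>\<mu>: "nrm2 (\<mu> \<Otimes>\<^sub>M \<mu>) \<kappa>\<mu> =
  c\<^sup>2 * (\<Sum>k<K. \<Sum>l<K. ip (N1 \<Otimes>\<^sub>M N1) (P.A k) (P.A l) * ip (N2 \<Otimes>\<^sub>M N2) (Q.A k) (Q.A l))"
proof -
  have L: "\<kappa>\<mu> \<in> L2 (\<mu> \<Otimes>\<^sub>M \<mu>)"
    unfolding hs_comp_\<Phi>[symmetric] by (intro hs_comp_L2 tr_L2 sf_\<mu> sf_\<nu> \<Phi>_L2)
  let ?a = "\<lambda>k l x. ip N1 (\<lambda>x'. P.A k (x, x')) (\<lambda>x'. P.A l (x, x'))"
  let ?b = "\<lambda>k l y. ip N2 (\<lambda>y'. Q.A k (y, y')) (\<lambda>y'. Q.A l (y, y'))"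
  have inner: "ip \<mu> (\<lambda>z'. \<kappa>\<mu> (z, z')) (\<lambda>z'. \<kappa>\<mu> (z, z')) = c\<^sup>2 * (\<Sum>k<K. \<Sum>l<K. ?a k l (fst z) * ?b k l (snd z))" for z
  proof -
    have "has_bochner_integral \<mu> (\<lambda>z'. c\<^sup>2 * (\<Sum>k<K. \<Sum>l<K. (P.A k (fst z, fst z') * P.A l (fst z, fst z')) * (Q.A k (snd z, snd z') * Q.A l (snd z, snd z'))))
      (c\<^sup>2 * (\<Sum>k<K. \<Sum>l<K. ?a k l (fst z) * ?b k l (snd z)))"
      unfolding ip_def
      by (intro has_bochner_integral_mult_right has_bochner_integral_sum
          has_integral_product[of "\<lambda>x. P.A _ (fst z, x) * P.A _ (fst z, x)" "\<lambda>y. Q.A _ (snd z, y) * Q.A _ (snd z, y)"] L2_integrable_mult A_slice_L2)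
    moreover have "\<kappa>\<mu> (z, z') * \<kappa>\<mu> (z, z') = c\<^sup>2 * (\<Sum>k<K. \<Sum>l<K. (P.A k (fst z, fst z') * P.A l (fst z, fst z')) * (Q.A k (snd z, snd z') * Q.A l (snd z, snd z')))" for z'
    proof -
      have "\<kappa>\<mu> (z, z') * \<kappa>\<mu> (z, z') = c\<^sup>2 * ((\<Sum>k<K. P.A k (fst z, fst z') * Q.A k (snd z, snd z')) * (\<Sum>l<K. P.A l (fst z, fst z') * Q.A l (snd z, snd z')))"
        by (simp add: \<kappa>\<mu>_def power2_eq_square)
      then show ?thesis unfolding sum_product by (simp add: mult_ac)
    qed
    ultimately show ?thesis by (simp add: ip_def has_bochner_integral_iff)
  qed
  have "has_bochner_integral \<mu> (\<lambda>z. c\<^sup>2 * (\<Sum>k<K. \<Sum>l<K. ?a k l (fst z) * ?b k l (snd z)))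
      (c\<^sup>2 * (\<Sum>k<K. \<Sum>l<K. (\<integral>x. ?a k l x \<partial>N1) * (\<integral>y. ?b k l y \<partial>N2)))"
    by (intro has_bochner_integral_mult_right has_bochner_integral_sum has_integral_product ip_slice_integrable
        P.sigma_finite_measure_axioms Q.sigma_finite_measure_axioms P.A_L2 Q.A_L2)
  then show ?thesis
    unfolding ip_pair(1)[OF sf_\<mu> sf_\<mu> L L] inner
    by (simp add: has_bochner_integral_iff ip_pair(1)[OF P.sigma_finite_measure_axioms P.sigma_finite_measure_axioms P.A_L2 P.A_L2]
        ip_pair(1)[OF Q.sigma_finite_measure_axioms Q.sigma_finite_measure_axioms Q.A_L2 Q.A_L2])
qed

end

text \<open>Terms are grouped by the way in which index 3 occurs: not at all, in \<open>a\<close>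
  only, in \<open>b\<close> only, or in both. Integrating out the fourth point will kill every group
  but the first.\<close>

lemma ucov_4_expand:
  assumes a0: "\<And>i. a i i = 0" and as: "\<And>i j. a i j = a j i" and b0: "\<And>i. b i i = 0" and bs: "\<And>i j. b i j = b j i"
  shows "ucov 4 a b = (a 0 1 * b 0 1 + a 0 2 * b 0 2 + a 1 2 * b 1 2) / 6
      - (a 0 1 * b 0 2 + a 0 1 * b 1 2 + a 0 2 * b 0 1 + a 0 2 * b 1 2 + a 1 2 * b 0 1 + a 1 2 * b 0 2) / 12
    + (a 0 3 * (b 1 2 / 6 - (b 0 1 + b 0 2) / 12) + a 1 3 * (b 0 2 / 6 - (b 0 1 + b 1 2) / 12) + a 2 3 * (b 0 1 / 6 - (b 0 2 + b 1 2) / 12))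
    + (b 0 3 * (a 1 2 / 6 - (a 0 1 + a 0 2) / 12) + b 1 3 * (a 0 2 / 6 - (a 0 1 + a 1 2) / 12) + b 2 3 * (a 0 1 / 6 - (a 0 2 + a 1 2) / 12))
    + ((a 0 3 * b 0 3 + a 1 3 * b 1 3 + a 2 3 * b 2 3) / 6
      - (a 0 3 * b 1 3 + a 0 3 * b 2 3 + a 1 3 * b 0 3 + a 1 3 * b 2 3 + a 2 3 * b 0 3 + a 2 3 * b 1 3) / 12)"
proof -
  have s4: "(\<Sum>i<4. f i) = f 0 + f 1 + f 2 + f 3" for f :: "nat \<Rightarrow> real"
    by (simp add: eval_nat_numeral)
  have sym: "a 1 0 = a 0 1" "a 2 0 = a 0 2" "a 3 0 = a 0 3" "a 2 1 = a 1 2" "a 3 1 = a 1 3" "a 3 2 = a 2 3"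
    "b 1 0 = b 0 1" "b 2 0 = b 0 2" "b 3 0 = b 0 3" "b 2 1 = b 1 2" "b 3 1 = b 1 3" "b 3 2 = b 2 3"
    by (rule as bs)+
  show ?thesis
    unfolding ucov_def s4 a0 b0 sym by (simp add: field_simps)
qed

context product_features
begin

lemma has_integral_A1: "has_bochner_integral \<mu> (\<lambda>z. P.A k (x, fst z)) 0"
  using has_integral_product[of "\<lambda>x'. P.A k (x, x')" "\<lambda>_. 1"] P.L2_integrable[OF A_slice_L2(1)] by (simp add: P.A_degenerate)

lemma has_integral_A2: "has_bochner_integral \<mu> (\<lambda>z. Q.A k (y, snd z)) 0"
  using has_integral_product[of "\<lambda>_. 1" "\<lambda>y'. Q.A k (y, y')"] Q.L2_integrable[OF A_slice_L2(2)] by (simp add: Q.A_degenerate)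

lemma has_integral_A12: "has_bochner_integral \<mu> (\<lambda>z. P.A k (x, fst z) * Q.A k (y, snd z)) 0"
  using has_integral_product[of "\<lambda>x'. P.A k (x, x')" "\<lambda>y'. Q.A k (y, y')"] P.L2_integrable[OF A_slice_L2(1)] Q.L2_integrable[OF A_slice_L2(2)]
  by (simp add: P.A_degenerate)

definition R3 :: "nat \<Rightarrow> 'x \<times> 'y \<Rightarrow> 'x \<times> 'y \<Rightarrow> 'x \<times> 'y \<Rightarrow> real" where
  "R3 k z1 z2 z3 = (let a = (\<lambda>z z'. P.A k (fst z, fst z')); b = (\<lambda>z z'. Q.A k (snd z, snd z')) in
      (a z1 z2 * b z1 z2 + a z1 z3 * b z1 z3 + a z2 z3 * b z2 z3) / 6
      - (a z1 z2 * b z1 z3 + a z1 z2 * b z2 z3 + a z1 z3 * b z1 z2 + a z1 z3 * b z2 z3 + a z2 z3 * b z1 z2 + a z2 z3 * b z1 z3) / 12)"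

text \<open>Centring the distances does not change \<open>h4\<close>. After it, a single factor
  containing \<open>z4\<close> has mean 0 by degeneracy, and so has a product of two such factors,
  since the coordinates of \<open>z4\<close> are independent under \<open>\<mu>\<close>.\<close>

lemma h4_integral4:
  "has_bochner_integral \<mu> (\<lambda>z4. h4 (\<lambda>i. p k (fst ([z1, z2, z3, z4] ! i))) (\<lambda>i. q k (snd ([z1, z2, z3, z4] ! i)))) (R3 k z1 z2 z3)"
proof -
  define z where "z z4 i = [z1, z2, z3, z4] ! i" for z4 i
  define a where "a z4 i j = (if i = j then 0 else P.A k (fst (z z4 i), fst (z z4 j)))" for z4 i j
  define b where "b z4 i j = (if i = j then 0 else Q.A k (snd (z z4 i), snd (z z4 j)))" for z4 i j
  have "h4 (\<lambda>i. p k (fst (z z4 i))) (\<lambda>i. q k (snd (z z4 i))) = ucov 4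
     (\<lambda>i j. if i = j then 0 else \<bar>p k (fst (z z4 i)) - p k (fst (z z4 j))\<bar> - P.mdist k (fst (z z4 i)) - P.mdist k (fst (z z4 j)) + P.mmdist k)
     (\<lambda>i j. if i = j then 0 else \<bar>q k (snd (z z4 i)) - q k (snd (z z4 j))\<bar> - Q.mdist k (snd (z z4 i)) - Q.mdist k (snd (z z4 j)) + Q.mmdist k)" for z4
    unfolding h4_eq_ucov by (rule ucov_centered) (auto simp: abs_minus_commute)
  then have e: "h4 (\<lambda>i. p k (fst (z z4 i))) (\<lambda>i. q k (snd (z z4 i))) = ucov 4 (a z4) (b z4)" for z4
    by (simp add: a_def[abs_def] b_def[abs_def] P.A_def Q.A_def cong: if_cong)
  have ab: "a z4 i i = 0" "a z4 i j = a z4 j i" "b z4 i i = 0" "b z4 i j = b z4 j i" for z4 i j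
    by (auto simp: a_def b_def P.A_sym[of k "fst (z z4 i)"] Q.A_sym[of k "snd (z z4 i)"])
  have "has_bochner_integral \<mu> (\<lambda>z4. ucov 4 (a z4) (b z4)) (R3 k z1 z2 z3)"
    unfolding ucov_4_expand[of "a _" "b _", OF ab] R3_def Let_def
    using has_integral_A1[of k] has_integral_A2[of k] has_integral_A12[of k]
    by (simp add: a_def b_def z_def eval_nat_numeral has_bochner_integral_iff PQ.P.prob_space)
  then show ?thesis unfolding e[unfolded z_def, symmetric] .
qed

text \<open>Every term of \<open>R3\<close> that contains \<open>z3\<close> integrates to 0; the
  single term left carries the coefficient 1/6, the origin of the factor 6 in the eigenvalue
  problem.\<close>

lemma R3_integral3: "has_bochner_integral \<mu> (R3 k z1 z2) (P.A k (fst z1, fst z2) * Q.A k (snd z1, snd z2) / 6)"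
  unfolding R3_def[abs_def] Let_def
  using has_integral_A1[of k] has_integral_A2[of k] has_integral_A12[of k]
  by (simp add: has_bochner_integral_iff PQ.P.prob_space)

lemma double_integral_h4:
  "(\<integral>z3. (\<integral>z4. d * (\<Sum>k<K. e * h4 (\<lambda>i. p k (fst ([z1, z2, z3, z4] ! i))) (\<lambda>i. q k (snd ([z1, z2, z3, z4] ! i)))) \<partial>\<mu>) \<partial>\<mu>)
    = d * (\<Sum>k<K. e * (P.A k (fst z1, fst z2) * Q.A k (snd z1, snd z2) / 6))"
proof -
  have "has_bochner_integral \<mu> (\<lambda>z4. d * (\<Sum>k<K. e * h4 (\<lambda>i. p k (fst ([z1, z2, z3, z4] ! i))) (\<lambda>i. q k (snd ([z1, z2, z3, z4] ! i)))))
     (d * (\<Sum>k<K. e * R3 k z1 z2 z3))" for z3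
    by (intro has_bochner_integral_mult_right has_bochner_integral_sum h4_integral4)
  then have 1: "(\<integral>z4. d * (\<Sum>k<K. e * h4 (\<lambda>i. p k (fst ([z1, z2, z3, z4] ! i))) (\<lambda>i. q k (snd ([z1, z2, z3, z4] ! i)))) \<partial>\<mu>) = d * (\<Sum>k<K. e * R3 k z1 z2 z3)" for z3
    by (rule has_bochner_integral_integral_eq)
  have "has_bochner_integral \<mu> (\<lambda>z3. d * (\<Sum>k<K. e * R3 k z1 z2 z3)) (d * (\<Sum>k<K. e * (P.A k (fst z1, fst z2) * Q.A k (snd z1, snd z2) / 6)))"
    by (intro has_bochner_integral_mult_right has_bochner_integral_sum R3_integral3)
  then show ?thesis unfolding 1 by (rule has_bochner_integral_integral_eq)
qed

end

section \<open>The limit theorem\<close>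

lemma (in prob_space) centered_distance_distr:
  fixes W :: "'a \<Rightarrow> 'b::euclidean_space"
  assumes W[measurable]: "W \<in> borel_measurable M" and int: "integrable M (\<lambda>\<omega>. (norm (W \<omega>))\<^sup>2)"
  shows "centered_distance (distr M borel W) (\<lambda>x. w \<bullet> x)"
proof -
  interpret D: prob_space "distr M borel W" by (rule prob_space_distr) simp
  have "integrable M (\<lambda>\<omega>. (w \<bullet> W \<omega>)\<^sup>2)"
  proof (rule Bochner_Integration.integrable_bound)
    show "integrable M (\<lambda>\<omega>. (norm w)\<^sup>2 * (norm (W \<omega>))\<^sup>2)" using int by simp
    have "(w \<bullet> x)\<^sup>2 \<le> (norm w)\<^sup>2 * (norm x)\<^sup>2" for x
      using Cauchy_Schwarz_ineq[of w x] by (simp add: power2_norm_eq_inner)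
    then show "AE \<omega> in M. norm ((w \<bullet> W \<omega>)\<^sup>2) \<le> norm ((norm w)\<^sup>2 * (norm (W \<omega>))\<^sup>2)" by simp
  qed simp
  then have "integrable (distr M borel W) (\<lambda>x. (w \<bullet> x)\<^sup>2)"
    by (subst integrable_distr_eq) auto
  then show ?thesis by unfold_locales (simp add: L2_def)
qed

lemma (in prob_space) mmdist_eq_expectation:
  fixes W :: "nat \<Rightarrow> 'a \<Rightarrow> 'b::euclidean_space"
  assumes ind: "indep_vars (\<lambda>_. N) W UNIV" and law: "\<And>i. distr M N (W i) = N"
    and "centered_distance N (\<lambda>x. w \<bullet> x)"
  shows "centered_distance.mmdist N (\<lambda>x. w \<bullet> x) = (\<integral>\<omega>. \<bar>w \<bullet> (W 0 \<omega> - W 1 \<omega>)\<bar> \<partial>M)"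
proof -
  interpret W: centered_distance N "\<lambda>x. w \<bullet> x" by fact
  let ?d = "dist_kernel (\<lambda>x. w \<bullet> x)"
  have d: "distr M (N \<Otimes>\<^sub>M N) (\<lambda>\<omega>. (W 0 \<omega>, W 1 \<omega>)) = N \<Otimes>\<^sub>M N"
    using distr_pair_of_indep_vars(2)[OF ind, of 0 1] by (simp add: law)
  have [measurable]: "W i \<in> measurable M N" for i using ind by (auto simp: indep_vars_def)
  have [measurable]: "?d \<in> borel_measurable (N \<Otimes>\<^sub>M N)" using W.dist_kernel_L2 by measurable
  have "W.mmdist = ip (N \<Otimes>\<^sub>M N) (tensor (\<lambda>_. 1) (\<lambda>_. 1)) ?d"
    using W.ip_tensor_dist_kernel(1)[OF W.one_L2] by (simp add: ip_def W.mmdist_def)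
  also have "\<dots> = (\<integral>z. ?d z \<partial>distr M (N \<Otimes>\<^sub>M N) (\<lambda>\<omega>. (W 0 \<omega>, W 1 \<omega>)))"
    unfolding d by (simp add: ip_def tensor_def split_def)
  also have "\<dots> = (\<integral>\<omega>. \<bar>w \<bullet> (W 0 \<omega> - W 1 \<omega>)\<bar> \<partial>M)"
    by (subst integral_distr) (auto simp: dist_kernel_def inner_diff_right)
  finally show ?thesis .
qed

lemma (in prob_space) dcov_projections:
  fixes W :: "'a \<Rightarrow> 'b::euclidean_space"
  assumes W: "W \<in> borel_measurable M"
    and "centered_distance (distr M borel W) (\<lambda>x. w \<bullet> x)" "centered_distance (distr M borel W) (\<lambda>x. w' \<bullet> x)"
  shows "dcov (distr M borel (\<lambda>\<omega>. (w \<bullet> W \<omega>, w' \<bullet> W \<omega>))) = ip (distr M borel W \<Otimes>\<^sub>M distr M borel W)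
    (centered_distance.A (distr M borel W) (\<lambda>x. w \<bullet> x)) (centered_distance.A (distr M borel W) (\<lambda>x. w' \<bullet> x))"
proof -
  have m: "(\<lambda>x. (w \<bullet> x, w' \<bullet> x)) \<in> borel_measurable borel"
    unfolding borel_prod[symmetric] by measurable
  have "distr M borel (\<lambda>\<omega>. (w \<bullet> W \<omega>, w' \<bullet> W \<omega>)) = distr (distr M borel W) borel (\<lambda>x. (w \<bullet> x, w' \<bullet> x))"
    by (subst distr_distr[OF m W]) (simp add: comp_def)
  then show ?thesis using dcov_eq_ip[OF assms(2,3)] by simp
qed

lemma Cconst_nonneg: "n > 0 \<Longrightarrow> Cconst n \<ge> 0"
  unfolding Cconst_def
  by (intro divide_nonneg_nonneg mult_nonneg_nonneg less_imp_le[OF Gamma_real_pos]) auto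

text \<open>Conditioning on the directions is expressed by treating \<open>u\<close> and
  \<open>v\<close> as fixed parameters, and the sample point with index 1 serves as the independent
  copy in the trace formula.\<close>

theorem theorem4p18:
  fixes M :: "'a measure"
    and X :: "nat \<Rightarrow> 'a \<Rightarrow> real^'p" and Y :: "nat \<Rightarrow> 'a \<Rightarrow> real^'q"
    and K :: nat and u :: "nat \<Rightarrow> real^'p" and v :: "nat \<Rightarrow> real^'q"
    and lam :: "nat \<Rightarrow> real"
  assumes "prob_space M"
    and "K \<ge> 1"
    and "\<forall>k<K. norm (u k) = 1" and "\<forall>k<K. norm (v k) = 1"
    and "\<forall>i. X i \<in> borel_measurable M" and "\<forall>i. Y i \<in> borel_measurable M"
    and "prob_space.indep_vars M (\<lambda>_. borel) (\<lambda>i \<omega>. (X i \<omega>, Y i \<omega>)) UNIV"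
    and "\<forall>i. distr M borel (\<lambda>\<omega>. (X i \<omega>, Y i \<omega>)) = distr M borel (\<lambda>\<omega>. (X 0 \<omega>, Y 0 \<omega>))"
    and "distr M borel (\<lambda>\<omega>. (X 0 \<omega>, Y 0 \<omega>)) = distr M borel (X 0) \<Otimes>\<^sub>M distr M borel (Y 0)"
    and "integrable M (\<lambda>\<omega>. (norm (X 0 \<omega>))\<^sup>2)" and "integrable M (\<lambda>\<omega>. (norm (Y 0 \<omega>))\<^sup>2)"
    and "kernel_eigen_enum (distr M borel (\<lambda>\<omega>. (X 0 \<omega>, Y 0 \<omega>)))
           (\<lambda>z z'. 6 * hbar2 (distr M borel (\<lambda>\<omega>. (X 0 \<omega>, Y 0 \<omega>))) K u v z z') lam"
  shows "weak_conv_m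
           (\<lambda>n. distr M borel (\<lambda>\<omega>. real n * Omegabar K u v n (\<lambda>i. X i \<omega>) (\<lambda>i. Y i \<omega>)))
           (distr (\<Pi>\<^sub>M i\<in>UNIV. std_normal_distribution) borel
              (\<lambda>z. \<Sum>i. lam i * ((z i)\<^sup>2 - 1)))
       \<and> summable lam
       \<and> (\<Sum>i. lam i) = Cconst CARD('p) * Cconst CARD('q) / real K *
           (\<Sum>k<K. (\<integral>\<omega>. \<bar>u k \<bullet> (X 0 \<omega> - X 1 \<omega>)\<bar> \<partial>M) * (\<integral>\<omega>. \<bar>v k \<bullet> (Y 0 \<omega> - Y 1 \<omega>)\<bar> \<partial>M))
       \<and> summable (\<lambda>i. (lam i)\<^sup>2)
       \<and> (\<Sum>i. (lam i)\<^sup>2) = (Cconst CARD('p))\<^sup>2 * (Cconst CARD('q))\<^sup>2 / (real K)\<^sup>2 *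
           (\<Sum>k<K. \<Sum>k'<K.
              dcov (distr M borel (\<lambda>\<omega>. (u k \<bullet> X 0 \<omega>, u k' \<bullet> X 0 \<omega>))) *
              dcov (distr M borel (\<lambda>\<omega>. (v k \<bullet> Y 0 \<omega>, v k' \<bullet> Y 0 \<omega>))))"
proof -
  interpret M: prob_space M by fact
  have X[measurable]: "X i \<in> borel_measurable M" and Y[measurable]: "Y i \<in> borel_measurable M" for i
    using assms(5,6) by auto
  define N1 where "N1 = distr M borel (X 0)"
  define N2 where "N2 = distr M borel (Y 0)"
  define Z where "Z i \<omega> = (X i \<omega>, Y i \<omega>)" for i \<omega>
  define p where "p k x = u k \<bullet> x" for k x
  define q where "q k y = v k \<bullet> y" for k y
  define C where "C = Cconst CARD('p) * Cconst CARD('q)"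
  define c where "c = C / real K"
  have sets_N[measurable_cong]: "sets N1 = sets borel" "sets N2 = sets borel" by (simp_all add: N1_def N2_def)
  have prob_N: "prob_space N1" "prob_space N2"
    unfolding N1_def N2_def by (rule M.prob_space_distr; simp)+
  have Z_m[measurable]: "Z i \<in> measurable M (N1 \<Otimes>\<^sub>M N2)" for i
    unfolding Z_def by measurable
  have law0: "distr M borel (Z 0) = N1 \<Otimes>\<^sub>M N2"
    using assms(9) unfolding Z_def[abs_def] N1_def N2_def .
  have sets_prod: "sets (N1 \<Otimes>\<^sub>M N2) = sets borel"
    unfolding law0[symmetric] by simp
  have law_Z: "distr M borel (Z i) = N1 \<Otimes>\<^sub>M N2" for i
    using assms(8) law0 unfolding Z_def[abs_def] by metis
  have law_Z': "distr M (N1 \<Otimes>\<^sub>M N2) (Z i) = N1 \<Otimes>\<^sub>M N2" for i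
  proof -
    have "distr M (N1 \<Otimes>\<^sub>M N2) (Z i) = distr M borel (Z i)"
      by (rule distr_cong) (simp_all add: sets_prod)
    then show ?thesis by (simp add: law_Z)
  qed
  \<comment> \<open>Independence depends only on the sigma-algebra of the target, and
    \<open>sets_prod\<close> identifies that of the product law with the Borel sets.\<close>
  have ind_Z: "M.indep_vars (\<lambda>_. N1 \<Otimes>\<^sub>M N2) Z UNIV"
    using assms(7) unfolding prob_space.indep_vars_def[OF assms(1)] Z_def[abs_def]
    by (simp add: sets_prod measurable_cong_sets[OF refl sets_prod])
  interpret N1: prob_space N1 by (rule prob_N)
  interpret N2: prob_space N2 by (rule prob_N)
  interpret N12: pair_prob_space N1 N2 ..
  have X_ind: "M.indep_vars (\<lambda>_. N1) X UNIV" and Y_ind: "M.indep_vars (\<lambda>_. N2) Y UNIV"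
  proof -
    have "M.indep_vars (\<lambda>_. N1) (\<lambda>i \<omega>. fst (Z i \<omega>)) UNIV" "M.indep_vars (\<lambda>_. N2) (\<lambda>i \<omega>. snd (Z i \<omega>)) UNIV"
      by (rule M.indep_vars_compose2[OF ind_Z]; simp)+
    then show "M.indep_vars (\<lambda>_. N1) X UNIV" "M.indep_vars (\<lambda>_. N2) Y UNIV" by (simp_all add: Z_def)
  qed
  have bX: "distr M borel (X i) = N1" and bY: "distr M borel (Y i) = N2" for i
  proof -
    have m: "fst \<in> borel_measurable (borel :: ((real^'p) \<times> (real^'q)) measure)" "snd \<in> borel_measurable (borel :: ((real^'p) \<times> (real^'q)) measure)"
      unfolding borel_prod[symmetric] by measurable
    have Zb: "Z i \<in> borel_measurable M" for i using Z_m[of i] by (simp add: measurable_cong_sets[OF refl sets_prod])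
    have "distr M borel (X i) = distr (distr M borel (Z i)) borel fst" for i
      by (subst distr_distr[OF m(1) Zb]) (simp add: comp_def Z_def)
    then show "distr M borel (X i) = N1" unfolding N1_def law_Z by metis
    have "distr M borel (Y i) = distr (distr M borel (Z i)) borel snd" for i
      by (subst distr_distr[OF m(2) Zb]) (simp add: comp_def Z_def)
    then show "distr M borel (Y i) = N2" unfolding N2_def law_Z by metis
  qed
  have X_law: "distr M N1 (X i) = N1" and Y_law: "distr M N2 (Y i) = N2" for i
  proof -
    have "distr M N1 (X i) = distr M borel (X i)" by (rule distr_cong) (simp_all add: sets_N)
    then show "distr M N1 (X i) = N1" by (simp add: bX)
    have "distr M N2 (Y i) = distr M borel (Y i)" by (rule distr_cong) (simp_all add: sets_N)
    then show "distr M N2 (Y i) = N2" by (simp add: bY)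
  qed
  have C_nn: "C \<ge> 0" unfolding C_def by (intro mult_nonneg_nonneg Cconst_nonneg) simp_all
  have p_eq: "p k = (\<lambda>x. u k \<bullet> x)" and q_eq: "q k = (\<lambda>y. v k \<bullet> y)" for k by (simp_all add: p_def q_def fun_eq_iff)
  interpret F: product_features N1 N2 K p q c
  proof (rule product_features.intro)
    show "centered_distance N1 (p k)" for k
      unfolding N1_def p_eq by (rule M.centered_distance_distr[OF X assms(10)])
    show "centered_distance N2 (q k)" for k
      unfolding N2_def q_eq by (rule M.centered_distance_distr[OF Y assms(11)])
    show "0 \<le> c" using C_nn by (simp add: c_def)
  qed
  \<comment> \<open>The 6 cancels the 1/6 left by integrating out two of the four points, so the
    given operator has the Gram kernel of \<open>F.\<Phi>\<close>.\<close>
  have kernel: "6 * hbar2 F.\<mu> K u v z z' = F.\<kappa>\<mu> (z, z')" for z z'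
  proof -
    have "hbar2 F.\<mu> K u v z z' = (1 / real K) * (\<Sum>k<K. C * (F.P.A k (fst z, fst z') * F.Q.A k (snd z, snd z') / 6))"
      using F.double_integral_h4[of "1 / real K" C z z'] unfolding hbar2_def hbar4_def C_def p_def q_def .
    also have "6 * \<dots> = F.\<kappa>\<mu> (z, z')"
      unfolding F.\<kappa>\<mu>_def prod.case unfolding c_def by (simp add: sum_distrib_left sum_divide_distrib)
    finally show ?thesis .
  qed
  have "kernel_eigen_enum F.\<mu> (\<lambda>z z'. F.\<kappa>\<mu> (z, z')) lam"
    using assms(12) unfolding law0[unfolded Z_def[abs_def]] kernel .
  then obtain \<phi>' where
    e1: "\<forall>i. lam i \<noteq> 0 \<longrightarrow> \<phi>' i \<in> borel_measurable F.\<mu> \<and> integrable F.\<mu> (\<lambda>z. (\<phi>' i z)\<^sup>2) \<and>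
            (AE z in F.\<mu>. (\<integral>z'. F.\<kappa>\<mu> (z, z') * \<phi>' i z' \<partial>F.\<mu>) = lam i * \<phi>' i z)"
    and e2: "\<forall>i j. lam i \<noteq> 0 \<longrightarrow> lam j \<noteq> 0 \<longrightarrow> (\<integral>z. \<phi>' i z * \<phi>' j z \<partial>F.\<mu>) = (if i = j then 1 else 0)"
    and e3: "\<forall>d g. d \<noteq> 0 \<longrightarrow> g \<in> borel_measurable F.\<mu> \<longrightarrow> integrable F.\<mu> (\<lambda>z. (g z)\<^sup>2) \<longrightarrow>
            (AE z in F.\<mu>. (\<integral>z'. F.\<kappa>\<mu> (z, z') * g z' \<partial>F.\<mu>) = d * g z) \<longrightarrow>
            (\<forall>i. lam i = d \<longrightarrow> (\<integral>z. g z * \<phi>' i z \<partial>F.\<mu>) = 0) \<longrightarrow> (AE z in F.\<mu>. g z = 0)"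
    unfolding kernel_eigen_enum_def by (elim exE conjE) (rule that)
  \<comment> \<open>Where \<open>lam i = 0\<close> nothing is known of \<open>\<phi>' i\<close>, not
    even measurability, so the zero function takes its place.\<close>
  define \<phi> where "\<phi> i = (if lam i \<noteq> 0 then \<phi>' i else (\<lambda>_. 0))" for i
  have fk: "feature_kernel F.\<mu> F.\<nu> F.\<Phi> lam \<phi>"
  proof (rule feature_kernel.intro[OF F.sf_\<mu> F.sf_\<nu> F.\<Phi>_L2])
    show "\<phi> i \<in> L2 F.\<mu>" for i using e1 by (auto simp: \<phi>_def L2_def)
    show "ip F.\<mu> (\<phi> i) (\<phi> j) = (if i = j \<and> lam i \<noteq> 0 then 1 else 0)" for i j
      using e2 by (auto simp: \<phi>_def ip_def)
    show "AE x in F.\<mu>. (\<integral>y. hs_comp F.\<nu> F.\<Phi> (tr F.\<Phi>) (x, y) * \<phi> i y \<partial>F.\<mu>) = lam i * \<phi> i x" for i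
      using e1 by (auto simp: \<phi>_def F.hs_comp_\<Phi>)
    show "AE x in F.\<mu>. g x = 0"
      if "d \<noteq> 0" "g \<in> L2 F.\<mu>" "AE x in F.\<mu>. (\<integral>y. hs_comp F.\<nu> F.\<Phi> (tr F.\<Phi>) (x, y) * g y \<partial>F.\<mu>) = d * g x"
        "\<And>i. ip F.\<mu> g (\<phi> i) = 0" for d g
    proof (rule e3[rule_format, OF that(1)])
      \<comment> \<open>As \<open>d\<close> is not zero, \<open>\<phi> i\<close> is the original
        eigenfunction at these indices.\<close>
      fix i assume "lam i = d"
      then show "(\<integral>z. g z * \<phi>' i z \<partial>F.\<mu>) = 0" using that(1) that(4)[of i] by (simp add: \<phi>_def ip_def)
    qed (use that in \<open>auto simp: L2_def F.hs_comp_\<Phi>\<close>)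
  qed
  interpret I: iid_feature_kernel F.\<mu> F.\<nu> F.\<Phi> lam \<phi> M Z
  proof (rule iid_feature_kernel.intro[OF fk assms(1) iid_feature_kernel_axioms.intro])
    show "(\<integral>z'. hs_comp F.\<nu> F.\<Phi> (tr F.\<Phi>) (z, z') \<partial>F.\<mu>) = 0" for z
      by (simp add: F.hs_comp_\<Phi> F.\<kappa>\<mu>_degenerate)
  qed (rule F.prob_\<mu> ind_Z law_Z' F.\<Phi>_slice_L2)+
  have \<kappa>_eq: "I.\<kappa> = F.\<kappa>\<mu>" by (simp add: I.\<kappa>_def F.hs_comp_\<Phi>)
  have dk: "degenerate_kernel M N1 X (F.P.A k)" "degenerate_kernel M N2 Y (F.Q.A k)" for k
    by (intro degenerate_kernel.intro degenerate_kernel_axioms.intro assms(1) prob_N X_ind Y_ind X_law Y_law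
        F.P.A_L2 F.Q.A_L2 F.P.A_degenerate F.Q.A_degenerate; rule F.P.A_sym F.Q.A_sym)+
  have ik: "independent_kernels M N1 X (F.P.A k) N2 Y (F.Q.A k)" for k
  proof (rule independent_kernels.intro[OF dk independent_kernels_axioms.intro])
    fix f :: "(nat \<Rightarrow> real^'p) \<Rightarrow> real" and g :: "(nat \<Rightarrow> real^'q) \<Rightarrow> real"
    assume f: "f \<in> borel_measurable (\<Pi>\<^sub>M i\<in>UNIV. N1)" and g: "g \<in> borel_measurable (\<Pi>\<^sub>M i\<in>UNIV. N2)"
    have s: "sets (\<Pi>\<^sub>M i\<in>(UNIV::nat set). N1) = sets (\<Pi>\<^sub>M i\<in>UNIV. borel)" "sets (\<Pi>\<^sub>M i\<in>(UNIV::nat set). N2) = sets (\<Pi>\<^sub>M i\<in>UNIV. borel)"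
      by (intro sets_PiM_cong refl sets_N)+
    show "M.indep_var borel (\<lambda>\<omega>. f (\<lambda>i. X i \<omega>)) borel (\<lambda>\<omega>. g (\<lambda>i. Y i \<omega>))"
    proof (rule M.indep_var_sequences[of X Y f g])
      show "M.indep_vars (\<lambda>_. borel) (\<lambda>i \<omega>. (X i \<omega>, Y i \<omega>)) UNIV" by (rule assms(7))
      show "distr M borel (\<lambda>\<omega>. (X i \<omega>, Y i \<omega>)) = distr M borel (X i) \<Otimes>\<^sub>M distr M borel (Y i)" for i
        using law_Z[of i] by (simp add: bX bY Z_def[abs_def])
      show "f \<in> borel_measurable (\<Pi>\<^sub>M i\<in>UNIV. borel)" using f by (simp add: measurable_cong_sets[OF s(1) refl])
      show "g \<in> borel_measurable (\<Pi>\<^sub>M i\<in>UNIV. borel)" using g by (simp add: measurable_cong_sets[OF s(2) refl])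
    qed auto
  qed (rule F.P.A_diag_L2 F.Q.A_diag_L2)+
  interpret R: independent_kernels M N1 X "F.P.A k" N2 Y "F.Q.A k" for k by (rule ik)
  define D where "D n \<omega> = real n * Omegabar K u v n (\<lambda>i. X i \<omega>) (\<lambda>i. Y i \<omega>)" for n \<omega>
  define \<tau> where "\<tau> = nrm2 (F.\<mu> \<Otimes>\<^sub>M F.\<nu>) F.\<Phi>"
  have D_m: "D n \<in> borel_measurable M" for n
    unfolding D_def Omegabar_def Omega_n_def Let_def by measurable
  \<comment> \<open>The traces of the two centred distances are both minus a mean distance, so the
    signs cancel in each product.\<close>
  have \<tau>_eq: "\<tau> = (\<Sum>k<K. c * R.\<tau> k)"
    unfolding \<tau>_def F.nrm2_\<Phi> by (simp add: R.\<tau>_def F.P.A_trace F.Q.A_trace sum_distrib_left)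
  \<comment> \<open>From \<open>n = 4\<close> on centring leaves the statistic unchanged, so the
    total error is exactly the sum of the remainders of the single projections.\<close>
  have D_eq: "D n \<omega> + \<tau> - I.V n \<omega> = (\<Sum>k<K. c * R.remainder k n \<omega>)" if n: "n \<ge> 4" for n \<omega>
  proof -
    have om: "Omega_n n (\<lambda>i. u k \<bullet> X i \<omega>) (\<lambda>i. v k \<bullet> Y i \<omega>) = ucov n (\<lambda>i j. R.oA k i j \<omega>) (\<lambda>i j. R.oB k i j \<omega>)" for k
    proof -
      have "Omega_n n (\<lambda>i. u k \<bullet> X i \<omega>) (\<lambda>i. v k \<bullet> Y i \<omega>) = ucov n
         (\<lambda>i j. if i = j then 0 else \<bar>u k \<bullet> X i \<omega> - u k \<bullet> X j \<omega>\<bar> - F.P.mdist k (X i \<omega>) - F.P.mdist k (X j \<omega>) + F.P.mmdist k)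
         (\<lambda>i j. if i = j then 0 else \<bar>v k \<bullet> Y i \<omega> - v k \<bullet> Y j \<omega>\<bar> - F.Q.mdist k (Y i \<omega>) - F.Q.mdist k (Y j \<omega>) + F.Q.mmdist k)"
        unfolding Omega_n_eq_ucov by (rule ucov_centered[OF n]) (auto simp: abs_minus_commute)
      then show ?thesis
        unfolding R.A.offdiag_def R.B.offdiag_def
        by (simp add: F.P.A_def F.Q.A_def p_def q_def cong: if_cong)
    qed
    have "D n \<omega> = (\<Sum>k<K. c * (real n * ucov n (\<lambda>i j. R.oA k i j \<omega>) (\<lambda>i j. R.oB k i j \<omega>)))"
      by (simp add: D_def Omegabar_def om c_def C_def sum_distrib_left sum_divide_distrib mult_ac)
    moreover have "I.V n \<omega> = (\<Sum>k<K. c * ((\<Sum>i<n. \<Sum>j<n. F.P.A k (X i \<omega>, X j \<omega>) * F.Q.A k (Y i \<omega>, Y j \<omega>)) / real n))"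
    proof -
      have "(\<Sum>i<n. \<Sum>j<n. \<Sum>k<K. h i j k) = (\<Sum>k<K. \<Sum>i<n. \<Sum>j<n. h i j k)" for h :: "nat \<Rightarrow> nat \<Rightarrow> nat \<Rightarrow> real"
      proof -
        have "(\<Sum>i<n. \<Sum>j<n. \<Sum>k<K. h i j k) = (\<Sum>i<n. \<Sum>k<K. \<Sum>j<n. h i j k)"
          by (rule sum.cong[OF refl], rule sum.swap)
        also have "\<dots> = (\<Sum>k<K. \<Sum>i<n. \<Sum>j<n. h i j k)" by (rule sum.swap)
        finally show ?thesis .
      qed
      then show ?thesis
        by (simp add: I.V_def \<kappa>_eq F.\<kappa>\<mu>_def Z_def sum_distrib_left sum_divide_distrib)
    qed
    ultimately show ?thesis
      unfolding \<tau>_eq R.remainder_def by (simp add: sum.distrib sum_subtractf right_diff_distrib distrib_left)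
  qed
  have R_L2: "(\<lambda>\<omega>. \<Sum>k<K. c * R.remainder k n \<omega>) \<in> L2 M" if "n \<ge> 4" for n
    using that by (intro L2_sum L2_cmult R.remainder_L2)
  have int_of_L2: "integrable M f" if "f \<in> L2 M" for f
    by (rule M.square_integrable_imp_integrable) (use that in \<open>auto simp: L2_def\<close>)
  have small: "(\<lambda>n. \<integral>\<omega>. \<bar>D n \<omega> + \<tau> - I.V n \<omega>\<bar> \<partial>M) \<longlonglongrightarrow> 0"
  proof (rule tendsto_sandwich[OF _ _ tendsto_const])
    show "\<forall>\<^sub>F n in sequentially. (\<integral>\<omega>. \<bar>D n \<omega> + \<tau> - I.V n \<omega>\<bar> \<partial>M) \<le> (\<Sum>k<K. \<bar>c\<bar> * (\<integral>\<omega>. \<bar>R.remainder k n \<omega>\<bar> \<partial>M))"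
    proof (rule eventually_sequentiallyI[of 4])
      fix n :: nat assume n: "4 \<le> n"
      have i: "integrable M (\<lambda>\<omega>. \<bar>R.remainder k n \<omega>\<bar>)" for k
        by (intro integrable_abs int_of_L2 R.remainder_L2 n)
      have "(\<integral>\<omega>. \<bar>D n \<omega> + \<tau> - I.V n \<omega>\<bar> \<partial>M) \<le> (\<integral>\<omega>. (\<Sum>k<K. \<bar>c\<bar> * \<bar>R.remainder k n \<omega>\<bar>) \<partial>M)"
        unfolding D_eq[OF n]
      proof (rule integral_mono)
        show "integrable M (\<lambda>\<omega>. \<bar>\<Sum>k<K. c * R.remainder k n \<omega>\<bar>)" by (intro integrable_abs int_of_L2 R_L2 n)
        show "integrable M (\<lambda>\<omega>. \<Sum>k<K. \<bar>c\<bar> * \<bar>R.remainder k n \<omega>\<bar>)" by (intro Bochner_Integration.integrable_sum integrable_mult_right i)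
        fix \<omega> show "\<bar>\<Sum>k<K. c * R.remainder k n \<omega>\<bar> \<le> (\<Sum>k<K. \<bar>c\<bar> * \<bar>R.remainder k n \<omega>\<bar>)"
          using sum_abs[of "\<lambda>k. c * R.remainder k n \<omega>" "{..<K}"] by (simp add: abs_mult)
      qed
      also have "\<dots> = (\<Sum>k<K. \<bar>c\<bar> * (\<integral>\<omega>. \<bar>R.remainder k n \<omega>\<bar> \<partial>M))"
        using i by (simp add: Bochner_Integration.integral_sum)
      finally show "(\<integral>\<omega>. \<bar>D n \<omega> + \<tau> - I.V n \<omega>\<bar> \<partial>M) \<le> (\<Sum>k<K. \<bar>c\<bar> * (\<integral>\<omega>. \<bar>R.remainder k n \<omega>\<bar> \<partial>M))" .
    qed
    have "(\<lambda>n. \<Sum>k<K. \<bar>c\<bar> * (\<integral>\<omega>. \<bar>R.remainder k n \<omega>\<bar> \<partial>M)) \<longlonglongrightarrow> (\<Sum>k<K. \<bar>c\<bar> * 0)"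
      by (intro tendsto_intros R.remainder_tendsto)
    then show "(\<lambda>n. \<Sum>k<K. \<bar>c\<bar> * (\<integral>\<omega>. \<bar>R.remainder k n \<omega>\<bar> \<partial>M)) \<longlonglongrightarrow> 0" by simp
  qed auto
  have lam: "summable lam" "suminf lam = \<tau>"
    using I.lam_sums unfolding \<tau>_def by (auto simp: sums_iff)
  have AE_sum: "AE g in gauss_seq. summable (\<lambda>i. lam i * (g i)\<^sup>2)"
    by (rule gauss_seq_weighted_summable[OF lam(1) I.lam_nonneg])
  have "weak_conv_m (\<lambda>n. distr M borel (D n)) (distr gauss_seq borel (\<lambda>z. \<Sum>i. lam i * ((z i)\<^sup>2 - 1)))"
  proof (rule weak_conv_of_laplace[OF assms(1) prob_space_gauss_seq D_m, where V = I.V and Q = "\<lambda>g. \<Sum>i. lam i * (g i)\<^sup>2" and \<tau> = \<tau>])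
    show "(\<lambda>g. \<Sum>i. lam i * (g i)\<^sup>2) \<in> borel_measurable gauss_seq" by measurable
    show "(\<lambda>z. \<Sum>i. lam i * ((z i)\<^sup>2 - 1)) \<in> borel_measurable gauss_seq" by measurable
    show "AE g in gauss_seq. 0 \<le> (\<Sum>i. lam i * (g i)\<^sup>2)"
      using AE_sum by eventually_elim (intro suminf_nonneg mult_nonneg_nonneg I.lam_nonneg, auto)
    \<comment> \<open>The series is split where its first part converges; elsewhere
      \<open>suminf\<close> need not be additive, so the identity is claimed only almost
      surely.\<close>
    show "AE z in gauss_seq. (\<Sum>i. lam i * ((z i)\<^sup>2 - 1)) = (\<Sum>i. lam i * (z i)\<^sup>2) - \<tau>"
      using AE_sum
    proof eventually_elim
      case (elim g)
      from suminf_diff[OF this lam(1)] show ?case by (simp add: lam(2) right_diff_distrib)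
    qed
    show "\<forall>\<^sub>F n in sequentially. integrable M (\<lambda>\<omega>. D n \<omega> + \<tau> - I.V n \<omega>)"
      by (rule eventually_sequentiallyI[of 4]) (simp add: D_eq int_of_L2 R_L2)
  qed (auto intro: I.V_nonneg I.laplace_V_tendsto small)
  moreover have "\<tau> = C / real K * (\<Sum>k<K. (\<integral>\<omega>. \<bar>u k \<bullet> (X 0 \<omega> - X 1 \<omega>)\<bar> \<partial>M) * (\<integral>\<omega>. \<bar>v k \<bullet> (Y 0 \<omega> - Y 1 \<omega>)\<bar> \<partial>M))"
  proof -
    have "F.P.mmdist k = (\<integral>\<omega>. \<bar>u k \<bullet> (X 0 \<omega> - X 1 \<omega>)\<bar> \<partial>M)" "F.Q.mmdist k = (\<integral>\<omega>. \<bar>v k \<bullet> (Y 0 \<omega> - Y 1 \<omega>)\<bar> \<partial>M)" for k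
      unfolding p_eq q_eq by (intro M.mmdist_eq_expectation X_ind X_law Y_ind Y_law F.P[unfolded p_eq] F.Q[unfolded q_eq])+
    then show ?thesis unfolding \<tau>_def F.nrm2_\<Phi> unfolding c_def by simp
  qed
  moreover have "(\<lambda>i. (lam i)\<^sup>2) sums ((Cconst CARD('p))\<^sup>2 * (Cconst CARD('q))\<^sup>2 / (real K)\<^sup>2 *
     (\<Sum>k<K. \<Sum>k'<K. dcov (distr M borel (\<lambda>\<omega>. (u k \<bullet> X 0 \<omega>, u k' \<bullet> X 0 \<omega>))) *
              dcov (distr M borel (\<lambda>\<omega>. (v k \<bullet> Y 0 \<omega>, v k' \<bullet> Y 0 \<omega>)))))"
  proof -
    have "dcov (distr M borel (\<lambda>\<omega>. (u k \<bullet> X 0 \<omega>, u k' \<bullet> X 0 \<omega>))) = ip (N1 \<Otimes>\<^sub>M N1) (F.P.A k) (F.P.A k')"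
      "dcov (distr M borel (\<lambda>\<omega>. (v k \<bullet> Y 0 \<omega>, v k' \<bullet> Y 0 \<omega>))) = ip (N2 \<Otimes>\<^sub>M N2) (F.Q.A k) (F.Q.A k')" for k k'
      unfolding p_eq q_eq N1_def N2_def
      by (rule M.dcov_projections[OF X F.P[unfolded p_eq N1_def] F.P[unfolded p_eq N1_def]]
          M.dcov_projections[OF Y F.Q[unfolded q_eq N2_def] F.Q[unfolded q_eq N2_def]])+
    moreover have "c\<^sup>2 = (Cconst CARD('p))\<^sup>2 * (Cconst CARD('q))\<^sup>2 / (real K)\<^sup>2"
      by (simp add: c_def C_def power_divide power_mult_distrib)
    ultimately show ?thesis using I.lam_square_sums by (simp add: \<kappa>_eq F.nrm2_\<kappa>\<mu>)
  qed
  ultimately show ?thesis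
    using lam unfolding D_def[abs_def] C_def by (simp add: sums_iff)
qed

end
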